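(* Let $n\ge 1$, let $\Omega=\prod_{i=1}^n(\underline{x}_i,\overline{x}_i)\subset\mathbb{R}^n$ be a bounded rectangular domain, let $\alpha\in(0,1)$ be fixed, and let $p_i,q_i>0$ ($1\le i\le n$) be constants with $\sum_{i=1}^n(p_i+q_i)=1$. Given data $f$ on $\Omega$ and $g$ on $\partial\Omega$, consider the Dirichlet problem $$-\sum_{i=1}^{n}\partial_{x_i}\left(p_i J^{\alpha}_{\underline{x}_i}+q_i J^{\alpha}_{\overline{x}_i-}\right)\partial_{x_i}u=f\ \text{ in }\Omega,\qquad u=g\ \text{ on }\partial\Omega .$$ If this problem admits a non-trivial solution $u\in\hat H_1(\Omega)$, then $u$ is unique in the sense of $\hat H_{1-\alpha}(\Omega)$; that is, for any $u_1,u_2\in\hat H_1(\Omega)$ that both satisfy the problem, $$\|u_1-u_2\|_{\hat H_{1-\alpha}(\Omega)}=0 .$$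
   Context: Fractional integrals: for $\alpha>0$ and a function $u$ on $\Omega$, write $\boldsymbol{x}=(\hat x_i,x_i)$ with $\hat x_i=(x_1,\dots,x_{i-1},x_{i+1},\dots,x_n)$. The left and right Riemann-Liouville fractional integrals of order $\alpha$ in the variable $x_i$ are $$J^{\alpha}_{\underline{x}_i}u(\hat x_i,x_i)=\frac{1}{\Gamma(\alpha)}\int_{\underline{x}_i}^{x_i}(x_i-w)^{\alpha-1}u(\hat x_i,w)\,dw,\qquad J^{\alpha}_{\overline{x}_i-}u(\hat x_i,x_i)=\frac{1}{\Gamma(\alpha)}\int_{x_i}^{\overline{x}_i}(w-x_i)^{\alpha-1}u(\hat x_i,w)\,dw,$$ where $\Gamma$ is the Gamma function. Fractional derivatives: for $s\in(0,1)$, the left Riemann-Liouville derivative of order $s$ in $x_i$ is $\partial^{s}_{x_i}u=\partial_{x_i}J^{1-s}_{\underline{x}_i}u$; for $s=1$, $\partial^{1}_{x_i}=\partial_{x_i}$ is the usual (weak) derivative. Spaces: for $s\in(0,1]$, $$\hat H_s(\Omega)=\{v\in L^2(\Omega):\ \partial^s_{x_i}v\in L^2(\Omega)\text{ for all } i=1,\dots,n\},\qquad \|v\|^2_{\hat H_s(\Omega)}=\sum_{i=1}^n\|\partial^s_{x_i}v\|^2_{L^2(\Omega)} .$$ Meaning of solution: for $u\in\hat H_1(\Omega)$ the functions $J^{\alpha}_{\underline{x}_i}\partial_{x_i}u$ and $J^{\alpha}_{\overline{x}_i-}\partial_{x_i}u$ lie in $L^2(\Omega)$. The equation is understood in the sense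 of distributions in $\Omega$ (outer derivatives $\partial_{x_i}$ being distributional), and the boundary condition in the sense of traces. *)

theory Defs
  imports "HOL-Analysis.Analysis"
begin

text \<open>Throughout, the rectangular domain is \<^term>\<open>box a b\<close> with \<open>a $ i < b $ i\<close>, and functions on it are
  total functions on \<open>real ^ 'n\<close> of which only the values on the domain (for boundary data: on its
  boundary) matter. Elements of function spaces are represented by functions, not by classes modulo
  null sets.\<close>

section \<open>Square integrable functions\<close>

definition L2 :: "'a measure \<Rightarrow> ('a \<Rightarrow> real) \<Rightarrow> bool" where
  "L2 M v \<longleftrightarrow> v \<in> borel_measurable M \<and> integrable M (\<lambda>x. (v x)\<^sup>2)"

definition L2_norm :: "'a measure \<Rightarrow> ('a \<Rightarrow> real) \<Rightarrow> real" where
  "L2_norm M v = sqrt (\<integral>x. (v x)\<^sup>2 \<partial>M)"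

section \<open>Smooth functions, test functions and distributions\<close>

definition pderiv_at :: "'n \<Rightarrow> (real ^ 'n::finite \<Rightarrow> real) \<Rightarrow> real ^ 'n \<Rightarrow> real" where
  "pderiv_at i \<phi> x = frechet_derivative \<phi> (at x) (axis i 1)"

text \<open>If all iterated partial derivatives exist and are Frechet differentiable, then they are
  all continuous, so this is the usual notion of an infinitely differentiable function.\<close>

definition smooth :: "(real ^ 'n::finite \<Rightarrow> real) \<Rightarrow> bool" where
  "smooth \<phi> \<longleftrightarrow> (\<forall>is x. foldr pderiv_at is \<phi> differentiable at x)"

definition test_function :: "(real ^ 'n::finite) set \<Rightarrow> (real ^ 'n \<Rightarrow> real) \<Rightarrow> bool" where
  "test_function \<Omega> \<phi> \<longleftrightarrow> smooth \<phi> \<and> compact (closure {x. \<phi> x \<noteq> 0}) \<and> closure {x. \<phi> x \<noteq> 0} \<subseteq> \<Omega>"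

type_synonym 'n functional = "(real ^ 'n \<Rightarrow> real) \<Rightarrow> real"

definition distribution :: "(real ^ 'n::finite) set \<Rightarrow> 'n functional \<Rightarrow> bool" where
  "distribution \<Omega> T \<longleftrightarrow>
     (\<forall>\<phi> \<psi>. test_function \<Omega> \<phi> \<longrightarrow> test_function \<Omega> \<psi> \<longrightarrow> T (\<lambda>x. \<phi> x + \<psi> x) = T \<phi> + T \<psi>) \<and>
     (\<forall>c \<phi>. test_function \<Omega> \<phi> \<longrightarrow> T (\<lambda>x. c * \<phi> x) = c * T \<phi>) \<and>
     (\<forall>K. compact K \<and> K \<subseteq> \<Omega> \<longrightarrow>
       (\<exists>C N. \<forall>\<phi> B. test_function \<Omega> \<phi> \<and> closure {x. \<phi> x \<noteq> 0} \<subseteq> K \<and>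
           (\<forall>is x. length is \<le> N \<longrightarrow> \<bar>foldr pderiv_at is \<phi> x\<bar> \<le> B) \<longrightarrow> \<bar>T \<phi>\<bar> \<le> C * B))"

definition regular_distribution ::
    "(real ^ 'n::finite) set \<Rightarrow> (real ^ 'n \<Rightarrow> real) \<Rightarrow> 'n functional" where
  "regular_distribution \<Omega> F \<phi> = (\<integral>x. F x * \<phi> x \<partial>lebesgue_on \<Omega>)"

definition distributional_deriv :: "'n::finite \<Rightarrow> 'n functional \<Rightarrow> 'n functional" where
  "distributional_deriv i T \<phi> = - T (pderiv_at i \<phi>)"

lemma distribution_regular_distribution:
  fixes F :: "real ^ 'n::finite \<Rightarrow> real"
  assumes \<Omega>: "open \<Omega>" and F: "\<And>K. compact K \<Longrightarrow> K \<subseteq> \<Omega> \<Longrightarrow> set_integrable lebesgue K F"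
  shows "distribution \<Omega> (regular_distribution \<Omega> F)"
proof -
  have meas: "\<phi> \<in> borel_measurable borel" and cont: "continuous_on A \<phi>"
    if "test_function \<Omega> \<phi>" for \<phi> A
  proof -
    have "\<phi> differentiable at x" for x
      using that unfolding test_function_def smooth_def by (metis foldr.simps(1) id_apply)
    then have c: "continuous_on A \<phi>" for A
      by (meson continuous_at_imp_continuous_on differentiable_imp_continuous_within)
    show "continuous_on A \<phi>" by (rule c)
    show "\<phi> \<in> borel_measurable borel" using c by (rule borel_measurable_continuous_onI)
  qed
  have om: "\<Omega> \<inter> space lebesgue \<in> sets lebesgue" using \<Omega> by auto
  have core: "integrable (lebesgue_on \<Omega>) (\<lambda>x. F x * \<phi> x) \<and>
      \<bar>regular_distribution \<Omega> F \<phi>\<bar> \<le> (\<integral>x. norm (indicator K x *\<^sub>R F x) \<partial>lebesgue) * B"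
    if t: "test_function \<Omega> \<phi>" and K: "compact K" "K \<subseteq> \<Omega>" "closure {x. \<phi> x \<noteq> 0} \<subseteq> K"
      and B: "\<And>x. \<bar>\<phi> x\<bar> \<le> B" for \<phi> K B
  proof -
    let ?G = "\<lambda>x. indicator K x *\<^sub>R F x"
    have G: "integrable lebesgue ?G" using F[OF K(1,2)] by (simp add: set_integrable_def)
    have z: "\<phi> x = 0" if "x \<notin> K" for x using subsetD[OF subset_trans[OF closure_subset K(3)], of x] that by blast
    have eq: "indicator \<Omega> x *\<^sub>R (F x * \<phi> x) = ?G x * \<phi> x" for x
      using z[of x] K(2) by (auto simp: indicator_def)
    have "\<phi> \<in> borel_measurable lebesgue"
      using meas[OF t] by (intro measurable_completion) simp
    then have m: "(\<lambda>x. ?G x * \<phi> x) \<in> borel_measurable lebesgue"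
      by (intro borel_measurable_times borel_measurable_integrable[OF G])
    have le: "norm (?G x * \<phi> x) \<le> norm (?G x) * B" for x
      unfolding norm_mult by (intro mult_left_mono) (use B in auto)
    have GB: "integrable lebesgue (\<lambda>x. norm (?G x) * B)" using G by (intro integrable_mult_left integrable_norm)
    have i: "integrable lebesgue (\<lambda>x. ?G x * \<phi> x)"
    proof (rule Bochner_Integration.integrable_bound[OF GB m], rule AE_I2)
      show "norm (?G x * \<phi> x) \<le> norm (norm (?G x) * B)" for x
        using order_trans[OF le abs_ge_self] by (simp only: real_norm_def)
    qed
    have 1: "integrable (lebesgue_on \<Omega>) (\<lambda>x. F x * \<phi> x)"
      unfolding integrable_restrict_space[OF om] eq by (rule i)
    have "regular_distribution \<Omega> F \<phi> = (\<integral>x. ?G x * \<phi> x \<partial>lebesgue)"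
      unfolding regular_distribution_def integral_restrict_space[OF om] eq ..
    also have "\<bar>\<dots>\<bar> \<le> (\<integral>x. norm (?G x) * B \<partial>lebesgue)"
      using order_trans[OF integral_norm_bound integral_mono[OF integrable_norm[OF i] GB le]]
      by (simp only: real_norm_def)
    also have "\<dots> = (\<integral>x. norm (?G x) \<partial>lebesgue) * B"
      by (rule integral_mult_left_zero)
    finally show ?thesis using 1 by blast
  qed
  have int: "integrable (lebesgue_on \<Omega>) (\<lambda>x. F x * \<phi> x)" if t: "test_function \<Omega> \<phi>" for \<phi>
  proof -
    let ?K = "closure {x. \<phi> x \<noteq> 0}"
    have K: "compact ?K" "?K \<subseteq> \<Omega>" using t by (auto simp: test_function_def)
    have "bounded (\<phi> ` ?K)"
      using compact_continuous_image[OF cont[OF t] K(1)] compact_imp_bounded by blast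
    then obtain B where B: "0 < B" "\<And>x. x \<in> ?K \<Longrightarrow> \<bar>\<phi> x\<bar> \<le> B"
      by (auto simp: bounded_pos)
    have "\<bar>\<phi> x\<bar> \<le> B" for x
      using B closure_subset[of "{x. \<phi> x \<noteq> 0}"] by (cases "\<phi> x = 0") auto
    then show ?thesis using core[OF t K order_refl] by blast
  qed
  have bound: "\<exists>C N. \<forall>\<phi> B. test_function \<Omega> \<phi> \<and> closure {x. \<phi> x \<noteq> 0} \<subseteq> K \<and>
           (\<forall>is x. length is \<le> N \<longrightarrow> \<bar>foldr pderiv_at is \<phi> x\<bar> \<le> B) \<longrightarrow>
           \<bar>regular_distribution \<Omega> F \<phi>\<bar> \<le> C * B" if "compact K" "K \<subseteq> \<Omega>" for K
  proof (intro exI allI impI, elim conjE)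
    fix \<phi> and B :: real
    assume t: "test_function \<Omega> \<phi>" and K: "closure {x. \<phi> x \<noteq> 0} \<subseteq> K"
      and B: "\<forall>is x. length is \<le> 0 \<longrightarrow> \<bar>foldr pderiv_at is \<phi> x\<bar> \<le> B"
    have "\<bar>\<phi> x\<bar> \<le> B" for x using B[rule_format, of "[]" x] by simp
    then show "\<bar>regular_distribution \<Omega> F \<phi>\<bar> \<le> (\<integral>x. norm (indicator K x *\<^sub>R F x) \<partial>lebesgue) * B"
      using core[OF t that K] by blast
  qed
  have add: "regular_distribution \<Omega> F (\<lambda>x. \<phi> x + \<psi> x) =
      regular_distribution \<Omega> F \<phi> + regular_distribution \<Omega> F \<psi>"
    if "test_function \<Omega> \<phi>" "test_function \<Omega> \<psi>" for \<phi> \<psi>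
    unfolding regular_distribution_def distrib_left
    by (rule Bochner_Integration.integral_add) (intro int that)+
  have scale: "regular_distribution \<Omega> F (\<lambda>x. c * \<phi> x) = c * regular_distribution \<Omega> F \<phi>" for c \<phi>
    unfolding regular_distribution_def mult.left_commute[of _ c] by (rule integral_mult_right_zero)
  show ?thesis
    unfolding distribution_def
  proof (intro conjI allI impI, goal_cases)
    case 1
    then show ?case by (rule add)
  next
    case 2
    show ?case by (rule scale)
  next
    case (3 K)
    show ?case by (rule bound) (rule 3[THEN conjunct1], rule 3[THEN conjunct2])
  qed
qed

section \<open>Weak and fractional derivatives\<close>

definition has_weak_pderiv ::
    "(real ^ 'n::finite) set \<Rightarrow> 'n \<Rightarrow> (real ^ 'n \<Rightarrow> real) \<Rightarrow> (real ^ 'n \<Rightarrow> real) \<Rightarrow> bool" where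
  "has_weak_pderiv \<Omega> i v w \<longleftrightarrow>
     (\<forall>\<phi>. test_function \<Omega> \<phi> \<longrightarrow>
       distributional_deriv i (regular_distribution \<Omega> v) \<phi> = regular_distribution \<Omega> w \<phi>)"

definition update_coord :: "real ^ 'n::finite \<Rightarrow> 'n \<Rightarrow> real \<Rightarrow> real ^ 'n" where
  "update_coord x i w = (\<chi> j. if j = i then w else x $ j)"

definition J_left ::
    "real ^ 'n::finite \<Rightarrow> real \<Rightarrow> 'n \<Rightarrow> (real ^ 'n \<Rightarrow> real) \<Rightarrow> real ^ 'n \<Rightarrow> real" where
  "J_left a \<alpha> i u x =
     1 / Gamma \<alpha> * (LINT w:{a $ i<..<x $ i}|lebesgue. (x $ i - w) powr (\<alpha> - 1) * u (update_coord x i w))"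

definition J_right ::
    "real ^ 'n::finite \<Rightarrow> real \<Rightarrow> 'n \<Rightarrow> (real ^ 'n \<Rightarrow> real) \<Rightarrow> real ^ 'n \<Rightarrow> real" where
  "J_right b \<alpha> i u x =
     1 / Gamma \<alpha> * (LINT w:{x $ i<..<b $ i}|lebesgue. (w - x $ i) powr (\<alpha> - 1) * u (update_coord x i w))"

text \<open>For \<open>0 < s \<le> 1\<close>: \<open>w\<close> is a square integrable version of the left Riemann-Liouville
  derivative of order \<open>s\<close> of \<open>v\<close>, the outer derivative being taken in the weak sense. For \<open>s = 1\<close> this is
  the weak partial derivative.\<close>

definition has_RL_deriv ::
    "real ^ 'n::finite \<Rightarrow> real ^ 'n \<Rightarrow> real \<Rightarrow> 'n \<Rightarrow> (real ^ 'n \<Rightarrow> real) \<Rightarrow> (real ^ 'n \<Rightarrow> real) \<Rightarrow> bool" where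
  "has_RL_deriv a b s i v w \<longleftrightarrow> L2 (lebesgue_on (box a b)) w \<and>
     has_weak_pderiv (box a b) i (if s = 1 then v else J_left a (1 - s) i v) w"

text \<open>A representative of the derivative, which is unique up to null sets; it is meaningful only if a
  square integrable derivative exists.\<close>

definition RL_deriv ::
    "real ^ 'n::finite \<Rightarrow> real ^ 'n \<Rightarrow> real \<Rightarrow> 'n \<Rightarrow> (real ^ 'n \<Rightarrow> real) \<Rightarrow> real ^ 'n \<Rightarrow> real" where
  "RL_deriv a b s i v = (SOME w. has_RL_deriv a b s i v w)"

definition H_space :: "real ^ 'n::finite \<Rightarrow> real ^ 'n \<Rightarrow> real \<Rightarrow> (real ^ 'n \<Rightarrow> real) set" where
  "H_space a b s =
     {v. L2 (lebesgue_on (box a b)) v \<and> (\<forall>i. \<exists>w. has_RL_deriv a b s i v w)}"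

text \<open>Meaningful only on \<^term>\<open>H_space a b s\<close>.\<close>

definition H_norm :: "real ^ 'n::finite \<Rightarrow> real ^ 'n \<Rightarrow> real \<Rightarrow> (real ^ 'n \<Rightarrow> real) \<Rightarrow> real" where
  "H_norm a b s v = sqrt (\<Sum>i\<in>UNIV. (L2_norm (lebesgue_on (box a b)) (RL_deriv a b s i v))\<^sup>2)"

section \<open>Traces on the boundary of the box\<close>

text \<open>The surface measure on the hyperplane of all \<open>x\<close> with \<open>x $ i = c\<close>: Lebesgue measure in the remaining
  coordinates. If there are none (dimension one), it is the point mass at \<open>c\<close>.\<close>

definition hyperplane_measure :: "'n \<Rightarrow> real \<Rightarrow> (real ^ 'n::finite) measure" where
  "hyperplane_measure i c =
     distr (\<Pi>\<^sub>M j\<in>UNIV - {i}. lborel) borel (\<lambda>y. \<chi> j. if j = i then c else y j)"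

definition face_measure ::
    "real ^ 'n::finite \<Rightarrow> real ^ 'n \<Rightarrow> 'n \<Rightarrow> real \<Rightarrow> (real ^ 'n) measure" where
  "face_measure a b i c =
     restrict_space (completion (hyperplane_measure i c)) {x \<in> cbox a b. x $ i = c}"

text \<open>The trace operator is the continuous extension, from the full first-order Sobolev norm to \<open>L2\<close> of the
  boundary, of the restriction of functions that are smooth up to the boundary. The boundary of the box is the
  union of its \<open>2n\<close> faces, which overlap only in null sets of the surface measure, so that
  convergence in \<open>L2\<close> of the boundary is convergence in \<open>L2\<close> of every face.\<close>

definition has_trace ::
    "real ^ 'n::finite \<Rightarrow> real ^ 'n \<Rightarrow> (real ^ 'n \<Rightarrow> real) \<Rightarrow> (real ^ 'n \<Rightarrow> real) \<Rightarrow> bool" where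
  "has_trace a b u g \<longleftrightarrow>
     u \<in> H_space a b 1 \<and>
     (\<forall>i. \<forall>c\<in>{a $ i, b $ i}. L2 (face_measure a b i c) g) \<and>
     (\<exists>\<phi> :: nat \<Rightarrow> real ^ 'n \<Rightarrow> real.
        (\<forall>k. smooth (\<phi> k)) \<and>
        (\<lambda>k. L2_norm (lebesgue_on (box a b)) (\<lambda>x. \<phi> k x - u x)) \<longlonglongrightarrow> 0 \<and>
        (\<forall>i. (\<lambda>k. L2_norm (lebesgue_on (box a b))
                (\<lambda>x. pderiv_at i (\<phi> k) x - RL_deriv a b 1 i u x)) \<longlonglongrightarrow> 0) \<and>
        (\<forall>i. \<forall>c\<in>{a $ i, b $ i}.
           (\<lambda>k. L2_norm (face_measure a b i c) (\<lambda>x. \<phi> k x - g x)) \<longlonglongrightarrow> 0))"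

section \<open>The Dirichlet problem\<close>

text \<open>The datum \<open>f\<close> is a distribution; a locally integrable function \<open>F\<close> is the datum
  \<open>regular_distribution (box a b) F\<close>, see \<open>distribution_regular_distribution\<close>.\<close>

definition solves_equation ::
    "real ^ 'n::finite \<Rightarrow> real ^ 'n \<Rightarrow> real \<Rightarrow> ('n \<Rightarrow> real) \<Rightarrow> ('n \<Rightarrow> real) \<Rightarrow>
     'n functional \<Rightarrow> (real ^ 'n \<Rightarrow> real) \<Rightarrow> bool" where
  "solves_equation a b \<alpha> p q f u \<longleftrightarrow>
     (\<forall>\<phi>. test_function (box a b) \<phi> \<longrightarrow>
        - (\<Sum>i\<in>UNIV. distributional_deriv i (regular_distribution (box a b)
             (\<lambda>x. p i * J_left a \<alpha> i (RL_deriv a b 1 i u) x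
                + q i * J_right b \<alpha> i (RL_deriv a b 1 i u) x)) \<phi>) = f \<phi>)"

definition dirichlet_solution ::
    "real ^ 'n::finite \<Rightarrow> real ^ 'n \<Rightarrow> real \<Rightarrow> ('n \<Rightarrow> real) \<Rightarrow> ('n \<Rightarrow> real) \<Rightarrow>
     'n functional \<Rightarrow> (real ^ 'n \<Rightarrow> real) \<Rightarrow> (real ^ 'n \<Rightarrow> real) \<Rightarrow> bool" where
  "dirichlet_solution a b \<alpha> p q f g u \<longleftrightarrow>
     u \<in> H_space a b 1 \<and> solves_equation a b \<alpha> p q f u \<and> has_trace a b u g"

end

(*
  Both solutions have the same boundary values, so their difference u is a limit of smooth functions whose
  boundary values tend to 0. Hence the equation for u, known for test functions, may be tested with u
  itself: the sum over i of the integrals of (p_i J_left + q_i J_right) u_i times u_i vanishes, where u_i is the i-th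
  partial derivative of u. With A_i(r) the autocorrelation of u_i (extended by 0) in direction i, both fractional
  integrals contribute the same energy, the integral of r^(alpha-1) A_i(r) over r > 0 up to a factor.
  Since r^(alpha-1) is a superposition of the tents max(0, R - r) with weights proportional to R^(alpha-3), and a tent
  tested against A_i is half the squared L2 norm of the integrals of u_i over segments of length R,
  every energy is nonnegative and vanishes only if u_i = 0. So the gradient of u vanishes, the
  Poincare inequality gives u = 0, and the fractional derivatives of u vanish as well.
*)
theory Submission
  imports Defs
begin

section \<open>Square integrable functions\<close>

text \<open>Obstacle: the equation is known only for test functions, while the approximants of u are
  smooth functions whose values on the faces are merely small. They are not turned into test
  functions. Instead a kernel K(x, z), a dilated and mollified delta, is a test function of x for
  every z in the box, so the flux is orthogonal to its x-gradient. Its x- and z-gradients are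
  proportional, and integrating by parts in z moves the derivative onto the approximants; what
  remains are face integrals. Their bound blows up as the dilation parameter delta tends to 0, so
  the approximation index goes to infinity first, with delta fixed.

  The tents and the power R^(alpha-3) come from Taylor's formula at infinity: r^(alpha-1) is the
  integral over R > r of (R - r) times the second derivative (1-alpha)(2-alpha) R^(alpha-3). This
  yields strict positivity without Fourier transforms.

  Solutions are Lebesgue measurable on the box. They are replaced by Borel functions on the whole
  space that vanish outside the box, so that translations and Fubini's theorem apply freely.\<close>

lemma L2_prod_integrable:
  assumes "L2 M f" "L2 M g"
  shows "integrable M (\<lambda>x. f x * g x)"
proof (rule Bochner_Integration.integrable_bound)
  show "integrable M (\<lambda>x. (f x)\<^sup>2 + (g x)\<^sup>2)"
    using assms by (auto simp: L2_def)
  show "(\<lambda>x. f x * g x) \<in> borel_measurable M"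
    using assms by (auto simp: L2_def)
  show "AE x in M. norm (f x * g x) \<le> norm ((f x)\<^sup>2 + (g x)\<^sup>2)"
  proof (rule AE_I2)
    fix x
    have "2 * (\<bar>f x\<bar> * \<bar>g x\<bar>) \<le> (f x)\<^sup>2 + (g x)\<^sup>2"
      using sum_squares_bound[of "\<bar>f x\<bar>" "\<bar>g x\<bar>"] by simp
    moreover have "0 \<le> \<bar>f x\<bar> * \<bar>g x\<bar>" by simp
    ultimately show "norm (f x * g x) \<le> norm ((f x)\<^sup>2 + (g x)\<^sup>2)"
      unfolding real_norm_def abs_mult by linarith
  qed
qed

lemma L2_add: "L2 M f \<Longrightarrow> L2 M g \<Longrightarrow> L2 M (\<lambda>x. f x + g x)"
  using L2_prod_integrable[of M f g] by (auto simp: L2_def power2_sum mult.assoc)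

lemma L2_cmult: "L2 M f \<Longrightarrow> L2 M (\<lambda>x. c * f x)"
  by (auto simp: L2_def power_mult_distrib)

lemma L2_diff: "L2 M f \<Longrightarrow> L2 M g \<Longrightarrow> L2 M (\<lambda>x. f x - g x)"
  using L2_add[of M f "\<lambda>x. (-1) * g x"] L2_cmult[of M g "-1"] by simp

lemma L2_norm_nonneg: "0 \<le> L2_norm M f"
  by (simp add: L2_norm_def)

lemma L2_norm_sq: "(L2_norm M f)\<^sup>2 = (\<integral>x. (f x)\<^sup>2 \<partial>M)"
  by (simp add: L2_norm_def)

text \<open>Cauchy-Schwarz, from the nonnegativity of the quadratic polynomial that maps
  \<open>t\<close> to the integral of the square of \<open>f + t * g\<close>.\<close>

lemma L2_inner_bound:
  assumes f: "L2 M f" and g: "L2 M g"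
  shows "\<bar>\<integral>x. f x * g x \<partial>M\<bar> \<le> L2_norm M f * L2_norm M g"
proof -
  let ?F = "\<integral>x. (f x)\<^sup>2 \<partial>M" and ?G = "\<integral>x. (g x)\<^sup>2 \<partial>M" and ?I = "\<integral>x. f x * g x \<partial>M"
  have i: "integrable M (\<lambda>x. (f x)\<^sup>2)" "integrable M (\<lambda>x. (g x)\<^sup>2)" "integrable M (\<lambda>x. f x * g x)"
    using f g L2_prod_integrable by (auto simp: L2_def)
  have q: "0 \<le> ?F + 2 * t * ?I + t\<^sup>2 * ?G" for t
  proof -
    have "0 \<le> (\<integral>x. (f x + t * g x)\<^sup>2 \<partial>M)" by simp
    also have "(\<lambda>x. (f x + t * g x)\<^sup>2) = (\<lambda>x. (f x)\<^sup>2 + 2 * t * (f x * g x) + t\<^sup>2 * (g x)\<^sup>2)"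
      by (auto simp: power2_eq_square algebra_simps)
    finally show ?thesis using i by simp
  qed
  have "?I\<^sup>2 \<le> ?F * ?G"
  proof (cases "?G = 0")
    case True
    have "?I = 0"
    proof (rule ccontr)
      assume n: "?I \<noteq> 0"
      \<comment> \<open>With \<open>?G = 0\<close> the polynomial is affine in \<open>t\<close>, and
        at this \<open>t\<close> it equals -1.\<close>
      have "0 \<le> ?F + 2 * (- (?F + 1) / (2 * ?I)) * ?I" using q[of "- (?F + 1) / (2 * ?I)"] True by simp
      then show False using n by (simp add: field_simps)
    qed
    then show ?thesis using True by simp
  next
    case False
    moreover have "0 \<le> ?G" by simp
    ultimately have G: "0 < ?G" by linarith
    have "0 \<le> ?F + 2 * (- ?I / ?G) * ?I + (- ?I / ?G)\<^sup>2 * ?G" by (rule q)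
    also have "\<dots> = ?F - ?I\<^sup>2 / ?G" using G by (simp add: power2_eq_square field_simps)
    finally show ?thesis using G by (simp add: field_simps)
  qed
  then have "sqrt (?I\<^sup>2) \<le> sqrt (?F * ?G)" by (rule real_sqrt_le_mono)
  then show ?thesis by (simp add: L2_norm_def real_sqrt_mult)
qed

lemma L2_norm_triangle:
  assumes f: "L2 M f" and g: "L2 M g"
  shows "L2_norm M (\<lambda>x. f x + g x) \<le> L2_norm M f + L2_norm M g"
proof (rule power2_le_imp_le)
  have i: "integrable M (\<lambda>x. (f x)\<^sup>2)" "integrable M (\<lambda>x. (g x)\<^sup>2)" "integrable M (\<lambda>x. f x * g x)"
    using f g L2_prod_integrable by (auto simp: L2_def)
  have "(L2_norm M (\<lambda>x. f x + g x))\<^sup>2 = (L2_norm M f)\<^sup>2 + 2 * (\<integral>x. f x * g x \<partial>M) + (L2_norm M g)\<^sup>2"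
    unfolding L2_norm_sq power2_sum using i by (simp add: mult.assoc)
  also have "\<dots> \<le> (L2_norm M f + L2_norm M g)\<^sup>2"
    using L2_inner_bound[OF f g] by (simp add: power2_sum)
  finally show "(L2_norm M (\<lambda>x. f x + g x))\<^sup>2 \<le> (L2_norm M f + L2_norm M g)\<^sup>2" .
qed (simp add: L2_norm_nonneg)

lemma L2_norm_minus: "L2_norm M (\<lambda>x. - f x) = L2_norm M f"
  by (simp add: L2_norm_def)

lemma L2_norm_triangle_diff:
  assumes "L2 M f" "L2 M g"
  shows "L2_norm M (\<lambda>x. f x - g x) \<le> L2_norm M f + L2_norm M g"
  using L2_norm_triangle[OF assms(1) L2_cmult[OF assms(2), of "-1"]] by (simp add: L2_norm_minus)

lemma L2_norm_diff_tendsto_0: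
  assumes "\<And>k. L2 M (f k)" "\<And>k. L2 M (g k)"
    and "(\<lambda>k. L2_norm M (f k)) \<longlonglongrightarrow> 0" "(\<lambda>k. L2_norm M (g k)) \<longlonglongrightarrow> 0"
  shows "(\<lambda>k. L2_norm M (\<lambda>x. f k x - g k x)) \<longlonglongrightarrow> 0"
proof (rule Lim_null_comparison)
  show "\<forall>\<^sub>F k in sequentially. norm (L2_norm M (\<lambda>x. f k x - g k x)) \<le> L2_norm M (f k) + L2_norm M (g k)"
    using L2_norm_triangle_diff[OF assms(1,2)] by (auto simp: L2_norm_nonneg)
  show "(\<lambda>k. L2_norm M (f k) + L2_norm M (g k)) \<longlonglongrightarrow> 0"
    using tendsto_add[OF assms(3,4)] by simp
qed

lemma L2_inner_tendsto:
  assumes "\<And>k. L2 M (f k)" "L2 M F" "L2 M g"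
    and "(\<lambda>k. L2_norm M (\<lambda>x. f k x - F x)) \<longlonglongrightarrow> 0"
  shows "(\<lambda>k. \<integral>x. g x * f k x \<partial>M) \<longlonglongrightarrow> (\<integral>x. g x * F x \<partial>M)"
proof (rule LIM_zero_cancel, rule Lim_null_comparison)
  show "\<forall>\<^sub>F k in sequentially. norm ((\<integral>x. g x * f k x \<partial>M) - (\<integral>x. g x * F x \<partial>M))
      \<le> L2_norm M g * L2_norm M (\<lambda>x. f k x - F x)"
  proof (rule always_eventually, rule allI)
    fix k
    have "(\<integral>x. g x * f k x \<partial>M) - (\<integral>x. g x * F x \<partial>M) = (\<integral>x. g x * (f k x - F x) \<partial>M)"
      unfolding right_diff_distrib
      by (rule Bochner_Integration.integral_diff[symmetric]) (intro L2_prod_integrable assms)+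
    then show "norm ((\<integral>x. g x * f k x \<partial>M) - (\<integral>x. g x * F x \<partial>M))
        \<le> L2_norm M g * L2_norm M (\<lambda>x. f k x - F x)"
      using L2_inner_bound[OF assms(3) L2_diff[OF assms(1)[of k] assms(2)]] by simp
  qed
  show "(\<lambda>k. L2_norm M g * L2_norm M (\<lambda>x. f k x - F x)) \<longlonglongrightarrow> 0"
    using tendsto_mult_right_zero[OF assms(4)] by simp
qed

lemma L2_norm_0_iff:
  assumes "L2 M f"
  shows "L2_norm M f = 0 \<longleftrightarrow> (AE x in M. f x = 0)"
  using assms integral_nonneg_eq_0_iff_AE[of M "\<lambda>x. (f x)\<^sup>2"] by (auto simp: L2_def L2_norm_def)

section \<open>Passing between Lebesgue and Borel measurable functions\<close>

text \<open>Integrands such as \<open>W (x - r *\<^sub>R e)\<close> must be jointly measurable in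
  \<open>x\<close> and \<open>r\<close> for the product of the Borel measures; Borel measurability
  survives this composition. Vanishing outside \<open>S\<close> lets every integral run over the
  whole space.\<close>

definition borel_rep :: "'a::euclidean_space set \<Rightarrow> ('a \<Rightarrow> real) \<Rightarrow> ('a \<Rightarrow> real) \<Rightarrow> bool" where
  "borel_rep S v V \<longleftrightarrow> V \<in> borel_measurable borel \<and> (\<forall>x. x \<notin> S \<longrightarrow> V x = 0) \<and>
     (AE x in lborel. x \<in> S \<longrightarrow> V x = v x)"

lemma borel_rep_ex:
  assumes S: "S \<in> sets borel" and v: "v \<in> borel_measurable (lebesgue_on S)"
  shows "\<exists>V. borel_rep S v V"
proof -
  have "(\<lambda>x. indicator S x *\<^sub>R v x) \<in> borel_measurable lebesgue"
    using S v by (subst (asm) borel_measurable_restrict_space_iff) auto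
  then obtain V where V: "V \<in> borel_measurable lborel" "AE x in lborel. indicator S x *\<^sub>R v x = V x"
    using completion_ex_borel_measurable_real[of "\<lambda>x. indicator S x *\<^sub>R v x" lborel] by auto
  have "borel_rep S v (\<lambda>x. indicator S x * V x)"
    unfolding borel_rep_def
  proof (intro conjI)
    show "(\<lambda>x. indicator S x * V x) \<in> borel_measurable borel" using V(1) S by simp
    show "AE x in lborel. x \<in> S \<longrightarrow> indicator S x * V x = v x"
      using V(2) by (auto elim!: eventually_mono simp: indicator_def)
  qed auto
  then show ?thesis by blast
qed

text \<open>The preimages of \<open>A\<close> under \<open>f\<close> and \<open>g\<close> differ by
  a subset of a null set, and the completion measures every such subset.\<close>

lemma borel_measurable_lebesgue_cong_AE:
  fixes f g :: "'a::euclidean_space \<Rightarrow> real"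
  assumes "g \<in> borel_measurable borel" and "AE x in lborel. f x = g x"
  shows "f \<in> borel_measurable lebesgue"
proof (rule measurableI)
  fix A :: "real set" assume A: "A \<in> sets borel"
  have g: "g -` A \<in> sets lebesgue"
    using assms(1) A by (metis measurable_sets_borel sets_completionI_sets sets_lborel)
  have *: "AE x in lborel. (f x \<in> A) = (g x \<in> A)" using assms(2) by auto
  have "AE x in lborel. \<not> ((f x \<in> A) \<noteq> (g x \<in> A))" using * by auto
  from sets_completion_AE[OF this] have "{x. (f x \<in> A) \<noteq> (g x \<in> A)} \<in> sets lebesgue"
    by (simp add: pred_def)
  then have "(g -` A - {x. (f x \<in> A) \<noteq> (g x \<in> A)}) \<union> ({x. (f x \<in> A) \<noteq> (g x \<in> A)} - g -` A) \<in> sets lebesgue"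
    using g by (intro sets.Un sets.Diff)
  also have "(g -` A - {x. (f x \<in> A) \<noteq> (g x \<in> A)}) \<union> ({x. (f x \<in> A) \<noteq> (g x \<in> A)} - g -` A) = f -` A" by auto
  finally show "f -` A \<inter> space lebesgue \<in> sets lebesgue" by simp
qed simp

lemma borel_rep_AE:
  assumes "borel_rep S v V"
  shows "AE x in lborel. indicator S x *\<^sub>R v x = V x"
  using assms unfolding borel_rep_def by (auto elim!: eventually_mono simp: indicator_def)

lemma borel_rep_integral:
  assumes S: "S \<in> sets borel" and r: "borel_rep S v V"
  shows "v \<in> borel_measurable (lebesgue_on S)"
    and "integrable (lebesgue_on S) v \<longleftrightarrow> integrable lborel V"
    and "(\<integral>x. v x \<partial>lebesgue_on S) = (LBINT x. V x)"
proof -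
  have V: "V \<in> borel_measurable borel" using r by (simp add: borel_rep_def)
  note ae = borel_rep_AE[OF r]
  have m: "(\<lambda>x. indicator S x *\<^sub>R v x) \<in> borel_measurable lebesgue"
    by (rule borel_measurable_lebesgue_cong_AE[OF V ae])
  have V': "V \<in> borel_measurable lebesgue" using V by (simp add: measurable_completion)
  have S': "S \<inter> space lebesgue \<in> sets lebesgue" using S by simp
  show "v \<in> borel_measurable (lebesgue_on S)"
    using m S by (subst borel_measurable_restrict_space_iff) auto
  show "integrable (lebesgue_on S) v \<longleftrightarrow> integrable lborel V"
    unfolding integrable_restrict_space[OF S']
    using integrable_cong_AE[OF m V' AE_completion[OF ae]] integrable_completion[of V lborel] V by simp
  show "(\<integral>x. v x \<partial>lebesgue_on S) = (LBINT x. V x)"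
    unfolding integral_restrict_space[OF S']
    using integral_cong_AE[OF m V' AE_completion[OF ae]] integral_completion[of V lborel] V by simp
qed

lemma borel_rep_indicator:
  assumes "S \<in> sets borel" "f \<in> borel_measurable borel"
  shows "borel_rep S f (\<lambda>x. indicator S x * f x)"
  using assms by (auto simp: borel_rep_def)

lemma borel_rep_diff: "borel_rep S v V \<Longrightarrow> borel_rep S w W \<Longrightarrow> borel_rep S (\<lambda>x. v x - w x) (\<lambda>x. V x - W x)"
  by (auto simp: borel_rep_def elim!: AE_mp)

lemma borel_rep_mult: "borel_rep S v V \<Longrightarrow> borel_rep S w W \<Longrightarrow> borel_rep S (\<lambda>x. v x * w x) (\<lambda>x. V x * W x)"
  by (auto simp: borel_rep_def elim!: AE_mp)

lemma borel_rep_L2: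
  assumes S: "S \<in> sets borel" and r: "borel_rep S v V"
  shows "L2 (lebesgue_on S) v \<longleftrightarrow> L2 lborel V" "L2_norm (lebesgue_on S) v = L2_norm lborel V"
  using borel_rep_integral[OF S borel_rep_mult[OF r r]] borel_rep_integral(1)[OF S r] r
  by (auto simp: L2_def L2_norm_def power2_eq_square borel_rep_def)

section \<open>Averages of translates and the energy of the kernel\<close>

lemma nn_integral_lborel_translate:
  fixes f :: "'a::euclidean_space \<Rightarrow> ennreal"
  assumes "f \<in> borel_measurable borel"
  shows "(\<integral>\<^sup>+x. f (x + c) \<partial>lborel) = (\<integral>\<^sup>+x. f x \<partial>lborel)"
proof -
  have "(\<integral>\<^sup>+x. f x \<partial>distr lborel borel ((+) c)) = (\<integral>\<^sup>+x. f (c + x) \<partial>lborel)"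
    using assms by (intro nn_integral_distr) auto
  then show ?thesis by (simp add: lborel_distr_plus add.commute)
qed

lemma integral_lborel_translate:
  fixes f :: "'a::euclidean_space \<Rightarrow> real"
  assumes "f \<in> borel_measurable borel"
  shows "(LBINT x. f (x + c)) = (LBINT x. f x)"
proof -
  have "(\<integral>x. f x \<partial>distr lborel borel ((+) c)) = (LBINT x. f (c + x))"
    using assms by (intro integral_distr) auto
  then show ?thesis by (simp add: lborel_distr_plus add.commute)
qed

lemma L2_borel: "L2 lborel W \<Longrightarrow> W \<in> borel_measurable borel"
  by (simp add: L2_def)

lemma L2_translate:
  fixes W :: "'a::euclidean_space \<Rightarrow> real"
  assumes "L2 lborel W"
  shows "L2 lborel (\<lambda>x. W (x + c))" "L2_norm lborel (\<lambda>x. W (x + c)) = L2_norm lborel W"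
proof -
  have m[measurable]: "W \<in> borel_measurable borel" using assms by (simp add: L2_borel)
  have "integrable (distr lborel borel ((+) c)) (\<lambda>x. (W x)\<^sup>2) \<longleftrightarrow> integrable lborel (\<lambda>x. (W (c + x))\<^sup>2)"
    by (rule integrable_distr_eq) auto
  then show "L2 lborel (\<lambda>x. W (x + c))"
    using assms by (simp add: L2_def lborel_distr_plus add.commute)
  show "L2_norm lborel (\<lambda>x. W (x + c)) = L2_norm lborel W"
    using integral_lborel_translate[of "\<lambda>x. (W x)\<^sup>2" c] by (simp add: L2_norm_def)
qed

abbreviation lborel2 :: "('a::euclidean_space \<times> 'b::euclidean_space) measure" where
  "lborel2 \<equiv> lborel \<Otimes>\<^sub>M lborel"

text \<open>Tonelli, integrating over \<open>x\<close> first. This order suits integrands built from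
  translates: for fixed \<open>r\<close> a translation preserves the norm in \<open>x\<close>, so a
  bound \<open>B r\<close> is at hand.\<close>

lemma integrable_pair_sections:
  fixes f :: "'a::euclidean_space \<times> 'b::euclidean_space \<Rightarrow> real"
  assumes [measurable]: "f \<in> borel_measurable lborel2"
    and B: "\<And>r. (\<integral>\<^sup>+x. norm (f (x, r)) \<partial>lborel) \<le> ennreal (B r)" "integrable lborel B"
  shows "integrable lborel2 f"
proof (rule integrableI_bounded)
  have "(\<integral>\<^sup>+z. norm (f z) \<partial>lborel2) = (\<integral>\<^sup>+r. \<integral>\<^sup>+x. norm (f (x, r)) \<partial>lborel \<partial>lborel)"
    by (subst lborel_pair.nn_integral_snd[symmetric]) auto
  also have "\<dots> \<le> (\<integral>\<^sup>+r. ennreal (B r) \<partial>lborel)"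
    by (intro nn_integral_mono B)
  also have "\<dots> \<le> (\<integral>\<^sup>+r. ennreal (norm (B r)) \<partial>lborel)"
    by (intro nn_integral_mono ennreal_leI) auto
  also have "\<dots> < \<infinity>" using B(2) by (simp add: integrable_iff_bounded)
  finally show "(\<integral>\<^sup>+z. norm (f z) \<partial>lborel2) < \<infinity>" .
qed fact

lemma L2_nn_integral:
  "L2 M W \<Longrightarrow> (\<integral>\<^sup>+x. ennreal ((W x)\<^sup>2) \<partial>M) = ennreal ((L2_norm M W)\<^sup>2)"
  by (simp add: L2_def L2_norm_sq nn_integral_eq_integral)

section \<open>Weighted averages of the translates of a square integrable function\<close>

context
  fixes e :: "'a::euclidean_space" and \<rho> :: "real \<Rightarrow> real" and W :: "'a \<Rightarrow> real"
  assumes \<rho>: "integrable lborel \<rho>" and W: "L2 lborel W"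
begin

lemma avg_borel: "\<rho> \<in> borel_measurable borel" "W \<in> borel_measurable borel"
  using \<rho> W by (auto simp: L2_borel)

lemma avg_integrable_pair_square:
  "integrable lborel2 (\<lambda>(x, r). \<rho> r * (W (x - r *\<^sub>R e))\<^sup>2)"
proof (rule integrable_pair_sections)
  note avg_borel[measurable]
  show "(\<lambda>(x, r). \<rho> r * (W (x - r *\<^sub>R e))\<^sup>2) \<in> borel_measurable lborel2"
    by measurable
  show "integrable lborel (\<lambda>r. \<bar>\<rho> r\<bar> * (L2_norm lborel W)\<^sup>2)"
    using \<rho> by simp
  fix r
  let ?f = "\<lambda>(x, r). \<rho> r * (W (x - r *\<^sub>R e))\<^sup>2"
  have "(\<integral>\<^sup>+x. ennreal (norm (?f (x, r))) \<partial>lborel)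
     = (\<integral>\<^sup>+x. ennreal \<bar>\<rho> r\<bar> * ennreal ((W (x + - (r *\<^sub>R e)))\<^sup>2) \<partial>lborel)"
    by (intro nn_integral_cong) (simp add: abs_mult ennreal_mult)
  also have "\<dots> = ennreal \<bar>\<rho> r\<bar> * (\<integral>\<^sup>+x. ennreal ((W (x + - (r *\<^sub>R e)))\<^sup>2) \<partial>lborel)"
    by (intro nn_integral_cmult) measurable
  also have "(\<integral>\<^sup>+x. ennreal ((W (x + - (r *\<^sub>R e)))\<^sup>2) \<partial>lborel) = ennreal ((L2_norm lborel W)\<^sup>2)"
    using nn_integral_lborel_translate[of "\<lambda>x. ennreal ((W x)\<^sup>2)" "- (r *\<^sub>R e)"] L2_nn_integral[OF W] by simp
  finally show "(\<integral>\<^sup>+x. ennreal (norm (?f (x, r))) \<partial>lborel)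
     \<le> ennreal (\<bar>\<rho> r\<bar> * (L2_norm lborel W)\<^sup>2)"
    by (simp add: ennreal_mult)
qed

lemma avg_integrable_pair:
  assumes V: "L2 lborel V"
  shows "integrable lborel2 (\<lambda>(x, r). V x * (\<rho> r * W (x - r *\<^sub>R e)))"
proof (rule integrable_pair_sections)
  note avg_borel[measurable]
  have [measurable]: "V \<in> borel_measurable borel" using V by (simp add: L2_borel)
  show "(\<lambda>(x, r). V x * (\<rho> r * W (x - r *\<^sub>R e))) \<in> borel_measurable lborel2"
    by measurable
  show "integrable lborel (\<lambda>r. \<bar>\<rho> r\<bar> * (L2_norm lborel V * L2_norm lborel W))"
    using \<rho> by simp
  fix r
  let ?f = "\<lambda>(x, r). V x * (\<rho> r * W (x - r *\<^sub>R e))"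
  let ?W = "\<lambda>x. W (x + - (r *\<^sub>R e))"
  have V': "L2 lborel (\<lambda>x. \<bar>V x\<bar>)" and W': "L2 lborel (\<lambda>x. \<bar>?W x\<bar>)"
    using V L2_translate[OF W, of "- (r *\<^sub>R e)"] by (auto simp: L2_def)
  have "(\<integral>\<^sup>+x. ennreal (norm (?f (x, r))) \<partial>lborel)
     = (\<integral>\<^sup>+x. ennreal (\<bar>\<rho> r\<bar> * (\<bar>V x\<bar> * \<bar>?W x\<bar>)) \<partial>lborel)"
    by (intro nn_integral_cong) (simp add: abs_mult mult_ac)
  also have "\<dots> = ennreal (LBINT x. \<bar>\<rho> r\<bar> * (\<bar>V x\<bar> * \<bar>?W x\<bar>))"
    using L2_prod_integrable[OF V' W'] by (intro nn_integral_eq_integral) auto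
  also have "\<dots> = ennreal (\<bar>\<rho> r\<bar> * (LBINT x. \<bar>V x\<bar> * \<bar>?W x\<bar>))" by simp
  also have "\<dots> \<le> ennreal (\<bar>\<rho> r\<bar> * (L2_norm lborel V * L2_norm lborel W))"
    using L2_inner_bound[OF V' W'] L2_translate(2)[OF W, of "- (r *\<^sub>R e)"]
    by (intro ennreal_leI mult_left_mono) (auto simp: L2_norm_def)
  finally show "(\<integral>\<^sup>+x. ennreal (norm (?f (x, r))) \<partial>lborel)
     \<le> ennreal (\<bar>\<rho> r\<bar> * (L2_norm lborel V * L2_norm lborel W))" .
qed

text \<open>The Fubini exchange behind the energy identities: with \<open>V = W\<close> it produces
  the autocorrelation, and with \<open>V\<close> itself an average it expands a square.\<close>

lemma avg_inner:
  assumes V: "L2 lborel V"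
  shows "(LBINT x. V x * (LBINT r. \<rho> r * W (x - r *\<^sub>R e)))
    = (LBINT r. \<rho> r * (LBINT x. V x * W (x - r *\<^sub>R e)))"
proof -
  have "(LBINT x. V x * (LBINT r. \<rho> r * W (x - r *\<^sub>R e)))
      = (LBINT x. (LBINT r. V x * (\<rho> r * W (x - r *\<^sub>R e))))"
    by simp
  also have "\<dots> = (LBINT r. (LBINT x. V x * (\<rho> r * W (x - r *\<^sub>R e))))"
    using lborel_pair.Fubini_integral[OF avg_integrable_pair[OF V]] by simp
  also have "\<dots> = (LBINT r. (LBINT x. \<rho> r * (V x * W (x - r *\<^sub>R e))))"
    by (simp only: mult.left_commute)
  finally show ?thesis by simp
qed

lemma avg_integrable_inner:
  assumes V: "L2 lborel V"
  shows "integrable lborel (\<lambda>r. \<rho> r * (LBINT x. V x * W (x - r *\<^sub>R e)))"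
proof -
  have "integrable lborel (\<lambda>r. LBINT x. V x * (\<rho> r * W (x - r *\<^sub>R e)))"
    using lborel_pair.integrable_snd[OF avg_integrable_pair[OF V]] by simp
  moreover have "(\<lambda>r. LBINT x. V x * (\<rho> r * W (x - r *\<^sub>R e))) =
     (\<lambda>r. LBINT x. \<rho> r * (V x * W (x - r *\<^sub>R e)))"
    by (simp only: mult.left_commute)
  ultimately show ?thesis by simp
qed

lemma avg_AE_integrable_square:
  "AE x in lborel. integrable lborel (\<lambda>r. \<rho> r * (W (x - r *\<^sub>R e))\<^sup>2)"
  using lborel_pair.AE_integrable_fst[OF avg_integrable_pair_square] by simp

text \<open>Since |t| is at most 1 + t^2, the weight and the weighted square together dominate the
  integrand.\<close>

lemma avg_AE_integrable:
  "AE x in lborel. integrable lborel (\<lambda>r. \<rho> r * W (x - r *\<^sub>R e))"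
  using avg_AE_integrable_square
proof eventually_elim
  case (elim x)
  note avg_borel[measurable]
  show ?case
  proof (rule Bochner_Integration.integrable_bound)
    show "integrable lborel (\<lambda>r. \<bar>\<rho> r\<bar> + \<bar>\<rho> r * (W (x - r *\<^sub>R e))\<^sup>2\<bar>)"
      using elim \<rho> by (intro Bochner_Integration.integrable_add integrable_abs)
    show "AE r in lborel. norm (\<rho> r * W (x - r *\<^sub>R e)) \<le> norm (\<bar>\<rho> r\<bar> + \<bar>\<rho> r * (W (x - r *\<^sub>R e))\<^sup>2\<bar>)"
    proof (rule AE_I2)
      fix r
      have *: "t \<le> 1 + t\<^sup>2" for t :: real
        using zero_le_power2[of "t - 1/2"] by (simp add: power2_eq_square algebra_simps)
      have "\<bar>\<rho> r\<bar> * \<bar>W (x - r *\<^sub>R e)\<bar> \<le> \<bar>\<rho> r\<bar> * (1 + \<bar>W (x - r *\<^sub>R e)\<bar>\<^sup>2)"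
        by (rule mult_left_mono[OF *]) simp
      then show "norm (\<rho> r * W (x - r *\<^sub>R e)) \<le> norm (\<bar>\<rho> r\<bar> + \<bar>\<rho> r * (W (x - r *\<^sub>R e))\<^sup>2\<bar>)"
        by (simp add: abs_mult algebra_simps)
    qed
  qed measurable
qed

text \<open>Cauchy-Schwarz in \<open>r\<close>, with the weight split into two factors
  \<open>sqrt (\<rho> r)\<close>, bounds the squared average by the total weight times the average
  of the squares, which is integrable in \<open>x\<close>.\<close>

lemma avg_L2:
  assumes nonneg: "\<And>r. 0 \<le> \<rho> r"
  shows "L2 lborel (\<lambda>x. LBINT r. \<rho> r * W (x - r *\<^sub>R e))"
proof -
  note avg_borel[measurable]
  let ?F = "\<lambda>x. LBINT r. \<rho> r * W (x - r *\<^sub>R e)"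
  have m[measurable]: "?F \<in> borel_measurable lborel"
    by (rule lborel.borel_measurable_lebesgue_integral) measurable
  have "integrable lborel (\<lambda>x. (?F x)\<^sup>2)"
  proof (rule Bochner_Integration.integrable_bound)
    show "integrable lborel (\<lambda>x. (LBINT r. \<rho> r) * (LBINT r. \<rho> r * (W (x - r *\<^sub>R e))\<^sup>2))"
      using lborel_pair.integrable_fst[OF avg_integrable_pair_square] by simp
    show "AE x in lborel. norm ((?F x)\<^sup>2)
        \<le> norm ((LBINT r. \<rho> r) * (LBINT r. \<rho> r * (W (x - r *\<^sub>R e))\<^sup>2))"
      using avg_AE_integrable_square
    proof eventually_elim
      case (elim x)
      have a: "L2 lborel (\<lambda>r. sqrt (\<rho> r))" using \<rho> nonneg by (auto simp: L2_def)
      have b: "L2 lborel (\<lambda>r. sqrt (\<rho> r) * W (x - r *\<^sub>R e))"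
        using elim nonneg by (auto simp: L2_def power_mult_distrib)
      have eq: "sqrt (\<rho> r) * (sqrt (\<rho> r) * W (x - r *\<^sub>R e)) = \<rho> r * W (x - r *\<^sub>R e)" for r
        using nonneg[of r] by (simp flip: mult.assoc)
      have "\<bar>?F x\<bar> \<le> L2_norm lborel (\<lambda>r. sqrt (\<rho> r)) * L2_norm lborel (\<lambda>r. sqrt (\<rho> r) * W (x - r *\<^sub>R e))"
        using L2_inner_bound[OF a b] by (simp add: eq)
      then have "\<bar>?F x\<bar>\<^sup>2 \<le> (L2_norm lborel (\<lambda>r. sqrt (\<rho> r)) * L2_norm lborel (\<lambda>r. sqrt (\<rho> r) * W (x - r *\<^sub>R e)))\<^sup>2"
        by (rule power_mono) simp
      also have "\<dots> = (LBINT r. \<rho> r) * (LBINT r. \<rho> r * (W (x - r *\<^sub>R e))\<^sup>2)"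
        unfolding power_mult_distrib L2_norm_sq using nonneg by simp
      finally show ?case by simp
    qed
  qed measurable
  then show ?thesis using m by (simp add: L2_def)
qed

end

text \<open>The autocorrelation of \<open>W\<close> in direction \<open>e\<close>. All energies
  depend on \<open>W\<close> only through it.\<close>

definition corr :: "'a::euclidean_space \<Rightarrow> ('a \<Rightarrow> real) \<Rightarrow> real \<Rightarrow> real" where
  "corr e W r = (LBINT x. W x * W (x - r *\<^sub>R e))"

lemma corr_shift:
  assumes "W \<in> borel_measurable borel"
  shows "(LBINT x. W (x + s *\<^sub>R e) * W (x + t *\<^sub>R e)) = corr e W (s - t)"
  using integral_lborel_translate[of "\<lambda>x. W x * W (x - (s - t) *\<^sub>R e)" "s *\<^sub>R e"] assms
  by (simp add: corr_def algebra_simps)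

lemma corr_even: "W \<in> borel_measurable borel \<Longrightarrow> corr e W (- r) = corr e W r"
  using corr_shift[of W r e 0] corr_shift[of W 0 e r] by (simp add: mult.commute)

text \<open>Direction \<open>e\<close> belongs to the left fractional integral and
  \<open>- e\<close> to the right one, so this is why both have the same energy.\<close>

lemma corr_uminus: "W \<in> borel_measurable borel \<Longrightarrow> corr (- e) W r = corr e W r"
  using corr_even[of W e r] by (simp add: corr_def)

lemma corr_borel:
  assumes [measurable]: "W \<in> borel_measurable borel"
  shows "corr e W \<in> borel_measurable borel"
proof -
  have "(\<lambda>r. LBINT x. W x * W (x - r *\<^sub>R e)) \<in> borel_measurable (borel :: real measure)"
    by (rule lborel.borel_measurable_lebesgue_integral) measurable
  then show ?thesis unfolding corr_def[abs_def] .
qed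

lemma corr_bound:
  assumes "L2 lborel W"
  shows "\<bar>corr e W r\<bar> \<le> (L2_norm lborel W)\<^sup>2"
  using L2_inner_bound[OF assms L2_translate(1)[OF assms, of "- (r *\<^sub>R e)"]]
    L2_translate(2)[OF assms, of "- (r *\<^sub>R e)"]
  by (simp add: corr_def power2_eq_square)

lemma integral_even:
  fixes g :: "real \<Rightarrow> real"
  assumes "integrable lborel g" "\<And>r. g (- r) = g r"
  shows "(LBINT r. g r) = 2 * (LBINT r. indicator {0<..} r * g r)"
proof -
  have [measurable]: "g \<in> borel_measurable borel" using assms(1) by auto
  have i: "integrable lborel (\<lambda>r. indicator {0<..} r * g r)" "integrable lborel (\<lambda>r. indicator {..<0} r * g r)"
    using integrable_real_mult_indicator[OF _ assms(1)] by (auto simp: mult.commute)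
  have "(LBINT r. g r) = (LBINT r. indicator {0<..} r * g r + indicator {..<0} r * g r)"
  proof (rule integral_cong_AE)
    have "AE r::real in lborel. r \<noteq> 0" by (rule AE_lborel_singleton)
    then show "AE r in lborel. g r = indicator {0<..} r * g r + indicator {..<0} r * g r"
      by eventually_elim (auto simp: indicator_def)
  qed measurable
  also have "\<dots> = (LBINT r. indicator {0<..} r * g r) + (LBINT r. indicator {..<0} r * g r)"
    using i by simp
  also have "(LBINT r. indicator {..<0} r * g r) = (LBINT r. indicator {0<..} r * g r)"
    using lborel_integral_real_affine[of "-1" "\<lambda>r. indicator {..<0} r * g r" 0] assms(2)
    by (simp add: indicator_def)
  finally show ?thesis by simp
qed

text \<open>The tent is the autocorrelation of the indicator of an interval. This is the source of
  its positivity as a kernel.\<close>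

lemma indicator_overlap:
  fixes R r :: real
  assumes "0 < R"
  shows "(LBINT s. indicator {0..R} s * indicator {0..R} (s + r)) = max 0 (R - \<bar>r\<bar>)"
proof -
  have "(\<lambda>s. indicator {0..R} s * indicator {0..R} (s + r) :: real) = indicator {max 0 (- r)..min R (R - r)}"
    by (auto simp: fun_eq_iff indicator_def)
  then show ?thesis using assms by (simp add: measure_def emeasure_lborel_Icc_eq) (auto simp: max_def min_def)
qed

text \<open>Expanding the square gives the double integral of \<open>corr e W (t - s)\<close> over
  \<open>s\<close> and \<open>t\<close> in \<open>{0..R}\<close>. With \<open>t = s + r\<close> the
  integral over \<open>s\<close> is the length of an overlap, that is the tent. The factor 1/2
  appears because only \<open>r > 0\<close> is kept of an even integrand.\<close>

lemma tent_eq_square: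
  fixes W :: "'a::euclidean_space \<Rightarrow> real"
  assumes W: "L2 lborel W" and R: "0 < R"
  shows "(LBINT r. indicator {0<..} r * (max 0 (R - \<bar>r\<bar>) * corr e W r))
    = 1 / 2 * (LBINT x. (LBINT s. indicator {0..R} s * W (x + s *\<^sub>R e))\<^sup>2)"
proof -
  let ?I = "indicator {0..R} :: real \<Rightarrow> real"
  let ?Y = "\<lambda>x. LBINT s. ?I s * W (x + s *\<^sub>R e)"
  have W'[measurable]: "W \<in> borel_measurable borel" using W by (rule L2_borel)
  note corr_borel[OF W', measurable]
  have I: "integrable lborel ?I" by (simp add: integrable_indicator_iff emeasure_lborel_Icc_eq)
  \<comment> \<open>Direction \<open>- e\<close> turns the translates
    \<open>x - s *\<^sub>R e\<close> of the averaging lemmas into \<open>x + s *\<^sub>R e\<close>;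
    the same holds below.\<close>
  have Y: "L2 lborel ?Y" using avg_L2[OF I W, of "- e"] by simp
  have tr: "L2 lborel (\<lambda>x. W (x + s *\<^sub>R e))" for s using L2_translate(1)[OF W] .
  have ps: "integrable lborel2 (\<lambda>(s, r). ?I s * ?I (s + r) * corr e W r)"
  proof (rule integrable_pair_sections)
    show "integrable lborel (\<lambda>r. indicator {- R..R} r * (R * (L2_norm lborel W)\<^sup>2))"
      by (simp add: integrable_indicator_iff emeasure_lborel_Icc_eq)
    fix r
    have "(\<integral>\<^sup>+x. ennreal (norm (case (x, r) of (s, r) \<Rightarrow> ?I s * ?I (s + r) * corr e W r)) \<partial>lborel)
       \<le> (\<integral>\<^sup>+x. ennreal (indicator {-R..R} r * (L2_norm lborel W)\<^sup>2) * indicator {0..R} x \<partial>lborel)"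
      using corr_bound[OF W, of e r] by (intro nn_integral_mono) (auto simp: indicator_def ennreal_leI abs_mult)
    also have "\<dots> = ennreal (indicator {-R..R} r * (L2_norm lborel W)\<^sup>2) * ennreal R"
      using R by (subst nn_integral_cmult_indicator) auto
    finally show "(\<integral>\<^sup>+x. ennreal (norm (case (x, r) of (s, r) \<Rightarrow> ?I s * ?I (s + r) * corr e W r)) \<partial>lborel)
       \<le> ennreal (indicator {- R..R} r * (R * (L2_norm lborel W)\<^sup>2))"
      using R by (simp add: ennreal_mult'[symmetric] mult_ac)
  qed measurable
  have "(LBINT x. (?Y x)\<^sup>2) = (LBINT s. ?I s * (LBINT x. ?Y x * W (x + s *\<^sub>R e)))"
    using avg_inner[OF I W Y, of "- e"] by (simp add: power2_eq_square)
  also have "\<dots> = (LBINT s. ?I s * (LBINT t. ?I t * corr e W (t - s)))"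
  proof -
    have "(LBINT x. ?Y x * W (x + s *\<^sub>R e)) = (LBINT t. ?I t * corr e W (t - s))" for s
      using avg_inner[OF I W tr[of s], of "- e"] corr_shift[OF W', of s e] corr_even[OF W', of e]
      by (simp add: mult.commute) (metis minus_diff_eq)
    then show ?thesis by simp
  qed
  also have "\<dots> = (LBINT s. (LBINT r. ?I s * ?I (s + r) * corr e W r))"
  proof -
    have "(LBINT t. ?I t * corr e W (t - s)) = (LBINT r. ?I (s + r) * corr e W r)" for s
      using integral_lborel_translate[of "\<lambda>t. ?I t * corr e W (t - s)" s] by (simp add: add.commute)
    then show ?thesis by (simp add: mult.assoc)
  qed
  also have "\<dots> = (LBINT r. (LBINT s. ?I s * ?I (s + r) * corr e W r))"
    using lborel_pair.Fubini_integral[OF ps] by simp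
  also have "\<dots> = (LBINT r. max 0 (R - \<bar>r\<bar>) * corr e W r)"
    using indicator_overlap[OF R] by simp
  also have "\<dots> = 2 * (LBINT r. indicator {0<..} r * (max 0 (R - \<bar>r\<bar>) * corr e W r))"
  proof (rule integral_even)
    show "integrable lborel (\<lambda>r. max 0 (R - \<bar>r\<bar>) * corr e W r)"
      using lborel_pair.integrable_snd[OF ps] indicator_overlap[OF R] by simp
  qed (simp add: corr_even)
  finally show ?thesis by simp
qed

section \<open>The energy of the fractional kernel as a superposition of squares\<close>

abbreviation segment_integral :: "'a::euclidean_space \<Rightarrow> real \<Rightarrow> ('a \<Rightarrow> real) \<Rightarrow> 'a \<Rightarrow> real" where
  "segment_integral e R W x \<equiv> LBINT s. indicator {0..R} s * W (x + s *\<^sub>R e)"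

text \<open>The Riemann-Liouville kernel without its Gamma factor, cut off at \<open>L\<close> so
  that it is integrable over the line. For functions supported in a box of width at most
  \<open>L\<close> in the direction considered, the cut-off changes nothing at points of the
  box.\<close>

abbreviation riesz_weight :: "real \<Rightarrow> real \<Rightarrow> real \<Rightarrow> real" where
  "riesz_weight \<alpha> L r \<equiv> indicator {0<..<L} r * r powr (\<alpha> - 1)"

abbreviation frac_energy :: "real \<Rightarrow> real \<Rightarrow> 'a::euclidean_space \<Rightarrow> ('a \<Rightarrow> real) \<Rightarrow> real" where
  "frac_energy \<alpha> L e W \<equiv> LBINT r. riesz_weight \<alpha> L r * corr e W r"

lemma integrable_powr_interval:
  fixes \<alpha> L :: real
  assumes "0 < \<alpha>"
  shows "integrable lborel (riesz_weight \<alpha> L)"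
proof (cases "0 < L")
  case True
  have "(\<lambda>r. r powr (\<alpha> - 1)) integrable_on {0..L}"
    using integrable_on_powr_from_0[of "\<alpha> - 1" L] assms True by simp
  then have "(\<lambda>r. r powr (\<alpha> - 1)) absolutely_integrable_on {0..L}"
    by (rule nonnegative_absolutely_integrable_1) simp
  then have "set_integrable lebesgue {0<..<L} (\<lambda>r. r powr (\<alpha> - 1))"
    by (rule set_integrable_subset) auto
  then show ?thesis
    unfolding set_integrable_def by (subst (asm) integrable_completion) auto
qed simp

text \<open>Taylor's formula at infinity for the power with exponent \<open>\<alpha> - 1\<close>,
  which decays together with its derivative because \<open>\<alpha> < 1\<close>; its second
  derivative is \<open>(1 - \<alpha>) * (2 - \<alpha>) * R powr (\<alpha> - 3)\<close>.\<close>

lemma tent_integral: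
  fixes \<alpha> r :: real
  assumes \<alpha>: "0 < \<alpha>" "\<alpha> < 1" and r: "0 < r"
  shows "(\<integral>\<^sup>+R. ennreal (R powr (\<alpha> - 3) * (R - r)) * indicator {r..} R \<partial>lborel)
    = ennreal (r powr (\<alpha> - 1) / ((1 - \<alpha>) * (2 - \<alpha>)))"
proof -
  \<comment> \<open>The antiderivative in \<open>R\<close> that vanishes at infinity.\<close>
  let ?F = "\<lambda>R. R powr (\<alpha> - 1) / (\<alpha> - 1) - r * R powr (\<alpha> - 2) / (\<alpha> - 2)"
  have "(\<integral>\<^sup>+R. ennreal (R powr (\<alpha> - 3) * (R - r)) * indicator {r..} R \<partial>lborel) = ennreal (0 - ?F r)"
  proof (rule nn_integral_FTC_atLeast[where F = ?F])
    fix R assume R: "r \<le> R"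
    then have R0: "0 < R" using r by simp
    have "(?F has_real_derivative (R powr (\<alpha> - 2) - r * R powr (\<alpha> - 3))) (at R)"
      using R0 \<alpha> by (auto intro!: derivative_eq_intros)
    moreover have "R powr (\<alpha> - 2) = R powr (\<alpha> - 3) * R"
      using R0 powr_add[of R "\<alpha> - 3" 1] by simp
    ultimately show "(?F has_real_derivative (R powr (\<alpha> - 3) * (R - r))) (at R)"
      by (simp add: algebra_simps)
    show "0 \<le> R powr (\<alpha> - 3) * (R - r)" using R by simp
  next
    have "((\<lambda>R. R powr (\<alpha> - 1)) \<longlongrightarrow> 0) at_top" "((\<lambda>R. R powr (\<alpha> - 2)) \<longlongrightarrow> 0) at_top"
      using \<alpha> by (auto intro!: tendsto_neg_powr filterlim_ident)
    from tendsto_diff[OF tendsto_mult_right[OF this(1), of "1 / (\<alpha> - 1)"]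
        tendsto_mult_right[OF this(2), of "r / (\<alpha> - 2)"]]
    show "(?F \<longlongrightarrow> 0) at_top" by (simp add: mult.commute)
  qed measurable
  also have "r * r powr (\<alpha> - 2) = r powr (\<alpha> - 1)" using r powr_add[of r 1 "\<alpha> - 2"] by simp
  then have "0 - ?F r = r powr (\<alpha> - 1) / ((1 - \<alpha>) * (2 - \<alpha>))"
    using \<alpha> by (simp add: field_simps)
  finally show ?thesis .
qed

text \<open>Write the kernel as an integral of tents over \<open>R\<close> and exchange the
  integrations; for each \<open>R\<close> the integral over \<open>r\<close> is a square by
  \<open>tent_eq_square\<close>. The integrability claim is what later permits reading off that the
  squares vanish when the energy does.\<close>

lemma energy_eq:
  fixes W :: "'a::euclidean_space \<Rightarrow> real"
  assumes \<alpha>: "0 < \<alpha>" "\<alpha> < 1" and W: "L2 lborel W"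
    and L: "\<And>r. L \<le> r \<Longrightarrow> corr e W r = 0"
  shows "frac_energy \<alpha> L e W = (1 - \<alpha>) * (2 - \<alpha>) *
     (LBINT R. indicator {0<..} R * R powr (\<alpha> - 3) *
        (1 / 2 * (LBINT x. (segment_integral e R W x)\<^sup>2)))" (is ?eq)
    and "integrable lborel (\<lambda>R. indicator {0<..} R * R powr (\<alpha> - 3) *
        (1 / 2 * (LBINT x. (segment_integral e R W x)\<^sup>2)))" (is ?int)
proof -
  note corr_borel[OF L2_borel[OF W], measurable]
  define f where "f = (\<lambda>(R::real, r::real). indicator {0<..} R * R powr (\<alpha> - 3) *
     (indicator {0<..} r * (max 0 (R - \<bar>r\<bar>) * corr e W r)))"
  have fm[measurable]: "f \<in> borel_measurable lborel2"
    unfolding f_def by measurable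
  define c where "c = 1 / ((1 - \<alpha>) * (2 - \<alpha>))"
  have c: "0 < c" using \<alpha> by (simp add: c_def)
  \<comment> \<open>As \<open>corr e W\<close> vanishes from \<open>L\<close> on, the restriction to
    \<open>r < L\<close> may be written in. It makes the bound by a multiple of
    \<open>r powr (\<alpha> - 1)\<close>, obtained below from the integral over \<open>R\<close>,
    integrable in \<open>r\<close>.\<close>
  have f_eq: "f (R, r) = indicator {0<..<L} r * corr e W r * (R powr (\<alpha> - 3) * (R - r) * indicator {r..} R)"
    for R r
    using L[of r] by (cases "0 < r"; cases "r \<le> R") (auto simp: f_def indicator_def)
  have nn: "(\<integral>\<^sup>+R. ennreal (R powr (\<alpha> - 3) * (R - r) * indicator {r..} R) \<partial>lborel)
    = ennreal (c * r powr (\<alpha> - 1))" if "0 < r" for r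
    using tent_integral[OF \<alpha> that] by (simp add: c_def ennreal_mult'' ennreal_indicator)
  have inner: "(LBINT R. R powr (\<alpha> - 3) * (R - r) * indicator {r..} R) = c * r powr (\<alpha> - 1)"
    if "0 < r" for r
  proof -
    have "(LBINT R. R powr (\<alpha> - 3) * (R - r) * indicator {r..} R)
      = enn2real (\<integral>\<^sup>+R. ennreal (R powr (\<alpha> - 3) * (R - r) * indicator {r..} R) \<partial>lborel)"
      by (rule integral_eq_nn_integral) (auto simp: indicator_def)
    then show ?thesis using c by (simp add: nn[OF that])
  qed
  have int: "integrable lborel2 f"
  proof (rule integrable_pair_sections[OF fm])
    show "integrable lborel (\<lambda>r. (L2_norm lborel W)\<^sup>2 * c * riesz_weight \<alpha> L r)"
      using integrable_powr_interval[OF \<alpha>(1)] by simp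
    fix r
    show "(\<integral>\<^sup>+R. ennreal (norm (f (R, r))) \<partial>lborel)
      \<le> ennreal ((L2_norm lborel W)\<^sup>2 * c * riesz_weight \<alpha> L r)"
    proof (cases "0 < r \<and> r < L")
      case False
      then have "indicator {0<..<L} r = (0::real)" by (simp add: indicator_def)
      then show ?thesis by (simp add: f_eq)
    next
      case True
      have "(\<integral>\<^sup>+R. ennreal (norm (f (R, r))) \<partial>lborel)
         = (\<integral>\<^sup>+R. ennreal \<bar>corr e W r\<bar> * ennreal (R powr (\<alpha> - 3) * (R - r) * indicator {r..} R) \<partial>lborel)"
        using True by (intro nn_integral_cong) (auto simp: f_eq indicator_def abs_mult ennreal_mult)
      also have "\<dots> = ennreal \<bar>corr e W r\<bar> * ennreal (c * r powr (\<alpha> - 1))"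
        using True by (subst nn_integral_cmult) (auto simp: nn)
      also have "\<dots> \<le> ennreal ((L2_norm lborel W)\<^sup>2) * ennreal (c * r powr (\<alpha> - 1))"
        by (intro mult_right_mono ennreal_leI corr_bound W) simp
      also have "\<dots> = ennreal ((L2_norm lborel W)\<^sup>2 * c * riesz_weight \<alpha> L r)"
        using True c by (simp add: ennreal_mult' mult_ac)
      finally show ?thesis .
    qed
  qed
  have fst: "(LBINT r. f (R, r)) = indicator {0<..} R * R powr (\<alpha> - 3) *
        (1 / 2 * (LBINT x. (segment_integral e R W x)\<^sup>2))" for R
    using tent_eq_square[OF W, of R e] by (cases "0 < R") (auto simp: f_def)
  show ?int
    using lborel_pair.integrable_fst[of "\<lambda>R r. f (R, r)"] int unfolding fst by simp
  have "(LBINT R. (LBINT r. f (R, r))) = (LBINT r. (LBINT R. f (R, r)))"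
    using lborel_pair.Fubini_integral[of "\<lambda>R r. f (R, r)"] int by simp
  also have "\<dots> = (LBINT r. c * (riesz_weight \<alpha> L r * corr e W r))"
  proof (rule Bochner_Integration.integral_cong[OF refl])
    fix r
    show "(LBINT R. f (R, r)) = c * (riesz_weight \<alpha> L r * corr e W r)"
      using inner[of r] by (cases "0 < r") (simp_all add: f_eq)
  qed
  also have "\<dots> = c * frac_energy \<alpha> L e W"
    by (rule integral_mult_right_zero)
  finally have "(LBINT R. (LBINT r. f (R, r)))
    = c * frac_energy \<alpha> L e W" .
  moreover have "(1 - \<alpha>) * (2 - \<alpha>) * (c * t) = t" for t using \<alpha> by (simp add: c_def)
  ultimately show ?eq unfolding fst by metis
qed

lemma energy_nonneg:
  fixes W :: "'a::euclidean_space \<Rightarrow> real"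
  assumes \<alpha>: "0 < \<alpha>" "\<alpha> < 1" and W: "L2 lborel W"
    and L: "\<And>r. L \<le> r \<Longrightarrow> corr e W r = 0"
  shows "0 \<le> frac_energy \<alpha> L e W"
  by (subst energy_eq(1)[OF assms]; use \<alpha> in \<open>auto intro!: mult_nonneg_nonneg Bochner_Integration.integral_nonneg\<close>)

text \<open>The integrand in \<open>energy_eq\<close> is nonnegative with positive weight, so the
  square vanishes for almost every length \<open>R\<close>, though perhaps not for all.\<close>

lemma energy_eq_0D:
  fixes W :: "'a::euclidean_space \<Rightarrow> real"
  assumes \<alpha>: "0 < \<alpha>" "\<alpha> < 1" and W: "L2 lborel W"
    and L: "\<And>r. L \<le> r \<Longrightarrow> corr e W r = 0"
    and 0: "frac_energy \<alpha> L e W = 0"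
  shows "AE R in lborel. 0 < R \<longrightarrow>
    (AE x in lborel. segment_integral e R W x = 0)"
proof -
  let ?Y = "\<lambda>R x. segment_integral e R W x"
  let ?h = "\<lambda>R. indicator {0<..} R * R powr (\<alpha> - 3) * (1 / 2 * (LBINT x. (?Y R x)\<^sup>2))"
  have "integral\<^sup>L lborel ?h = 0" using energy_eq(1)[where L = L, OF assms(1-4)] 0 \<alpha> by simp
  moreover have "AE R in lborel. 0 \<le> ?h R" by (rule AE_I2) simp
  ultimately have "AE R in lborel. ?h R = 0"
    using integral_nonneg_eq_0_iff_AE[OF energy_eq(2)[where L = L, OF assms(1-4)]] by simp
  then show ?thesis
  proof eventually_elim
    case (elim R)
    show ?case
    proof
      assume R: "0 < R"
      have "L2 lborel (?Y R)"
        using avg_L2[of "indicator {0..R}" W "- e"] W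
        by (simp add: integrable_indicator_iff emeasure_lborel_Icc_eq)
      then show "AE x in lborel. ?Y R x = 0"
        using elim R by (simp flip: L2_norm_0_iff add: L2_norm_def)
    qed
  qed
qed

section \<open>From vanishing segment integrals to orthogonality\<close>

lemma L2_bounded_support:
  fixes f :: "'a::euclidean_space \<Rightarrow> real"
  assumes [measurable]: "f \<in> borel_measurable borel"
    and B: "\<And>x. \<bar>f x\<bar> \<le> B" and A: "bounded A" "\<And>x. x \<notin> A \<Longrightarrow> f x = 0"
  shows "L2 lborel f"
proof -
  obtain M where M: "\<And>x. x \<in> A \<Longrightarrow> norm x \<le> M" using A(1) by (auto simp: bounded_iff)
  have "integrable lborel (\<lambda>x::'a. B\<^sup>2 * indicator (cball 0 M) x)"
    using emeasure_bounded_finite[OF bounded_cball]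
    by (intro integrable_mult_right integrable_real_indicator) auto
  then have "integrable lborel (\<lambda>x. (f x)\<^sup>2)"
  proof (rule Bochner_Integration.integrable_bound)
    show "AE x in lborel. norm ((f x)\<^sup>2) \<le> norm (B\<^sup>2 * indicator (cball 0 M) x)"
    proof (rule AE_I2)
      fix x
      have "(f x)\<^sup>2 \<le> B\<^sup>2" using power_mono[OF B[of x], of 2] by simp
      then show "norm ((f x)\<^sup>2) \<le> norm (B\<^sup>2 * indicator (cball 0 M) x)"
        using M[of x] A(2)[of x] by (cases "x \<in> A") (auto simp: indicator_def)
    qed
  qed measurable
  then show ?thesis by (simp add: L2_def)
qed

text \<open>Pair the translate of \<open>W\<close> by \<open>s\<close> with \<open>\<xi>\<close> to
  get a function \<open>D s\<close>. Its integral over \<open>{0..R}\<close> is the pairing of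
  \<open>\<xi>\<close> with a segment integral, hence 0 for arbitrarily small \<open>R\<close>.
  Since \<open>D\<close> is continuous from the right at 0, \<open>D 0 = 0\<close>.\<close>

lemma averages_0_imp_orthogonal:
  fixes W \<xi> :: "'a::euclidean_space \<Rightarrow> real"
  assumes W: "L2 lborel W" and S: "bounded S" "\<And>x. x \<notin> S \<Longrightarrow> W x = 0" and \<xi>: "continuous_on UNIV \<xi>"
    and av: "AE R in lborel. 0 < R \<longrightarrow>
    (AE x in lborel. segment_integral e R W x = 0)"
  shows "(LBINT x. W x * \<xi> x) = 0"
proof -
  obtain M where M: "\<And>x. x \<in> S \<Longrightarrow> norm x \<le> M" using S(1) by (auto simp: bounded_iff)
  \<comment> \<open>\<open>\<xi>\<close> need not be square integrable, so it is cut off. The radius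
    is large enough that \<open>x - s *\<^sub>R e\<close> stays in the ball for \<open>x\<close> in
    \<open>S\<close> and \<open>0 \<le> s < 1\<close>, where \<open>X\<close> and
    \<open>\<xi>\<close> then agree.\<close>
  define X where "X x = indicator (cball 0 (\<bar>M\<bar> + norm e + 1)) x * \<xi> x" for x
  have [measurable]: "\<xi> \<in> borel_measurable borel" by (rule borel_measurable_continuous_onI[OF \<xi>])
  have [measurable]: "W \<in> borel_measurable borel" using W by (rule L2_borel)
  have Xm[measurable]: "X \<in> borel_measurable borel"
    unfolding X_def[abs_def] by (intro borel_measurable_times borel_measurable_indicator) auto
  have "bounded (\<xi> ` cball 0 (\<bar>M\<bar> + norm e + 1))"
    by (intro compact_imp_bounded compact_continuous_image continuous_on_subset[OF \<xi>]) auto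
  then obtain B where B: "0 < B" "\<And>x. x \<in> cball 0 (\<bar>M\<bar> + norm e + 1) \<Longrightarrow> \<bar>\<xi> x\<bar> \<le> B"
    by (auto simp: bounded_pos)
  have XB: "\<bar>X x\<bar> \<le> B" for x using B by (auto simp: X_def indicator_def)
  have XL2: "L2 lborel X"
    by (rule L2_bounded_support[OF Xm XB bounded_cball[of 0 "\<bar>M\<bar> + norm e + 1"]])
      (simp add: X_def indicator_def)
  define D where "D s = (LBINT x. X x * W (x + s *\<^sub>R e))" for s
  \<comment> \<open>Moving the shift from \<open>W\<close> to the continuous factor makes dominated
    convergence applicable as \<open>s\<close> tends to 0.\<close>
  have D_eq: "D s = (LBINT x. W x * X (x - s *\<^sub>R e))" for s
    using integral_lborel_translate[of "\<lambda>x. W x * X (x - s *\<^sub>R e)" "s *\<^sub>R e"]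
    by (simp add: D_def mult.commute)
  have Wint: "integrable lborel W"
  proof -
    have "L2 lborel (\<lambda>x::'a. indicator (cball 0 \<bar>M\<bar>) x :: real)"
      by (rule L2_bounded_support[of _ 1, OF _ _ bounded_cball[of 0 "\<bar>M\<bar>"]]) (auto simp: indicator_def)
    from L2_prod_integrable[OF this W] have "integrable lborel (\<lambda>x. indicator (cball 0 \<bar>M\<bar>) x * W x)" .
    also have "(\<lambda>x. indicator (cball 0 \<bar>M\<bar>) x * W x) = W"
      using M S(2) by (force simp: fun_eq_iff indicator_def)
    finally show ?thesis .
  qed
  have D_cont: "(D \<longlongrightarrow> D 0) (at_right 0)"
  proof (rule tendsto_at_right_sequentially[where b = 1])
    fix t :: "nat \<Rightarrow> real"
    assume t: "\<And>n. 0 < t n" "\<And>n. t n < 1" "t \<longlonglongrightarrow> 0"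
    have *: "X (x - s *\<^sub>R e) = \<xi> (x - s *\<^sub>R e)" if "x \<in> S" "0 \<le> s" "s < 1" for x s
    proof -
      have "norm (x - s *\<^sub>R e) \<le> norm x + s * norm e"
        using norm_triangle_ineq4[of x "s *\<^sub>R e"] that by simp
      also have "\<dots> \<le> M + 1 * norm e"
        using M[OF that(1)] that by (intro add_mono mult_right_mono) auto
      also have "\<dots> \<le> \<bar>M\<bar> + norm e + 1" by simp
      finally show ?thesis by (simp add: X_def indicator_def)
    qed
    show "(\<lambda>n. D (t n)) \<longlonglongrightarrow> D 0"
      unfolding D_eq
    proof (rule integral_dominated_convergence[where w = "\<lambda>x. B * \<bar>W x\<bar>"])
      show "integrable lborel (\<lambda>x. B * \<bar>W x\<bar>)" using Wint by simp
      show "AE x in lborel. norm (W x * X (x - t i *\<^sub>R e)) \<le> B * \<bar>W x\<bar>" for i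
        using mult_left_mono[OF XB, of "\<bar>W _\<bar>"] by (intro AE_I2) (simp add: abs_mult mult.commute)
      show "AE x in lborel. (\<lambda>i. W x * X (x - t i *\<^sub>R e)) \<longlonglongrightarrow> W x * X (x - 0 *\<^sub>R e)"
      proof (rule AE_I2)
        fix x
        show "(\<lambda>i. W x * X (x - t i *\<^sub>R e)) \<longlonglongrightarrow> W x * X (x - 0 *\<^sub>R e)"
        proof (cases "x \<in> S")
          case True
          have "(\<lambda>i. \<xi> (x - t i *\<^sub>R e)) \<longlonglongrightarrow> \<xi> (x - 0 *\<^sub>R e)"
            using \<xi> by (intro continuous_on_tendsto_compose[OF \<xi>] tendsto_intros t) auto
          then have "(\<lambda>i. X (x - t i *\<^sub>R e)) \<longlonglongrightarrow> X (x - 0 *\<^sub>R e)"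
            using *[OF True, of 0] *[OF True, of "t _"] t less_imp_le[OF t(1)] by simp
          then show ?thesis by (intro tendsto_intros)
        qed (simp add: S(2))
      qed
    qed measurable
  qed simp
  have "D 0 = 0"
  proof (rule ccontr)
    assume n: "D 0 \<noteq> 0"
    then have "\<forall>\<^sub>F s in at_right 0. dist (D s) (D 0) < \<bar>D 0\<bar> / 2"
      using D_cont by (intro tendstoD) auto
    then obtain b where b: "0 < b" "\<And>s. 0 < s \<Longrightarrow> s < b \<Longrightarrow> dist (D s) (D 0) < \<bar>D 0\<bar> / 2"
      by (auto simp: eventually_at_right[of 0 1])
    \<comment> \<open>The exceptional lengths form a null set, which cannot contain the whole
      interval \<open>{0<..<b}\<close>.\<close>
    have "\<exists>R. 0 < R \<and> R < b \<and> (AE x in lborel. segment_integral e R W x = 0)"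
    proof (rule ccontr)
      assume "\<not> ?thesis"
      then have "AE R in lborel. R \<notin> {0<..<b}" using av by (auto elim!: AE_mp)
      then have "emeasure lborel {0<..<b} = 0"
        by (subst (asm) AE_iff_measurable[OF _ refl]) (auto simp: greaterThanLessThan_def greaterThan_def lessThan_def Int_def)
      then show False using b by simp
    qed
    then obtain R where R: "0 < R" "R < b"
        "AE x in lborel. segment_integral e R W x = 0" by blast
    have iI: "integrable lborel (indicator {0..R} :: real \<Rightarrow> real)"
      by (simp add: integrable_indicator_iff emeasure_lborel_Icc_eq)
    have "0 = (LBINT x. X x * segment_integral e R W x)"
      using R(3) by (intro integral_eq_zero_AE[symmetric]) (auto elim!: AE_mp)
    also have "\<dots> = (LBINT s. indicator {0..R} s * D s)"
      using avg_inner[OF iI W XL2, of "- e"] by (simp add: D_def)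
    finally have D0: "(LBINT s. indicator {0..R} s * D s) = 0" by simp
    have Di: "integrable lborel (\<lambda>s. indicator {0..R} s * D s)"
      using avg_integrable_inner[OF iI W XL2, of "- e"] by (simp add: D_def)
    \<comment> \<open>The mean of \<open>D\<close> over \<open>{0..R}\<close> is 0, yet
      \<open>D\<close> stays within \<open>\<bar>D 0\<bar> / 2\<close> of \<open>D 0\<close> there
      except possibly at \<open>s = 0\<close>. This forces
      \<open>\<bar>D 0\<bar> * R \<le> \<bar>D 0\<bar> / 2 * R\<close>.\<close>
    have "\<bar>D 0\<bar> * R = (LBINT s. \<bar>D 0\<bar> * indicator {0..R} s)" using R by simp
    also have "\<dots> = \<bar>(LBINT s. D 0 * indicator {0..R} s)\<bar>" using R by (simp add: abs_mult)
    also have "(LBINT s. D 0 * indicator {0..R} s) =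
      (LBINT s. D 0 * indicator {0..R} s) - (LBINT s. indicator {0..R} s * D s)"
      using D0 by simp
    also have "\<dots> = (LBINT s. D 0 * indicator {0..R} s - indicator {0..R} s * D s)"
      using iI Di by (intro Bochner_Integration.integral_diff[symmetric]) auto
    also have "\<bar>\<dots>\<bar> \<le> (LBINT s. norm (D 0 * indicator {0..R} s - indicator {0..R} s * D s))"
      using integral_norm_bound[of lborel "\<lambda>s. D 0 * indicator {0..R} s - indicator {0..R} s * D s"] by simp
    also have "\<dots> \<le> (LBINT s. \<bar>D 0\<bar> / 2 * indicator {0..R} s)"
    proof (rule integral_mono_AE)
      show "integrable lborel (\<lambda>s. norm (D 0 * indicator {0..R} s - indicator {0..R} s * D s))"
        using iI Di by (intro integrable_norm Bochner_Integration.integrable_diff) auto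
      show "integrable lborel (\<lambda>s. \<bar>D 0\<bar> / 2 * indicator {0..R} s)" using iI by simp
      have "AE s::real in lborel. s \<noteq> 0" by (rule AE_lborel_singleton)
      then show "AE s in lborel. norm (D 0 * indicator {0..R} s - indicator {0..R} s * D s) \<le> \<bar>D 0\<bar> / 2 * indicator {0..R} s"
      proof eventually_elim
        case (elim s)
        then show ?case using b(2)[of s] R by (cases "0 \<le> s \<and> s \<le> R") (auto simp: indicator_def dist_real_def abs_minus_commute)
      qed
    qed
    also have "\<dots> = \<bar>D 0\<bar> / 2 * R" using R by simp
    finally show False using n R by simp
  qed
  moreover have "D 0 = (LBINT x. W x * \<xi> x)"
    unfolding D_eq
  proof (rule Bochner_Integration.integral_cong[OF refl])
    fix x
    show "W x * X (x - 0 *\<^sub>R e) = W x * \<xi> x"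
    proof (cases "x \<in> S")
      case True
      have "norm x \<le> \<bar>M\<bar> + norm e + 1" using M[OF True] norm_ge_zero[of e] by linarith
      then show ?thesis by (simp add: X_def)
    qed (simp add: S(2))
  qed
  ultimately show ?thesis by simp
qed

section \<open>Smooth functions and test functions\<close>

fun times_diff :: "nat \<Rightarrow> (real \<Rightarrow> real) \<Rightarrow> bool" where
  "times_diff 0 f \<longleftrightarrow> True"
| "times_diff (Suc n) f \<longleftrightarrow> (\<forall>x. f differentiable at x) \<and> times_diff n (deriv f)"

definition smooth_real :: "(real \<Rightarrow> real) \<Rightarrow> bool" where
  "smooth_real f \<longleftrightarrow> (\<forall>n. times_diff n f)"

lemma smooth_real_differentiable: "smooth_real f \<Longrightarrow> f differentiable at x"
  unfolding smooth_real_def by (metis times_diff.simps(2))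

lemma smooth_real_deriv: "smooth_real f \<Longrightarrow> smooth_real (deriv f)"
  unfolding smooth_real_def by (metis times_diff.simps(2))

lemma smooth_real_DERIV: "smooth_real f \<Longrightarrow> (f has_real_derivative deriv f x) (at x)"
  using smooth_real_differentiable[of f x]
  by (simp add: DERIV_deriv_iff_real_differentiable)

lemma differentiableD_deriv:
  fixes f :: "real \<Rightarrow> real"
  shows "f differentiable at x \<Longrightarrow> (f has_real_derivative deriv f x) (at x)"
  by (simp add: DERIV_deriv_iff_real_differentiable)

lemma times_diff_mono: "times_diff (Suc n) f \<Longrightarrow> times_diff n f"
  by (induction n arbitrary: f) auto

lemma times_diff_add:
  "times_diff n f \<Longrightarrow> times_diff n g \<Longrightarrow> times_diff n (\<lambda>x. f x + g x)"
proof (induction n arbitrary: f g)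
  case (Suc n)
  have "deriv (\<lambda>x. f x + g x) = (\<lambda>x. deriv f x + deriv g x)"
    using Suc.prems by (intro ext DERIV_imp_deriv DERIV_add differentiableD_deriv) auto
  then show ?case using Suc by simp
qed simp

lemma times_diff_mult:
  "times_diff n f \<Longrightarrow> times_diff n g \<Longrightarrow> times_diff n (\<lambda>x. f x * g x)"
proof (induction n arbitrary: f g)
  case (Suc n)
  have "deriv (\<lambda>x. f x * g x) x = deriv f x * g x + deriv g x * f x" for x
    using Suc.prems by (intro DERIV_imp_deriv DERIV_mult differentiableD_deriv) auto
  then have "deriv (\<lambda>x. f x * g x) = (\<lambda>x. deriv f x * g x + deriv g x * f x)" by auto
  moreover have "times_diff n (\<lambda>x. deriv f x * g x + deriv g x * f x)"
    using Suc.prems times_diff_mono by (intro times_diff_add Suc.IH) auto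
  ultimately show ?case using Suc.prems by simp
qed simp

lemma times_diff_affine: "times_diff n f \<Longrightarrow> times_diff n (\<lambda>x. c * f (s * x + d))"
proof (induction n arbitrary: f c)
  case (Suc n)
  have *: "((\<lambda>x. c * f (s * x + d)) has_real_derivative (c * s) * deriv f (s * x + d)) (at x)" for x
  proof -
    have "(f has_real_derivative deriv f (s * x + d)) (at (s * x + d))"
      using Suc.prems by (intro differentiableD_deriv) simp
    then show ?thesis by (auto intro!: derivative_eq_intros DERIV_chain2[where f = f])
  qed
  then have "deriv (\<lambda>x. c * f (s * x + d)) = (\<lambda>x. (c * s) * deriv f (s * x + d))"
    by (intro ext DERIV_imp_deriv)
  then show ?case using Suc * by (auto simp: real_differentiable_def)
qed simp

lemma smooth_real_mult: "smooth_real f \<Longrightarrow> smooth_real g \<Longrightarrow> smooth_real (\<lambda>x. f x * g x)"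
  by (simp add: smooth_real_def times_diff_mult)

lemma smooth_real_affine: "smooth_real f \<Longrightarrow> smooth_real (\<lambda>x. f (s * x + d))"
  using times_diff_affine[of _ f 1 s d] by (simp add: smooth_real_def)

definition exp_bump_poly :: "real poly \<Rightarrow> real \<Rightarrow> real" where
  "exp_bump_poly p t = (if 0 < t then poly p (1 / t) * exp (- (1 / t)) else 0)"

abbreviation exp_bump :: "real \<Rightarrow> real" where
  "exp_bump \<equiv> exp_bump_poly 1"

lemma poly_times_exp_neg_tendsto_0: "((\<lambda>x. poly p x * exp (- x)) \<longlongrightarrow> (0::real)) at_top"
proof -
  have "((\<lambda>x. \<Sum>i\<le>degree p. coeff p i * (x ^ i / exp x)) \<longlongrightarrow> (\<Sum>i\<le>degree p. coeff p i * 0)) at_top"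
    by (intro tendsto_sum tendsto_mult tendsto_const tendsto_power_div_exp_0)
  then show ?thesis by (simp add: poly_altdef sum_divide_distrib exp_minus divide_inverse[symmetric])
qed

text \<open>With x = 1/t the derivative of x in t is -x^2, so p(x) exp(-x) has derivative x^2 (p -
  p')(x) exp(-x); \<open>[:0, 0, 1:]\<close> is the polynomial x^2.\<close>

lemma exp_bump_poly_DERIV:
  "(exp_bump_poly p has_real_derivative exp_bump_poly ([:0, 0, 1:] * (p - pderiv p)) t) (at t)"
proof -
  consider "t < 0" | "0 < t" | "t = 0" by linarith
  then show ?thesis
  proof cases
    case 1
    have "((\<lambda>_. 0) has_real_derivative 0) (at t)" by simp
    then have "(exp_bump_poly p has_real_derivative 0) (at t)"
      by (rule has_field_derivative_transform_within_open[where S = "{..<0}"])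
         (use 1 in \<open>auto simp: exp_bump_poly_def\<close>)
    then show ?thesis using 1 by (simp add: exp_bump_poly_def)
  next
    case 2
    have "((\<lambda>t. poly p (1 / t) * exp (- (1 / t))) has_real_derivative
        exp_bump_poly ([:0, 0, 1:] * (p - pderiv p)) t) (at t)"
    proof -
      have "((\<lambda>t. poly p (1 / t)) has_real_derivative poly (pderiv p) (1 / t) * (- 1 / t\<^sup>2)) (at t)"
        using 2 by (intro DERIV_chain2[OF poly_DERIV])
          (auto intro!: derivative_eq_intros simp: power2_eq_square)
      moreover have "((\<lambda>t. exp (- (1 / t))) has_real_derivative exp (- (1 / t)) * (1 / t\<^sup>2)) (at t)"
        using 2 by (auto intro!: derivative_eq_intros simp: power2_eq_square)
      ultimately have "((\<lambda>t. poly p (1 / t) * exp (- (1 / t))) has_real_derivative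
         poly (pderiv p) (1 / t) * (- 1 / t\<^sup>2) * exp (- (1 / t)) + exp (- (1 / t)) * (1 / t\<^sup>2) * poly p (1 / t)) (at t)"
        by (rule DERIV_mult)
      moreover have "poly (pderiv p) (1 / t) * (- 1 / t\<^sup>2) * exp (- (1 / t)) + exp (- (1 / t)) * (1 / t\<^sup>2) * poly p (1 / t)
         = exp_bump_poly ([:0, 0, 1:] * (p - pderiv p)) t"
        using 2 by (simp add: exp_bump_poly_def field_simps power2_eq_square)
      ultimately show ?thesis by simp
    qed
    then show ?thesis
      by (rule has_field_derivative_transform_within_open[where S = "{0<..}"])
         (use 2 in \<open>auto simp: exp_bump_poly_def\<close>)
  next
    case 3
    have r: "((\<lambda>h. exp_bump_poly p h / h) \<longlongrightarrow> 0) (at_right 0)"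
    proof -
      \<comment> \<open>At 0 the difference quotient is of the same kind: dividing by
        \<open>h\<close> multiplies the polynomial by 1/h, and the exponential still wins.\<close>
      have "((\<lambda>h. poly ([:0, 1:] * p) (inverse h) * exp (- (inverse h))) \<longlongrightarrow> 0) (at_right 0)"
        by (rule filterlim_compose[OF poly_times_exp_neg_tendsto_0 filterlim_inverse_at_top_right])
      then show ?thesis
        by (rule Lim_transform_eventually)
           (auto simp: eventually_at_filter exp_bump_poly_def field_simps)
    qed
    have l: "((\<lambda>h. exp_bump_poly p h / h) \<longlongrightarrow> 0) (at_left 0)"
      by (rule tendsto_eventually) (auto simp: eventually_at_filter exp_bump_poly_def)
    have "((\<lambda>h. exp_bump_poly p h / h) \<longlongrightarrow> 0) (at 0)"
      using l r by (simp add: filterlim_split_at)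
    then show ?thesis using 3 by (simp add: DERIV_def exp_bump_poly_def)
  qed
qed

lemma smooth_real_exp_bump_poly: "smooth_real (exp_bump_poly p)"
  unfolding smooth_real_def
proof
  show "times_diff n (exp_bump_poly p)" for n
  proof (induction n arbitrary: p)
    case (Suc n)
    have "deriv (exp_bump_poly p) = exp_bump_poly ([:0, 0, 1:] * (p - pderiv p))"
      using exp_bump_poly_DERIV by (intro ext DERIV_imp_deriv)
    then show ?case using Suc exp_bump_poly_DERIV by (auto simp: real_differentiable_def simp del: mult_pCons_left)
  qed simp
qed

lemma exp_bump_eq: "exp_bump t = (if 0 < t then exp (- (1 / t)) else 0)"
  by (simp add: exp_bump_poly_def)

text \<open>Test functions and mollifiers are built as tensor products, because a partial derivative
  then replaces one factor by its derivative and iterated partial derivatives stay in the class.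
  Smoothness is thus reduced to one variable.\<close>

definition coord_prod :: "('n \<Rightarrow> real \<Rightarrow> real) \<Rightarrow> real ^ 'n::finite \<Rightarrow> real" where
  "coord_prod F x = (\<Prod>j\<in>UNIV. F j (x $ j))"

lemma coord_prod_has_derivative:
  assumes "\<And>j. smooth_real (F j)"
  shows "(coord_prod F has_derivative
    (\<lambda>h. \<Sum>i\<in>UNIV. h $ i * coord_prod (F(i := deriv (F i))) x)) (at x)"
proof -
  have "((\<lambda>x. F j (x $ j)) has_derivative (\<lambda>h. h $ j * deriv (F j) (x $ j))) (at x)" for j
  proof -
    have "(F j has_derivative (\<lambda>h. h * deriv (F j) (x $ j))) (at (x $ j))"
      using smooth_real_DERIV[OF assms, of j "x $ j"] by (simp add: has_field_derivative_def mult_commute_abs)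
    from has_derivative_compose[OF bounded_linear_imp_has_derivative[OF bounded_linear_vec_nth] this]
    show ?thesis .
  qed
  then have "((\<lambda>x. \<Prod>j\<in>UNIV. F j (x $ j)) has_derivative
     (\<lambda>h. \<Sum>i\<in>UNIV. h $ i * deriv (F i) (x $ i) * (\<Prod>j\<in>UNIV - {i}. F j (x $ j)))) (at x)"
    by (intro has_derivative_prod)
  moreover have "h $ i * deriv (F i) (x $ i) * (\<Prod>j\<in>UNIV - {i}. F j (x $ j))
      = h $ i * coord_prod (F(i := deriv (F i))) x" for h i
    by (subst coord_prod_def, subst prod.remove[of UNIV i]) (auto intro!: prod.cong)
  ultimately show ?thesis unfolding coord_prod_def[abs_def] by simp
qed

lemma pderiv_at_eq: "(f has_derivative f') (at x) \<Longrightarrow> pderiv_at i f x = f' (axis i 1)"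
  by (metis frechet_derivative_at pderiv_at_def)

lemma pderiv_at_coord_prod:
  assumes "\<And>j. smooth_real (F j)"
  shows "pderiv_at i (coord_prod F) = coord_prod (F(i := deriv (F i)))"
  by (rule ext, subst pderiv_at_eq[OF coord_prod_has_derivative[OF assms]])
     (simp add: axis_def if_distrib[of "\<lambda>t. t * _"] cong: if_cong)

lemma foldr_pderiv_at_coord_prod:
  assumes "\<And>j. smooth_real (F j)"
  shows "\<exists>G. (\<forall>j. smooth_real (G j)) \<and> foldr pderiv_at is (coord_prod F) = coord_prod G"
proof (induction "is")
  case Nil
  then show ?case using assms by auto
next
  case (Cons i "is")
  then obtain G where G: "\<And>j. smooth_real (G j)" "foldr pderiv_at is (coord_prod F) = coord_prod G" by auto
  then show ?case using smooth_real_deriv[OF G(1)]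
    by (intro exI[of _ "G(i := deriv (G i))"]) (auto simp: pderiv_at_coord_prod fun_upd_def)
qed

lemma smooth_coord_prod:
  fixes F :: "'n::finite \<Rightarrow> real \<Rightarrow> real"
  assumes "\<And>j. smooth_real (F j)"
  shows "smooth (coord_prod F)"
  unfolding smooth_def
proof (intro allI)
  fix "is" and x :: "real ^ 'n"
  obtain G where G: "\<And>j. smooth_real (G j)" "foldr pderiv_at is (coord_prod F) = coord_prod G"
    using foldr_pderiv_at_coord_prod[of F "is"] assms by auto
  show "foldr pderiv_at is (coord_prod F) differentiable at x"
    unfolding G(2) using coord_prod_has_derivative[OF G(1)] by (rule differentiableI)
qed

lemma closure_coord_prod_subset:
  fixes l u :: "real ^ 'n::finite"
  assumes "\<And>j t. t \<notin> {l $ j..u $ j} \<Longrightarrow> F j t = 0"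
  shows "closure {x. coord_prod F x \<noteq> 0} \<subseteq> cbox l u"
proof (rule closure_minimal)
  show "{x. coord_prod F x \<noteq> 0} \<subseteq> cbox l u"
  proof
    fix x assume "x \<in> {x. coord_prod F x \<noteq> 0}"
    then have "F j (x $ j) \<noteq> 0" for j by (auto simp: coord_prod_def)
    then show "x \<in> cbox l u" using assms unfolding mem_box_cart by (metis atLeastAtMost_iff)
  qed
qed (rule closed_cbox)

lemma test_function_coord_prod:
  fixes l u :: "real ^ 'n::finite"
  assumes "\<And>j. smooth_real (F j)" "\<And>j t. t \<notin> {l $ j..u $ j} \<Longrightarrow> F j t = 0" "cbox l u \<subseteq> \<Omega>"
  shows "test_function \<Omega> (coord_prod F)"
  unfolding test_function_def
proof (intro conjI)
  note c = closure_coord_prod_subset[of l u F, OF assms(2)]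
  show "closure {x. coord_prod F x \<noteq> 0} \<subseteq> \<Omega>" using c assms(3) by blast
  show "compact (closure {x. coord_prod F x \<noteq> 0})"
    using compact_Int_closed[OF compact_cbox[of l u] closed_closure, of "{x. coord_prod F x \<noteq> 0}"] c
    by (simp add: inf.absorb2)
qed (rule smooth_coord_prod[OF assms(1)])

section \<open>Calculus of smooth functions of several variables\<close>

lemma smooth_differentiable: "smooth \<phi> \<Longrightarrow> \<phi> differentiable at x"
  unfolding smooth_def by (metis foldr.simps(1) id_apply)

lemma smooth_pderiv: "smooth \<phi> \<Longrightarrow> smooth (pderiv_at i \<phi>)"
  unfolding smooth_def
proof (intro allI)
  fix "is" x assume *: "\<forall>is x. foldr pderiv_at is \<phi> differentiable at x"
  show "foldr pderiv_at is (pderiv_at i \<phi>) differentiable at x"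
    \<comment> \<open>\<open>foldr\<close> applies the last entry of the list first.\<close>
    using *[rule_format, of "is @ [i]" x] by simp
qed

lemma smooth_continuous: "smooth \<phi> \<Longrightarrow> continuous_on A \<phi>"
  by (meson smooth_differentiable differentiable_imp_continuous_within continuous_at_imp_continuous_on)

lemma smooth_borel: "smooth \<phi> \<Longrightarrow> \<phi> \<in> borel_measurable borel"
  by (intro borel_measurable_continuous_onI smooth_continuous)

lemma smooth_has_derivative: "smooth \<phi> \<Longrightarrow> (\<phi> has_derivative frechet_derivative \<phi> (at x)) (at x)"
  using smooth_differentiable frechet_derivative_works by blast

lemma pderiv_at_diff:
  assumes "smooth \<phi>" "smooth \<psi>"
  shows "pderiv_at i (\<lambda>x. \<phi> x - \<psi> x) = (\<lambda>x. pderiv_at i \<phi> x - pderiv_at i \<psi> x)"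
  using pderiv_at_eq[OF has_derivative_diff[OF smooth_has_derivative[OF assms(1)] smooth_has_derivative[OF assms(2)]]]
  by (auto simp: pderiv_at_def)

lemma smooth_diff:
  assumes "smooth \<phi>" "smooth \<psi>"
  shows "smooth (\<lambda>x. \<phi> x - \<psi> x)"
proof -
  have "foldr pderiv_at is (\<lambda>x. \<phi> x - \<psi> x) = (\<lambda>x. foldr pderiv_at is \<phi> x - foldr pderiv_at is \<psi> x) \<and>
    smooth (foldr pderiv_at is \<phi>) \<and> smooth (foldr pderiv_at is \<psi>)" for "is"
    by (induction "is") (auto simp: assms pderiv_at_diff smooth_pderiv)
  note * = this
  show ?thesis
    unfolding smooth_def[of "\<lambda>x. \<phi> x - \<psi> x"]
  proof (intro allI)
    fix "is" and x
    show "foldr pderiv_at is (\<lambda>x. \<phi> x - \<psi> x) differentiable at x"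
      unfolding *[of "is", THEN conjunct1]
      by (intro differentiable_diff smooth_differentiable *[THEN conjunct2, THEN conjunct1]
          *[THEN conjunct2, THEN conjunct2])
  qed
qed

lemma pderiv_at_mult:
  assumes "smooth \<phi>" "smooth \<psi>"
  shows "pderiv_at i (\<lambda>x. \<phi> x * \<psi> x) x = \<phi> x * pderiv_at i \<psi> x + pderiv_at i \<phi> x * \<psi> x"
  using pderiv_at_eq[OF has_derivative_mult[OF smooth_has_derivative[OF assms(1)] smooth_has_derivative[OF assms(2)]]]
  by (auto simp: pderiv_at_def)

lemma test_function_smooth: "test_function \<Omega> \<phi> \<Longrightarrow> smooth \<phi>"
  by (simp add: test_function_def)

section \<open>The divergence theorem on the box\<close>

abbreviation insert_coord :: "'n \<Rightarrow> real \<Rightarrow> ('n \<Rightarrow> real) \<Rightarrow> real ^ 'n::finite" where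
  "insert_coord i t y \<equiv> (\<chi> j. if j = i then t else y j)"

abbreviation hyperplane_coords :: "'n::finite \<Rightarrow> ('n \<Rightarrow> real) measure" where
  "hyperplane_coords i \<equiv> (\<Pi>\<^sub>M j\<in>UNIV - {i}. lborel)"

lemma insert_coord_measurable_pair[measurable]:
  fixes i :: "'n::finite"
  shows
  "(\<lambda>(y, t). insert_coord i t y) \<in> borel_measurable (hyperplane_coords i \<Otimes>\<^sub>M lborel)"
proof (subst borel_measurable_euclidean_space, intro ballI)
  fix v :: "real ^ 'n" assume "v \<in> Basis"
  then obtain j where v: "v = axis j 1" by (auto simp: Basis_vec_def)
  have "(\<lambda>z. (case z of (y, t) \<Rightarrow> insert_coord i t y) \<bullet> v) = (if j = i then snd else (\<lambda>z. fst z j))"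
    by (auto simp: fun_eq_iff v inner_axis)
  also have "\<dots> \<in> borel_measurable (hyperplane_coords i \<Otimes>\<^sub>M lborel)"
  proof (cases "j = i")
    case False
    then show ?thesis
      using measurable_compose[OF measurable_fst measurable_component_singleton[of j "UNIV - {i}" "\<lambda>_. lborel"]]
      by simp
  qed simp
  finally show "(\<lambda>z. (case z of (y, t) \<Rightarrow> insert_coord i t y) \<bullet> v) \<in> borel_measurable (hyperplane_coords i \<Otimes>\<^sub>M lborel)" .
qed

lemma insert_coord_measurable[measurable]:
  "(\<lambda>y. insert_coord i t y) \<in> borel_measurable (hyperplane_coords i)"
proof -
  have "t \<in> space lborel" by simp
  from measurable_Pair1[OF insert_coord_measurable_pair this] show ?thesis by simp
qed

lemma hyperplane_coords_PiE:
  "{y \<in> space (hyperplane_coords i). \<forall>j. j \<noteq> i \<longrightarrow> y j \<in> A j} = Pi\<^sub>E (UNIV - {i}) A"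
  by (rule set_eqI) (simp add: space_PiM PiE_iff, blast)

lemma hyperplane_coords_sigma_finite: "sigma_finite_measure (hyperplane_coords i)"
proof -
  interpret product_sigma_finite "\<lambda>_. lborel :: real measure" by standard
  show ?thesis by (rule sigma_finite) simp
qed

lemma emeasure_hyperplane_coords_PiE:
  "(\<And>j. A j \<in> sets borel) \<Longrightarrow>
    emeasure (hyperplane_coords i) (Pi\<^sub>E (UNIV - {i}) A) = (\<Prod>j\<in>UNIV - {i}. emeasure lborel (A j))"
proof -
  assume A: "\<And>j. A j \<in> sets borel"
  interpret product_sigma_finite "\<lambda>_. lborel :: real measure" by standard
  show ?thesis by (rule emeasure_PiM) (auto simp: A)
qed

text \<open>Both measures give every box the product of its side lengths. The hyperplane factor is
  the one from which the face measures are built, so that Fubini in this form produces face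
  integrals.\<close>

lemma lborel_split_coord:
  "(lborel :: (real ^ 'n::finite) measure) =
    distr (hyperplane_coords i \<Otimes>\<^sub>M lborel) borel (\<lambda>(y, t). insert_coord i t y)"
proof (rule lborel_eqI)
  fix l u :: "real ^ 'n"
  assume le: "\<And>b. b \<in> Basis \<Longrightarrow> l \<bullet> b \<le> u \<bullet> b"
  have le': "l $ j \<le> u $ j" for j using le[of "axis j 1"] by (simp add: inner_axis)
  let ?A = "\<lambda>j. {l $ j<..<u $ j}"
  have "(\<lambda>(y, t). insert_coord i t y) -` box l u \<inter> space (hyperplane_coords i \<Otimes>\<^sub>M lborel)
      = Pi\<^sub>E (UNIV - {i}) ?A \<times> ?A i"
  proof -
    have "insert_coord i t y \<in> box l u \<longleftrightarrow> t \<in> ?A i \<and> (\<forall>j. j \<noteq> i \<longrightarrow> y j \<in> ?A j)" for t y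
      by (auto simp: mem_box_cart)
    then show ?thesis
      unfolding hyperplane_coords_PiE[symmetric] by (auto simp: space_pair_measure)
  qed
  then have "emeasure (distr (hyperplane_coords i \<Otimes>\<^sub>M lborel) borel (\<lambda>(y, t). insert_coord i t y)) (box l u)
     = emeasure (hyperplane_coords i \<Otimes>\<^sub>M lborel) (Pi\<^sub>E (UNIV - {i}) ?A \<times> ?A i)"
    by (subst emeasure_distr) auto
  also have "\<dots> = (\<Prod>j\<in>UNIV - {i}. emeasure lborel (?A j)) * emeasure lborel (?A i)"
    by (subst lborel.emeasure_pair_measure_Times)
       (auto simp: emeasure_hyperplane_coords_PiE intro!: sets_PiM_I_finite)
  also have "\<dots> = (\<Prod>j\<in>UNIV. emeasure lborel (?A j))"
    by (subst (2) prod.remove[of _ i]) (auto simp: mult.commute)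
  also have "\<dots> = ennreal (\<Prod>j\<in>UNIV. u $ j - l $ j)"
    using le' by (simp add: prod_ennreal)
  also have "(\<Prod>j\<in>UNIV. u $ j - l $ j) = (\<Prod>b\<in>Basis. (u - l) \<bullet> b)"
  proof -
    have B: "Basis = (\<lambda>j. axis j (1::real)) ` (UNIV :: 'n set)" by (auto simp: Basis_vec_def)
    show ?thesis unfolding B by (subst prod.reindex) (auto simp: inj_on_def axis_eq_axis inner_axis)
  qed
  finally show "emeasure (distr (hyperplane_coords i \<Otimes>\<^sub>M lborel) borel (\<lambda>(y, t). insert_coord i t y)) (box l u)
    = (\<Prod>b\<in>Basis. (u - l) \<bullet> b)" .
qed simp

section \<open>The faces of the box and their measures\<close>

abbreviation box_face :: "real ^ 'n::finite \<Rightarrow> real ^ 'n \<Rightarrow> 'n \<Rightarrow> real \<Rightarrow> (real ^ 'n) set" where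
  "box_face a b i c \<equiv> {x \<in> cbox a b. x $ i = c}"

lemma closed_box_face: "closed (box_face a b i c)"
proof -
  have "box_face a b i c = cbox a b \<inter> {x. x $ i = c}" by auto
  also have "closed \<dots>"
    by (intro closed_Int closed_cbox closed_Collect_eq continuous_intros)
  finally show ?thesis .
qed

lemma box_face_borel[measurable]: "box_face a b i c \<in> sets borel"
  by (intro borel_closed closed_box_face)

lemma hyperplane_measure_sets[simp]: "sets (hyperplane_measure i c) = sets borel"
  by (simp add: hyperplane_measure_def)

lemma face_measure_borel: "f \<in> borel_measurable borel \<Longrightarrow> f \<in> borel_measurable (face_measure a b i c)"
  unfolding face_measure_def
  by (intro measurable_restrict_space1 measurable_completion)
     (simp add: measurable_cong_sets[OF hyperplane_measure_sets refl])

lemma box_face_completion: "box_face a b i c \<inter> space (completion (hyperplane_measure i c)) \<in> sets (completion (hyperplane_measure i c))"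
proof -
  have "box_face a b i c \<in> sets (hyperplane_measure i c)" by simp
  moreover have "space (completion (hyperplane_measure i c)) = UNIV" by (simp add: hyperplane_measure_def)
  ultimately show ?thesis by (simp del: hyperplane_measure_sets)
qed

lemma emeasure_hyperplane_coords_box:
  "emeasure (hyperplane_coords i) {y \<in> space (hyperplane_coords i). \<forall>j. j \<noteq> i \<longrightarrow> a $ j \<le> y j \<and> y j \<le> b $ j} < \<infinity>"
proof -
  have "{y \<in> space (hyperplane_coords i). \<forall>j. j \<noteq> i \<longrightarrow> a $ j \<le> y j \<and> y j \<le> b $ j}
     = Pi\<^sub>E (UNIV - {i}) (\<lambda>j. {a $ j..b $ j})"
    unfolding hyperplane_coords_PiE[symmetric] by simp
  then show ?thesis
    by (auto simp: emeasure_hyperplane_coords_PiE emeasure_lborel_Icc_eq less_top[symmetric] ennreal_prod_eq_top)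
qed

lemma insert_coord_mem_face:
  assumes "a $ i \<le> c" "c \<le> b $ i"
  shows "insert_coord i c y \<in> box_face a b i c \<longleftrightarrow> (\<forall>j. j \<noteq> i \<longrightarrow> a $ j \<le> y j \<and> y j \<le> b $ j)"
  using assms by (auto simp: mem_box_cart)

lemma finite_face_measure:
  assumes "a $ i \<le> c" "c \<le> b $ i"
  shows "finite_measure (face_measure a b i c)"
proof (rule finite_measureI)
  have "emeasure (face_measure a b i c) (space (face_measure a b i c)) = emeasure (completion (hyperplane_measure i c)) (box_face a b i c)"
    unfolding face_measure_def using box_face_completion
    by (subst emeasure_restrict_space) (auto simp: space_restrict_space hyperplane_measure_def)
  also have "\<dots> = emeasure (hyperplane_measure i c) (box_face a b i c)" by simp
  also have "\<dots> = emeasure (hyperplane_coords i) {y \<in> space (hyperplane_coords i). \<forall>j. j \<noteq> i \<longrightarrow> a $ j \<le> y j \<and> y j \<le> b $ j}"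
  proof -
    have "(\<lambda>y. insert_coord i c y) -` box_face a b i c \<inter> space (hyperplane_coords i)
       = {y \<in> space (hyperplane_coords i). \<forall>j. j \<noteq> i \<longrightarrow> a $ j \<le> y j \<and> y j \<le> b $ j}"
      using insert_coord_mem_face[OF assms] by blast
    then show ?thesis
      unfolding hyperplane_measure_def by (subst emeasure_distr) auto
  qed
  also have "\<dots> < \<infinity>" by (rule emeasure_hyperplane_coords_box)
  finally show "emeasure (face_measure a b i c) (space (face_measure a b i c)) \<noteq> \<infinity>" by simp
qed

lemma integral_face_measure:
  fixes f :: "real ^ 'n::finite \<Rightarrow> real"
  assumes [measurable]: "f \<in> borel_measurable borel" and c: "a $ i \<le> c" "c \<le> b $ i"
  shows "(\<integral>x. f x \<partial>face_measure a b i c) =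
    (\<integral>y. indicator {y. \<forall>j. j \<noteq> i \<longrightarrow> a $ j \<le> y j \<and> y j \<le> b $ j} y * f (insert_coord i c y) \<partial>hyperplane_coords i)"
proof -
  have m: "(\<lambda>x. indicator (box_face a b i c) x * f x) \<in> borel_measurable borel" by measurable
  have "(\<integral>x. f x \<partial>face_measure a b i c) = (\<integral>x. indicator (box_face a b i c) x * f x \<partial>completion (hyperplane_measure i c))"
    unfolding face_measure_def by (subst integral_restrict_space[OF box_face_completion]) simp
  also have "\<dots> = (\<integral>x. indicator (box_face a b i c) x * f x \<partial>hyperplane_measure i c)"
    using m by (intro integral_completion) (simp add: measurable_cong_sets[OF hyperplane_measure_sets refl])
  also have "\<dots> = (\<integral>y. indicator (box_face a b i c) (insert_coord i c y) * f (insert_coord i c y) \<partial>hyperplane_coords i)"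
    unfolding hyperplane_measure_def using m by (intro integral_distr) auto
  finally show ?thesis
    unfolding indicator_def insert_coord_mem_face[OF c] by simp
qed

lemma space_face_measure: "space (face_measure a b i c) = box_face a b i c"
  by (simp add: face_measure_def space_restrict_space hyperplane_measure_def)

lemma integrable_face_measure_bounded:
  fixes f :: "real ^ 'n::finite \<Rightarrow> real"
  assumes f: "f \<in> borel_measurable borel" and c: "a $ i \<le> c" "c \<le> b $ i"
    and B: "\<And>x. x \<in> cbox a b \<Longrightarrow> \<bar>f x\<bar> \<le> B"
  shows "integrable (face_measure a b i c) f"
  using finite_face_measure[OF c] face_measure_borel[OF f] B
  by (intro finite_measure.integrable_const_bound[where B = B]) (auto simp: space_face_measure)

lemma continuous_bounded_on_cbox:
  fixes f :: "'a::euclidean_space \<Rightarrow> real"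
  assumes "continuous_on UNIV f"
  obtains B where "0 < B" "\<And>x. x \<in> cbox a b \<Longrightarrow> \<bar>f x\<bar> \<le> B"
proof -
  have "bounded (f ` cbox a b)"
    by (intro compact_imp_bounded compact_continuous_image continuous_on_subset[OF assms]) auto
  then show ?thesis using that by (auto simp: bounded_pos)
qed

lemma L2_face_measure_continuous:
  fixes f :: "real ^ 'n::finite \<Rightarrow> real"
  assumes f: "continuous_on UNIV f" and c: "a $ i \<le> c" "c \<le> b $ i"
  shows "L2 (face_measure a b i c) f"
proof -
  obtain B where B: "0 < B" "\<And>x. x \<in> cbox a b \<Longrightarrow> \<bar>f x\<bar> \<le> B"
    using continuous_bounded_on_cbox[OF f] by blast
  have m: "f \<in> borel_measurable borel" using f by (rule borel_measurable_continuous_onI)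
  have "\<bar>(f x)\<^sup>2\<bar> \<le> B\<^sup>2" if "x \<in> cbox a b" for x
    using power_mono[OF B(2)[OF that], of 2] by simp
  then show ?thesis
    unfolding L2_def using m face_measure_borel[OF m]
    by (auto intro!: integrable_face_measure_bounded[where B = "B\<^sup>2"] c)
qed

lemma pderiv_at_DERIV_insert_coord:
  assumes "\<And>x. \<Psi> differentiable at x"
  shows "((\<lambda>t. \<Psi> (insert_coord i t y)) has_real_derivative pderiv_at i \<Psi> (insert_coord i t y)) (at t)"
proof -
  have eq: "(\<lambda>s. insert_coord i s y) = (\<lambda>s. insert_coord i 0 y + s *\<^sub>R axis i 1)"
    by (auto simp: vec_eq_iff axis_def fun_eq_iff)
  have d: "((\<lambda>s. insert_coord i s y) has_derivative (\<lambda>h. h *\<^sub>R axis i 1)) (at t)"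
    unfolding eq by (auto intro!: derivative_eq_intros)
  have "(\<Psi> has_derivative frechet_derivative \<Psi> (at (insert_coord i t y))) (at (insert_coord i t y))"
    using assms frechet_derivative_works by blast
  from has_derivative_compose[OF d this]
  have "((\<lambda>t. \<Psi> (insert_coord i t y)) has_derivative
     (\<lambda>h. frechet_derivative \<Psi> (at (insert_coord i t y)) (h *\<^sub>R axis i 1))) (at t)" .
  moreover have "linear (frechet_derivative \<Psi> (at (insert_coord i t y)))"
    using assms linear_frechet_derivative by blast
  ultimately show ?thesis
    by (simp add: has_field_derivative_def pderiv_at_def linear_cmul mult_commute_abs)
qed

text \<open>The fundamental theorem of calculus on every line parallel to axis \<open>i\<close>,
  integrated over the remaining coordinates. As only one partial derivative occurs, only the two
  faces orthogonal to that axis contribute.\<close>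

lemma divergence_box:
  fixes \<Psi> :: "real ^ 'n::finite \<Rightarrow> real"
  assumes ab: "\<And>i. a $ i < b $ i" and \<Psi>: "\<And>x. \<Psi> differentiable at x"
    and c: "continuous_on UNIV (pderiv_at i \<Psi>)"
  shows "(LBINT x. indicator (box a b) x * pderiv_at i \<Psi> x)
     = (\<integral>x. \<Psi> x \<partial>face_measure a b i (b $ i)) - (\<integral>x. \<Psi> x \<partial>face_measure a b i (a $ i))"
proof -
  let ?D = "pderiv_at i \<Psi>"
  let ?B = "{y. \<forall>j. j \<noteq> i \<longrightarrow> a $ j \<le> y j \<and> y j \<le> b $ j}"
  have Dm[measurable]: "?D \<in> borel_measurable borel" using c by (rule borel_measurable_continuous_onI)
  have \<Psi>c: "continuous_on UNIV \<Psi>"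
    using \<Psi> by (simp add: continuous_at_imp_continuous_on differentiable_imp_continuous_within)
  then have [measurable]: "\<Psi> \<in> borel_measurable borel" by (rule borel_measurable_continuous_onI)
  interpret P: sigma_finite_measure "hyperplane_coords i" by (rule hyperplane_coords_sigma_finite)
  interpret PL: pair_sigma_finite "hyperplane_coords i" lborel ..
  have cb: "integrable lborel (\<lambda>x. indicator (cbox a b) x * ?D x)"
    using borel_integrable_compact[OF compact_cbox continuous_on_subset[OF c subset_UNIV], of a b] by simp
  \<comment> \<open>The closed box differs by a null set, and its slices are compact intervals, as
    the fundamental theorem wants them.\<close>
  have "(LBINT x. indicator (box a b) x * ?D x) = (LBINT x. indicator (cbox a b) x * ?D x)"
  proof (rule integral_cong_AE)
    have "AE x in lborel. x \<notin> cbox a b - box a b"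
      by (rule AE_not_in) (auto simp: null_sets_def emeasure_Diff emeasure_lborel_cbox_eq emeasure_lborel_box_eq box_subset_cbox)
    then show "AE x in lborel. indicator (box a b) x * ?D x = indicator (cbox a b) x * ?D x"
      using box_subset_cbox[of a b] by (auto elim!: eventually_mono simp: indicator_def)
  qed measurable
  also have "\<dots> = (\<integral>z. indicator (cbox a b) (case z of (y, t) \<Rightarrow> insert_coord i t y) * ?D (case z of (y, t) \<Rightarrow> insert_coord i t y) \<partial>(hyperplane_coords i \<Otimes>\<^sub>M lborel))"
    by (subst lborel_split_coord[of i], rule integral_distr) measurable
  also have "\<dots> = (\<integral>y. (LBINT t. indicator (cbox a b) (insert_coord i t y) * ?D (insert_coord i t y)) \<partial>hyperplane_coords i)"
  proof -
    have "integrable (distr (hyperplane_coords i \<Otimes>\<^sub>M lborel) borel (\<lambda>(y, t). insert_coord i t y)) (\<lambda>x. indicator (cbox a b) x * ?D x)"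
      using cb by (subst (asm) lborel_split_coord[of i]) simp
    then have "integrable (hyperplane_coords i \<Otimes>\<^sub>M lborel) (\<lambda>z. indicator (cbox a b) (case z of (y, t) \<Rightarrow> insert_coord i t y) * ?D (case z of (y, t) \<Rightarrow> insert_coord i t y))"
      by (subst (asm) integrable_distr_eq) auto
    then have "integrable (hyperplane_coords i \<Otimes>\<^sub>M lborel) (\<lambda>(y, t). indicator (cbox a b) (insert_coord i t y) * ?D (insert_coord i t y))"
      by (simp add: split_def)
    from PL.integral_fst[OF this] show ?thesis by (simp add: split_def)
  qed
  also have "\<dots> = (\<integral>y. indicator ?B y * \<Psi> (insert_coord i (b $ i) y) - indicator ?B y * \<Psi> (insert_coord i (a $ i) y) \<partial>hyperplane_coords i)"
  proof (rule Bochner_Integration.integral_cong[OF refl])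
    fix y
    have 1: "indicator (cbox a b) (insert_coord i t y) = (indicator ?B y * indicator {a $ i..b $ i} t :: real)" for t
      by (auto simp: indicator_def mem_box_cart)
    have 2: "(LBINT t. ?D (insert_coord i t y) * indicator {a $ i..b $ i} t) = \<Psi> (insert_coord i (b $ i) y) - \<Psi> (insert_coord i (a $ i) y)"
    proof (rule integral_FTC_Icc_real)
      show "a $ i \<le> b $ i" using ab less_imp_le by blast
      show "((\<lambda>t. \<Psi> (insert_coord i t y)) has_real_derivative ?D (insert_coord i t y)) (at t)" for t
        by (rule pderiv_at_DERIV_insert_coord[OF \<Psi>])
      show "isCont (\<lambda>t. ?D (insert_coord i t y)) t" for t
      proof -
        have "continuous_on UNIV (\<lambda>t. insert_coord i t y)"
        proof (rule continuous_on_vec_lambda)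
          show "continuous_on UNIV (\<lambda>t. if j = i then t else y j)" for j
            by (cases "j = i") auto
        qed
        then have "continuous_on UNIV (\<lambda>t. ?D (insert_coord i t y))"
          by (rule continuous_on_compose2[OF c]) simp
        then show ?thesis by (simp add: continuous_on_eq_continuous_at)
      qed
    qed
    show "(LBINT t. indicator (cbox a b) (insert_coord i t y) * ?D (insert_coord i t y))
       = indicator ?B y * \<Psi> (insert_coord i (b $ i) y) - indicator ?B y * \<Psi> (insert_coord i (a $ i) y)"
      unfolding 1 using 2 by (simp add: right_diff_distrib mult.assoc mult.commute[of "indicator {a $ i..b $ i} _"])
  qed
  also have "\<dots> = (\<integral>x. \<Psi> x \<partial>face_measure a b i (b $ i)) - (\<integral>x. \<Psi> x \<partial>face_measure a b i (a $ i))"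
  proof -
    obtain B where B: "0 < B" "\<And>x. x \<in> cbox a b \<Longrightarrow> \<bar>\<Psi> x\<bar> \<le> B"
      using continuous_bounded_on_cbox[OF \<Psi>c] by blast
    have "integrable (hyperplane_coords i) (\<lambda>y. indicator ?B y * \<Psi> (insert_coord i c y))"
      if c: "a $ i \<le> c" "c \<le> b $ i" for c
    proof -
      \<comment> \<open>Points of the product space are \<open>undefined\<close> at
        \<open>i\<close>, so \<open>?B\<close> is not a subset of that space; only its intersection
        with the space is measured.\<close>
      have *: "{y \<in> space (hyperplane_coords i). y \<in> ?B} \<in> sets (hyperplane_coords i)"
      proof -
        have "{y \<in> space (hyperplane_coords i). y \<in> ?B} = Pi\<^sub>E (UNIV - {i}) (\<lambda>j. {a $ j..b $ j})"
          unfolding hyperplane_coords_PiE[symmetric] by simp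
        then show ?thesis by (auto intro!: sets_PiM_I_finite)
      qed
      have "integrable (hyperplane_coords i) (\<lambda>y. B * indicator {y \<in> space (hyperplane_coords i). y \<in> ?B} y)"
        using emeasure_hyperplane_coords_box[of i a b] *
        by (intro integrable_mult_right integrable_real_indicator) auto
      then show ?thesis
      proof (rule Bochner_Integration.integrable_bound)
        have "(\<lambda>y. indicator {y \<in> space (hyperplane_coords i). y \<in> ?B} y * \<Psi> (insert_coord i c y)) \<in> borel_measurable (hyperplane_coords i)"
          using * by measurable
        then show "(\<lambda>y. indicator ?B y * \<Psi> (insert_coord i c y)) \<in> borel_measurable (hyperplane_coords i)"
          by (rule measurable_cong[THEN iffD1, rotated]) (auto simp: indicator_def)
        show "AE y in hyperplane_coords i. norm (indicator ?B y * \<Psi> (insert_coord i c y))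
            \<le> norm (B * indicator {y \<in> space (hyperplane_coords i). y \<in> ?B} y)"
        proof (rule AE_I2)
          fix y assume "y \<in> space (hyperplane_coords i)"
          then show "norm (indicator ?B y * \<Psi> (insert_coord i c y)) \<le> norm (B * indicator {y \<in> space (hyperplane_coords i). y \<in> ?B} y)"
            using B(2)[of "insert_coord i c y"] B(1) c by (auto simp: indicator_def mem_box_cart)
        qed
      qed
    qed
    then show ?thesis
      using ab by (simp add: integral_face_measure less_imp_le)
  qed
  finally show ?thesis .
qed

section \<open>Fractional integrals as averages of translates\<close>

text \<open>For suitable \<open>L\<close> this is, almost everywhere on the box,
  \<open>Gamma \<alpha>\<close> times the left (\<open>e = axis i 1\<close>) or right
  (\<open>e = - axis i 1\<close>) fractional integral of the function that \<open>W\<close>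
  continues by zero. Being an average of translates, it falls under the lemmas on averages.\<close>

definition frac_avg :: "real \<Rightarrow> real \<Rightarrow> 'a::euclidean_space \<Rightarrow> ('a \<Rightarrow> real) \<Rightarrow> 'a \<Rightarrow> real" where
  "frac_avg \<alpha> L e W x = (LBINT r. riesz_weight \<alpha> L r * W (x - r *\<^sub>R e))"

lemma frac_avg_L2: "0 < \<alpha> \<Longrightarrow> L2 lborel W \<Longrightarrow> L2 lborel (frac_avg \<alpha> L e W)"
  unfolding frac_avg_def[abs_def] by (rule avg_L2[OF integrable_powr_interval]) auto

lemma frac_avg_inner:
  assumes "0 < \<alpha>" "L2 lborel W"
  shows "(LBINT x. W x * frac_avg \<alpha> L e W x)
    = frac_energy \<alpha> L e W"
  unfolding frac_avg_def corr_def by (rule avg_inner[OF integrable_powr_interval]) fact+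

text \<open>Linearity is claimed only almost everywhere: where one of the integrals diverges it has
  the default value 0, and additivity may fail.\<close>

lemma frac_avg_diff:
  assumes "0 < \<alpha>" "L2 lborel V" "L2 lborel W"
  shows "AE x in lborel. frac_avg \<alpha> L e (\<lambda>x. V x - W x) x = frac_avg \<alpha> L e V x - frac_avg \<alpha> L e W x"
  using avg_AE_integrable[OF integrable_powr_interval[OF assms(1), of L] assms(2), of e]
    avg_AE_integrable[OF integrable_powr_interval[OF assms(1), of L] assms(3), of e]
  unfolding frac_avg_def by eventually_elim (simp add: right_diff_distrib)

lemma AE_lborel_translate:
  fixes N :: "'a::euclidean_space set"
  assumes "N \<in> null_sets lborel"
  shows "AE x in lborel. x + c \<notin> N"
proof -
  have [measurable]: "N \<in> sets borel" using assms by (simp add: null_sets_def)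
  have "(\<integral>\<^sup>+x. indicator N (x + c) \<partial>lborel) = (\<integral>\<^sup>+x. indicator N x \<partial>lborel)"
    by (rule nn_integral_lborel_translate) measurable
  also have "\<dots> = 0" using assms by (simp add: null_sets_def)
  finally have "AE x in lborel. indicator N (x + c) = (0 :: ennreal)"
    by (subst (asm) nn_integral_0_iff_AE) measurable
  then show ?thesis by (auto elim!: eventually_mono simp: indicator_def split: if_splits)
qed

text \<open>For fixed \<open>r\<close> the translate of a null set is null, and Fubini exchanges the
  two quantifiers. Hence changing a function on a null set changes its fractional integrals only on
  a null set, although these integrate over lines, which are null sets themselves.\<close>

lemma AE_line_notin_null_set:
  fixes N :: "'a::euclidean_space set"
  assumes "N \<in> null_sets lborel"
  shows "AE x in lborel. AE r::real in lborel. x - r *\<^sub>R e \<notin> N"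
proof -
  have [measurable]: "N \<in> sets borel" using assms by (simp add: null_sets_def)
  have "AE r::real in lborel. AE x in lborel. x - r *\<^sub>R e \<notin> N"
    using AE_lborel_translate[OF assms, of "- (_ *\<^sub>R e)"] by simp
  moreover have "{z \<in> space lborel2. fst z - (snd z :: real) *\<^sub>R e \<notin> N} \<in> sets lborel2"
    by measurable
  ultimately show ?thesis
    by (subst lborel_pair.AE_commute) (auto simp: split_def)
qed

lemma update_coord_eq: "update_coord x i w = x - (x $ i - w) *\<^sub>R axis i 1"
  by (auto simp: update_coord_def vec_eq_iff axis_def)

text \<open>The sign \<open>\<sigma>\<close> treats the left (1) and the right (-1) integral at
  once. The substitution is r = \<sigma> (x_i - t); on almost every line the representative
  \<open>W\<close> may replace \<open>w\<close>.\<close>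

lemma frac_avg_eq_line_integral:
  fixes a b :: "real ^ 'n::finite"
  assumes rep: "borel_rep (box a b) w W" and L: "b $ i - a $ i \<le> L" and \<sigma>: "\<sigma> = 1 \<or> \<sigma> = -1"
  shows "AE x in lborel. x \<in> box a b \<longrightarrow>
    (LINT t:{t. 0 < \<sigma> * (x $ i - t) \<and> update_coord x i t \<in> box a b}|lebesgue.
        (\<sigma> * (x $ i - t)) powr (\<alpha> - 1) * w (update_coord x i t))
    = frac_avg \<alpha> L (\<sigma> *\<^sub>R axis i 1) W x" (is "AE x in _. _ \<longrightarrow> ?J x = _")
proof -
  let ?e = "\<sigma> *\<^sub>R axis i 1 :: real ^ 'n"
  have W[measurable]: "W \<in> borel_measurable borel" and W0: "\<And>x. x \<notin> box a b \<Longrightarrow> W x = 0"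
    and ae: "AE x in lborel. x \<in> box a b \<longrightarrow> W x = w x"
    using rep by (auto simp: borel_rep_def)
  have \<sigma>\<sigma>: "\<sigma> * \<sigma> = 1" "\<sigma> \<noteq> 0" "\<bar>\<sigma>\<bar> = 1" using \<sigma> by auto
  obtain N where N: "N \<in> null_sets lborel" "{x. \<not> (x \<in> box a b \<longrightarrow> W x = w x)} \<subseteq> N"
    using ae by (auto elim!: AE_E simp: null_sets_def)
  show ?thesis
    using AE_line_notin_null_set[OF N(1), of ?e]
  proof (eventually_elim, intro impI)
    fix x :: "real ^ 'n"
    assume r: "AE r::real in lborel. x - r *\<^sub>R ?e \<notin> N" and x: "x \<in> box a b"
    have upd: "update_coord x i t = x - (\<sigma> * (x $ i - t)) *\<^sub>R ?e" for t
      unfolding update_coord_eq using \<sigma>\<sigma> by simp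
    define h where "h t = indicator {t. 0 < \<sigma> * (x $ i - t)} t * (\<sigma> * (x $ i - t)) powr (\<alpha> - 1) * W (x - (\<sigma> * (x $ i - t)) *\<^sub>R ?e)" for t
    have hm[measurable]: "h \<in> borel_measurable borel" unfolding h_def[abs_def] by measurable
    have m: "Measurable.pred borel (\<lambda>r. x - r *\<^sub>R ?e \<notin> N)"
    proof -
      have [measurable]: "N \<in> sets borel" using N(1) by (simp add: null_sets_def)
      show ?thesis by measurable
    qed
    have "AE t in lborel. x - (\<sigma> * x $ i + (- \<sigma>) * t) *\<^sub>R ?e \<notin> N"
      using AE_borel_affine[OF _ m r, of "- \<sigma>"] \<sigma>\<sigma> by auto
    then have h_ae: "AE t in lborel. indicator {t. 0 < \<sigma> * (x $ i - t) \<and> update_coord x i t \<in> box a b} t *\<^sub>R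
        ((\<sigma> * (x $ i - t)) powr (\<alpha> - 1) * w (update_coord x i t)) = h t"
    proof eventually_elim
      case (elim t)
      have "\<sigma> * x $ i + - \<sigma> * t = \<sigma> * (x $ i - t)" by (simp add: algebra_simps)
      then have nN: "update_coord x i t \<notin> N" using elim upd by metis
      show ?case
      proof (cases "update_coord x i t \<in> box a b")
        case True
        then have "W (update_coord x i t) = w (update_coord x i t)" using nN N(2) by blast
        then show ?thesis using True by (simp add: h_def upd indicator_def)
      next
        case False
        then show ?thesis using W0[OF False] by (simp add: h_def upd)
      qed
    qed
    have "?J x = (\<integral>t. h t \<partial>lebesgue)"
      unfolding set_lebesgue_integral_def
      by (intro integral_cong_AE borel_measurable_lebesgue_cong_AE[OF hm h_ae] AE_completion h_ae)
         (simp add: measurable_completion)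
    also have "\<dots> = (LBINT t. h t)" by (rule integral_completion) simp
    also have "\<dots> = (LBINT r. h (x $ i + (- \<sigma>) * r))"
      using lborel_integral_real_affine[of "- \<sigma>" h "x $ i"] \<sigma>\<sigma> by simp
    also have "\<dots> = frac_avg \<alpha> L ?e W x"
      unfolding frac_avg_def
    proof (rule Bochner_Integration.integral_cong[OF refl])
      fix r
      have 1: "\<sigma> * (x $ i - (x $ i + (- \<sigma>) * r)) = r" using \<sigma>\<sigma> by (simp flip: mult.assoc)
      \<comment> \<open>A step of length at least \<open>L\<close> from a point of the box leaves
        the box, so the cut-off in \<open>riesz_weight\<close> loses nothing.\<close>
      have 2: "W (x - r *\<^sub>R ?e) = 0" if "L \<le> r"
      proof (rule W0)
        have "a $ i < x $ i" "x $ i < b $ i" using x by (auto simp: mem_box_cart)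
        then have "\<not> (a $ i < (x - r *\<^sub>R ?e) $ i \<and> (x - r *\<^sub>R ?e) $ i < b $ i)"
          using that L \<sigma> by (auto simp: axis_def)
        then show "x - r *\<^sub>R ?e \<notin> box a b" unfolding mem_box_cart by blast
      qed
      show "h (x $ i + (- \<sigma>) * r) = riesz_weight \<alpha> L r * W (x - r *\<^sub>R ?e)"
        unfolding h_def indicator_def mem_Collect_eq 1 using 2 by (cases "r < L") auto
    qed
    finally show "?J x = frac_avg \<alpha> L ?e W x" .
  qed
qed

lemma update_coord_mem_box:
  "x \<in> box a b \<Longrightarrow> update_coord x i t \<in> box a b \<longleftrightarrow> a $ i < t \<and> t < b $ i"
  by (auto simp: mem_box_cart update_coord_def)

lemma J_left_AE:
  fixes a b :: "real ^ 'n::finite"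
  assumes rep: "borel_rep (box a b) w W" and L: "b $ i - a $ i \<le> L"
  shows "AE x in lborel. x \<in> box a b \<longrightarrow> J_left a \<alpha> i w x = 1 / Gamma \<alpha> * frac_avg \<alpha> L (axis i 1) W x"
proof -
  have "AE x in lborel. x \<in> box a b \<longrightarrow>
    (LINT t:{t. t < x $ i \<and> update_coord x i t \<in> box a b}|lebesgue. (x $ i - t) powr (\<alpha> - 1) * w (update_coord x i t))
    = frac_avg \<alpha> L (axis i 1) W x"
    using frac_avg_eq_line_integral[OF rep L, of 1 \<alpha>] by simp
  then show ?thesis
  proof eventually_elim
    case (elim x)
    show ?case
    proof
      assume x: "x \<in> box a b"
      then have "{t. t < x $ i \<and> update_coord x i t \<in> box a b} = {a $ i<..<x $ i}"
        using update_coord_mem_box[OF x] by (auto simp: mem_box_cart intro: less_trans)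
      then show "J_left a \<alpha> i w x = 1 / Gamma \<alpha> * frac_avg \<alpha> L (axis i 1) W x"
        using elim x by (simp add: J_left_def)
    qed
  qed
qed

lemma J_right_AE:
  fixes a b :: "real ^ 'n::finite"
  assumes rep: "borel_rep (box a b) w W" and L: "b $ i - a $ i \<le> L"
  shows "AE x in lborel. x \<in> box a b \<longrightarrow> J_right b \<alpha> i w x = 1 / Gamma \<alpha> * frac_avg \<alpha> L (- axis i 1) W x"
proof -
  have "AE x in lborel. x \<in> box a b \<longrightarrow>
    (LINT t:{t. x $ i < t \<and> update_coord x i t \<in> box a b}|lebesgue. (t - x $ i) powr (\<alpha> - 1) * w (update_coord x i t))
    = frac_avg \<alpha> L (- axis i 1) W x"
    using frac_avg_eq_line_integral[OF rep L, of "-1" \<alpha>] by simp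
  then show ?thesis
  proof eventually_elim
    case (elim x)
    show ?case
    proof
      assume x: "x \<in> box a b"
      then have "{t. x $ i < t \<and> update_coord x i t \<in> box a b} = {x $ i<..<b $ i}"
        using update_coord_mem_box[OF x] by (auto simp: mem_box_cart intro: less_trans)
      then show "J_right b \<alpha> i w x = 1 / Gamma \<alpha> * frac_avg \<alpha> L (- axis i 1) W x"
        using elim x by (simp add: J_right_def)
    qed
  qed
qed

lemma corr_eq_0_outside:
  fixes a b :: "real ^ 'n::finite"
  assumes W0: "\<And>x. x \<notin> box a b \<Longrightarrow> W x = 0" and L: "b $ i - a $ i \<le> r"
  shows "corr (axis i 1) W r = 0"
proof -
  have "W x * W (x - r *\<^sub>R axis i 1) = 0" for x
  proof (cases "x \<in> box a b")
    case True
    then have "a $ i < x $ i" "x $ i < b $ i" by (auto simp: mem_box_cart)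
    then have "\<not> a $ i < (x - r *\<^sub>R axis i 1) $ i" using L by (auto simp: axis_def)
    then have "x - r *\<^sub>R axis i 1 \<notin> box a b" unfolding mem_box_cart by blast
    then show ?thesis using W0 by simp
  qed (simp add: W0)
  then have "(\<lambda>x. W x * W (x - r *\<^sub>R axis i 1)) = (\<lambda>_. 0)" by (rule ext)
  then show ?thesis by (simp add: corr_def)
qed

section \<open>Testing the equation with the solution\<close>

definition bump :: "real \<Rightarrow> real" where
  "bump t = exp_bump (1 + t) * exp_bump (1 - t)"

lemma smooth_real_bump: "smooth_real bump"
  unfolding bump_def[abs_def]
  using smooth_real_mult[OF smooth_real_affine[OF smooth_real_exp_bump_poly, of 1 1 1]
      smooth_real_affine[OF smooth_real_exp_bump_poly, of 1 "-1" 1]]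
  by (simp add: add.commute)

lemma bump_nonneg: "0 \<le> bump t" and bump_le_1: "bump t \<le> 1"
  and bump_eq_0: "t \<notin> {-1<..<1} \<Longrightarrow> bump t = 0" and bump_0: "0 < bump 0"
proof -
  show "0 \<le> bump t" by (simp add: bump_def exp_bump_eq)
  show "bump t \<le> 1" unfolding bump_def exp_bump_eq by (auto intro!: mult_le_one)
  show "t \<notin> {-1<..<1} \<Longrightarrow> bump t = 0" by (auto simp: bump_def exp_bump_eq)
  show "0 < bump 0" by (simp add: bump_def exp_bump_eq)
qed

abbreviation bump_prod :: "real ^ 'n::finite \<Rightarrow> real" where
  "bump_prod \<equiv> coord_prod (\<lambda>_. bump)"

abbreviation bump_prod_deriv :: "'n \<Rightarrow> real ^ 'n::finite \<Rightarrow> real" where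
  "bump_prod_deriv i \<equiv> coord_prod ((\<lambda>_. bump)(i := deriv bump))"

lemma bump_prod_nonneg: "0 \<le> bump_prod y"
  by (auto simp: coord_prod_def intro!: prod_nonneg bump_nonneg)

lemma bump_prod_le_1: "bump_prod y \<le> 1"
  by (auto simp: coord_prod_def intro!: prod_le_1 bump_nonneg bump_le_1)

lemma smooth_bump_prod: "smooth bump_prod" "smooth (bump_prod_deriv i)"
  by (auto intro!: smooth_coord_prod smooth_real_bump smooth_real_deriv)

lemma coord_prod_eq_0: "F i (x $ i) = 0 \<Longrightarrow> coord_prod F x = 0"
  by (auto simp: coord_prod_def)

lemma bump_prod_eq_0: "y \<notin> cbox (- 1) 1 \<Longrightarrow> bump_prod y = 0"
proof -
  assume "y \<notin> cbox (- 1) 1"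
  then obtain j where "y $ j \<notin> {-1..1}" by (auto simp: mem_box_cart)
  then show ?thesis by (intro coord_prod_eq_0[where i = j]) (auto simp: bump_eq_0)
qed

lemma deriv_bump_eq_0: "t \<notin> {-1..1} \<Longrightarrow> deriv bump t = 0"
proof -
  assume t: "t \<notin> {-1..1}"
  have "((\<lambda>_. 0) has_real_derivative 0) (at t)" by simp
  then have "(bump has_real_derivative 0) (at t)"
    by (rule has_field_derivative_transform_within_open[where S = "- {-1..1}"])
       (use t in \<open>auto simp: bump_eq_0\<close>)
  then show ?thesis by (rule DERIV_imp_deriv)
qed

lemma bump_prod_deriv_eq_0: "y \<notin> cbox (- 1) 1 \<Longrightarrow> bump_prod_deriv i y = 0"
proof -
  assume "y \<notin> cbox (- 1) 1"
  then obtain j where "y $ j \<notin> {-1..1}" by (auto simp: mem_box_cart)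
  then show ?thesis by (intro coord_prod_eq_0[where i = j]) (auto simp: bump_eq_0 deriv_bump_eq_0)
qed

lemma bump_prod_deriv_bounded: "\<exists>B. \<forall>y. \<bar>bump_prod_deriv i y\<bar> \<le> B"
proof -
  obtain B where B: "0 < B" "\<And>x. x \<in> cbox (-1) 1 \<Longrightarrow> \<bar>bump_prod_deriv i x\<bar> \<le> B"
    using continuous_bounded_on_cbox[OF smooth_continuous[OF smooth_bump_prod(2)]] by blast
  have "\<bar>bump_prod_deriv i y\<bar> \<le> B" for y
    using B bump_prod_deriv_eq_0[of y i] by (cases "y \<in> cbox (-1) 1") auto
  then show ?thesis by blast
qed

lemma bump_prod_affine:
  "(\<lambda>x. bump_prod (s *\<^sub>R x + d)) = coord_prod (\<lambda>j t. bump (s * t + d $ j))"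
  by (auto simp: coord_prod_def)

lemma smooth_bump_prod_affine: "smooth (\<lambda>x. bump_prod (s *\<^sub>R x + d))"
  unfolding bump_prod_affine by (intro smooth_coord_prod smooth_real_affine smooth_real_bump)

lemma pderiv_at_bump_prod_affine:
  "pderiv_at i (\<lambda>x. bump_prod (s *\<^sub>R x + d)) x = s * bump_prod_deriv i (s *\<^sub>R x + d)"
proof -
  have d: "deriv (\<lambda>t. bump (s * t + d $ i)) = (\<lambda>t. s * deriv bump (s * t + d $ i))"
  proof (intro ext DERIV_imp_deriv)
    fix t
    have "(bump has_real_derivative deriv bump (s * t + d $ i)) (at (s * t + d $ i))"
      by (rule smooth_real_DERIV[OF smooth_real_bump])
    then show "((\<lambda>t. bump (s * t + d $ i)) has_real_derivative s * deriv bump (s * t + d $ i)) (at t)"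
      by (rule DERIV_cong[OF DERIV_chain2]) (auto intro!: derivative_eq_intros)
  qed
  show ?thesis
    unfolding bump_prod_affine
    by (subst pderiv_at_coord_prod, intro smooth_real_affine smooth_real_bump)
       (simp add: d coord_prod_def prod.remove[of UNIV i] cong: prod.cong_simp)
qed

lemma integrable_bump_prod: "integrable lborel (bump_prod :: real ^ 'n::finite \<Rightarrow> real)"
proof -
  have "integrable lborel (\<lambda>x::real ^ 'n. indicator (cbox (-1) 1) x *\<^sub>R bump_prod x)"
    by (intro borel_integrable_compact smooth_continuous smooth_bump_prod) auto
  also have "(\<lambda>x::real ^ 'n. indicator (cbox (-1) 1) x *\<^sub>R bump_prod x) = bump_prod"
    using bump_prod_eq_0 by (force simp: fun_eq_iff indicator_def)
  finally show ?thesis .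
qed

text \<open>The mollifier is left unnormalised; its mass is carried as a factor, which is cancelled
  at the end by positivity.\<close>

definition bump_mass :: "'n::finite itself \<Rightarrow> real" where
  "bump_mass _ = (LBINT y. bump_prod (y :: real ^ 'n))"

lemma bump_mass_pos: "0 < bump_mass TYPE('n::finite)"
proof -
  have "bump_mass TYPE('n) \<noteq> 0"
  proof
    assume "bump_mass TYPE('n) = 0"
    then have ae: "AE y :: real ^ 'n in lborel. bump_prod y = 0"
      unfolding bump_mass_def
      using integral_nonneg_eq_0_iff_AE[OF integrable_bump_prod[where 'n = 'n]] by (simp add: bump_prod_nonneg)
    have "open {y :: real ^ 'n. bump_prod y \<noteq> 0}"
      by (intro open_Collect_neq smooth_continuous smooth_bump_prod continuous_on_const)
    then have "{y :: real ^ 'n. bump_prod y \<noteq> 0} \<in> sets lborel" by simp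
    with ae have "{y :: real ^ 'n. bump_prod y \<noteq> 0} \<in> null_sets lborel"
      by (subst (asm) AE_iff_measurable[OF _ refl]) (auto simp: null_sets_def)
    then have "negligible {y :: real ^ 'n. bump_prod y \<noteq> 0}"
      by (simp add: negligible_iff_null_sets null_sets_completionI)
    then have "{y :: real ^ 'n. bump_prod y \<noteq> 0} = {}"
      using open_not_negligible \<open>open {y :: real ^ 'n. bump_prod y \<noteq> 0}\<close> by blast
    moreover have "bump_prod (0 :: real ^ 'n) \<noteq> 0" using bump_0 by (auto simp: coord_prod_def)
    ultimately show False by blast
  qed
  moreover have "0 \<le> bump_mass TYPE('n)"
    unfolding bump_mass_def by (intro Bochner_Integration.integral_nonneg) (simp add: bump_prod_nonneg)
  ultimately show ?thesis by simp
qed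

text \<open>The change of variables divides the integral by a power of \<open>s\<close>, which is at
  least 1. Applied with \<open>s = 1 + \<delta>\<close>, it gives bounds uniform in the
  dilation.\<close>

lemma nn_integral_lborel_affine_le:
  fixes f :: "'a::euclidean_space \<Rightarrow> ennreal"
  assumes [measurable]: "f \<in> borel_measurable borel" and s: "1 \<le> s"
  shows "(\<integral>\<^sup>+x. f (s *\<^sub>R x + t) \<partial>lborel) \<le> (\<integral>\<^sup>+x. f x \<partial>lborel)"
proof -
  have s0: "s \<noteq> 0" using s by simp
  have "(\<integral>\<^sup>+x. f x \<partial>lborel) = ennreal (\<bar>s\<bar> ^ DIM('a)) * (\<integral>\<^sup>+x. f (t + s *\<^sub>R x) \<partial>lborel)"
    by (subst lborel_affine[OF s0, of t]) (simp add: nn_integral_density nn_integral_distr nn_integral_cmult)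
  moreover have "1 * (\<integral>\<^sup>+x. f (t + s *\<^sub>R x) \<partial>lborel) \<le> ennreal (\<bar>s\<bar> ^ DIM('a)) * (\<integral>\<^sup>+x. f (t + s *\<^sub>R x) \<partial>lborel)"
    using s by (intro mult_right_mono) (auto simp flip: ennreal_1 intro!: ennreal_leI)
  ultimately show ?thesis by (simp add: add.commute)
qed

lemma lborel_integral_affine:
  fixes f :: "'a::euclidean_space \<Rightarrow> real"
  assumes [measurable]: "f \<in> borel_measurable borel" and s: "s \<noteq> 0"
  shows "(LBINT x. f x) = \<bar>s\<bar> ^ DIM('a) * (LBINT x. f (t + s *\<^sub>R x))"
  by (subst lborel_affine[OF s, of t]) (simp add: integral_density integral_distr)

text \<open>The boundary data vanish, so the solution, extended by \<open>0\<close>, is approximated by test functions after a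
  dilation of the box about its centre (by \<open>1 + \<delta>\<close>, which moves the support into the open box)
  and a mollification at a scale proportional to \<open>\<delta>\<close>. Only the resulting pairing with the flux is needed.\<close>

definition dilate :: "real ^ 'n::finite \<Rightarrow> real \<Rightarrow> real \<Rightarrow> real ^ 'n \<Rightarrow> real ^ 'n \<Rightarrow> real ^ 'n" where
  "dilate c \<mu> \<delta> x y = (1 + \<delta>) *\<^sub>R x + (- \<delta> *\<^sub>R c - (\<delta> * \<mu>) *\<^sub>R y)"

text \<open>\<open>F\<close> tested against the dilated and mollified \<open>V\<close>. It is one
  integral over pairs, so that Fubini and Cauchy-Schwarz apply without naming the mollified
  function.\<close>

definition mollified_pairing ::
    "real ^ 'n::finite \<Rightarrow> real \<Rightarrow> real \<Rightarrow> (real ^ 'n \<Rightarrow> real) \<Rightarrow> (real ^ 'n \<Rightarrow> real) \<Rightarrow> real" where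
  "mollified_pairing c \<mu> \<delta> F V =
    (\<integral>(x, y). F x * (bump_prod y * V (dilate c \<mu> \<delta> x y)) \<partial>lborel2)"

lemma dilate_borel[measurable]:
  "(\<lambda>z. dilate c \<mu> \<delta> (fst z) (snd z)) \<in> borel_measurable lborel2"
  unfolding dilate_def by measurable

text \<open>Cauchy-Schwarz on the product space, with the bump split into two square roots. The
  bound does not depend on \<open>\<delta>\<close>, which is what later extends the limit from
  continuous to square integrable \<open>V\<close>.\<close>

lemma mollified_pairing_L2:
  fixes F V :: "real ^ 'n::finite \<Rightarrow> real"
  assumes F: "L2 lborel F" and V: "L2 lborel V" and \<delta>: "0 < \<delta>"
  shows "integrable lborel2 (\<lambda>(x, y). F x * (bump_prod y * V (dilate c \<mu> \<delta> x y)))"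
    and "\<bar>mollified_pairing c \<mu> \<delta> F V\<bar> \<le> bump_mass TYPE('n) * (L2_norm lborel F * L2_norm lborel V)"
proof -
  let ?M = "lborel2 :: ((real ^ 'n) \<times> (real ^ 'n)) measure" and ?Z = "bump_mass TYPE('n)"
  have [measurable]: "F \<in> borel_measurable borel" "V \<in> borel_measurable borel"
    "bump_prod \<in> borel_measurable (borel :: (real ^ 'n) measure)"
    using F V smooth_borel[OF smooth_bump_prod(1)] by (auto simp: L2_borel)
  define f where "f z = F (fst z) * sqrt (bump_prod (snd z))" for z :: "(real ^ 'n) \<times> (real ^ 'n)"
  define g where "g z = sqrt (bump_prod (snd z)) * V (dilate c \<mu> \<delta> (fst z) (snd z))" for z
  have [measurable]: "f \<in> borel_measurable ?M" "g \<in> borel_measurable ?M"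
    unfolding f_def[abs_def] g_def[abs_def] by measurable
  have sec: "(\<integral>\<^sup>+x. ennreal ((G x)\<^sup>2 * bump_prod y) \<partial>lborel) \<le> ennreal ((L2_norm lborel U)\<^sup>2 * bump_prod y)"
    if "(\<integral>\<^sup>+x. ennreal ((G x)\<^sup>2) \<partial>lborel) \<le> ennreal ((L2_norm lborel U)\<^sup>2)" "G \<in> borel_measurable borel"
    for G U :: "real ^ 'n \<Rightarrow> real" and y :: "real ^ 'n"
  proof -
    have "(\<integral>\<^sup>+x. ennreal ((G x)\<^sup>2 * bump_prod y) \<partial>lborel) = (\<integral>\<^sup>+x. ennreal ((G x)\<^sup>2) \<partial>lborel) * ennreal (bump_prod y)"
      using that(2) by (subst nn_integral_multc[symmetric]) (auto simp: ennreal_mult bump_prod_nonneg)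
    also have "\<dots> \<le> ennreal ((L2_norm lborel U)\<^sup>2) * ennreal (bump_prod y)"
      by (rule mult_right_mono[OF that(1)]) simp
    finally show ?thesis by (simp add: ennreal_mult bump_prod_nonneg)
  qed
  have fsec: "(\<integral>\<^sup>+x. ennreal ((f (x, y))\<^sup>2) \<partial>lborel) \<le> ennreal ((L2_norm lborel F)\<^sup>2 * bump_prod y)" for y
    using sec[of F F y] L2_nn_integral[OF F]
    by (simp add: f_def power_mult_distrib bump_prod_nonneg)
  have gsec: "(\<integral>\<^sup>+x. ennreal ((g (x, y))\<^sup>2) \<partial>lborel) \<le> ennreal ((L2_norm lborel V)\<^sup>2 * bump_prod y)" for y
  proof -
    have "(\<integral>\<^sup>+x. ennreal ((V (dilate c \<mu> \<delta> x y))\<^sup>2) \<partial>lborel) \<le> ennreal ((L2_norm lborel V)\<^sup>2)"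
      using nn_integral_lborel_affine_le[of "\<lambda>x. ennreal ((V x)\<^sup>2)" "1 + \<delta>" "- \<delta> *\<^sub>R c - (\<delta> * \<mu>) *\<^sub>R y"] L2_nn_integral[OF V] \<delta>
      by (simp add: dilate_def)
    moreover have "(\<lambda>x. V (dilate c \<mu> \<delta> x y)) \<in> borel_measurable borel"
      unfolding dilate_def by measurable
    ultimately show ?thesis
      using sec[of "\<lambda>x. V (dilate c \<mu> \<delta> x y)" V y]
      by (simp add: g_def power_mult_distrib bump_prod_nonneg mult.commute)
  qed
  have L2: "L2 ?M h \<and> (L2_norm ?M h)\<^sup>2 \<le> (L2_norm lborel U)\<^sup>2 * ?Z"
    if [measurable]: "h \<in> borel_measurable ?M"
      and s: "\<And>y. (\<integral>\<^sup>+x. ennreal ((h (x, y))\<^sup>2) \<partial>lborel) \<le> ennreal ((L2_norm lborel U)\<^sup>2 * bump_prod y)"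
    for h and U :: "real ^ 'n \<Rightarrow> real"
  proof
    have bi: "integrable lborel (\<lambda>y::real ^ 'n. (L2_norm lborel U)\<^sup>2 * bump_prod y)"
      by (simp add: integrable_bump_prod)
    have "integrable ?M (\<lambda>z. (h z)\<^sup>2)"
      by (rule integrable_pair_sections[OF _ _ bi]) (use s in auto)
    then show L: "L2 ?M h" by (simp add: L2_def)
    have "ennreal ((L2_norm ?M h)\<^sup>2) = (\<integral>\<^sup>+z. ennreal ((h z)\<^sup>2) \<partial>?M)"
      using L2_nn_integral[OF L] by simp
    also have "\<dots> = (\<integral>\<^sup>+y. \<integral>\<^sup>+x. ennreal ((h (x, y))\<^sup>2) \<partial>lborel \<partial>lborel)"
      by (subst lborel_pair.nn_integral_snd[symmetric]) auto
    also have "\<dots> \<le> (\<integral>\<^sup>+y. ennreal ((L2_norm lborel U)\<^sup>2 * bump_prod (y :: real ^ 'n)) \<partial>lborel)"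
      by (intro nn_integral_mono s)
    also have "\<dots> = ennreal ((L2_norm lborel U)\<^sup>2 * ?Z)"
      unfolding bump_mass_def using bi by (subst nn_integral_eq_integral) (auto simp: bump_prod_nonneg)
    finally show "(L2_norm ?M h)\<^sup>2 \<le> (L2_norm lborel U)\<^sup>2 * ?Z"
      using bump_mass_pos[where 'n = 'n] by (subst (asm) ennreal_le_iff) auto
  qed
  have fL: "L2 ?M f" "(L2_norm ?M f)\<^sup>2 \<le> (L2_norm lborel F)\<^sup>2 * ?Z" using L2[OF _ fsec] by auto
  have gL: "L2 ?M g" "(L2_norm ?M g)\<^sup>2 \<le> (L2_norm lborel V)\<^sup>2 * ?Z" using L2[OF _ gsec] by auto
  have fg: "(\<lambda>z. f z * g z) = (\<lambda>(x, y). F x * (bump_prod y * V (dilate c \<mu> \<delta> x y)))"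
  proof (rule ext, clarify)
    fix x y :: "real ^ 'n"
    have "sqrt (bump_prod y) * (sqrt (bump_prod y) * t) = bump_prod y * t" for t
      using bump_prod_nonneg[of y] by (simp flip: mult.assoc)
    then show "f (x, y) * g (x, y) = F x * (bump_prod y * V (dilate c \<mu> \<delta> x y))"
      by (simp add: f_def g_def)
  qed
  show "integrable ?M (\<lambda>(x, y). F x * (bump_prod y * V (dilate c \<mu> \<delta> x y)))"
    using L2_prod_integrable[OF fL(1) gL(1)] unfolding fg .
  have "\<bar>mollified_pairing c \<mu> \<delta> F V\<bar> \<le> L2_norm ?M f * L2_norm ?M g"
    using L2_inner_bound[OF fL(1) gL(1)] unfolding fg mollified_pairing_def .
  also have "\<dots> \<le> ?Z * (L2_norm lborel F * L2_norm lborel V)"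
  proof (rule power2_le_imp_le)
    have "(L2_norm ?M f * L2_norm ?M g)\<^sup>2 \<le> ((L2_norm lborel F)\<^sup>2 * ?Z) * ((L2_norm lborel V)\<^sup>2 * ?Z)"
      unfolding power_mult_distrib by (intro mult_mono fL(2) gL(2)) (auto simp: bump_mass_pos less_imp_le)
    then show "(L2_norm ?M f * L2_norm ?M g)\<^sup>2 \<le> (?Z * (L2_norm lborel F * L2_norm lborel V))\<^sup>2"
      by (simp add: power_mult_distrib power2_eq_square mult_ac)
  qed (intro mult_nonneg_nonneg less_imp_le[OF bump_mass_pos] L2_norm_nonneg)
  finally show "\<bar>mollified_pairing c \<mu> \<delta> F V\<bar> \<le> ?Z * (L2_norm lborel F * L2_norm lborel V)" .
qed

lemma mollified_pairing_diff:
  fixes F V W :: "real ^ 'n::finite \<Rightarrow> real"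
  assumes "L2 lborel F" "L2 lborel V" "L2 lborel W" "0 < \<delta>"
  shows "mollified_pairing c \<mu> \<delta> F V - mollified_pairing c \<mu> \<delta> F W = mollified_pairing c \<mu> \<delta> F (\<lambda>x. V x - W x)"
  unfolding mollified_pairing_def
  by (subst Bochner_Integration.integral_diff[symmetric])
     (auto intro!: mollified_pairing_L2 assms Bochner_Integration.integral_cong simp: algebra_simps)

text \<open>Dominated convergence. The jump of the integrand at the boundary is harmless: for
  \<open>x\<close> in the open box the dilated points eventually lie in it too, and elsewhere
  \<open>F\<close> vanishes.\<close>

lemma mollified_pairing_tendsto_continuous:
  fixes F v :: "real ^ 'n::finite \<Rightarrow> real"
  assumes F: "integrable lborel F" and F0: "\<And>x. x \<notin> box a b \<Longrightarrow> F x = 0" and v: "continuous_on UNIV v"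
    and \<delta>: "\<delta> \<longlonglongrightarrow> 0"
  shows "(\<lambda>k. mollified_pairing c \<mu> (\<delta> k) F (\<lambda>x. indicator (box a b) x * v x))
    \<longlonglongrightarrow> bump_mass TYPE('n) * (LBINT x. F x * (indicator (box a b) x * v x))"
proof -
  let ?V = "\<lambda>x. indicator (box a b) x * v x"
  have [measurable]: "F \<in> borel_measurable borel" "v \<in> borel_measurable borel"
    "bump_prod \<in> borel_measurable (borel :: (real ^ 'n) measure)"
    using F borel_measurable_continuous_onI[OF v] smooth_borel[OF smooth_bump_prod(1)] by auto
  obtain B where B: "0 < B" "\<And>x. x \<in> cbox a b \<Longrightarrow> \<bar>v x\<bar> \<le> B"
    using continuous_bounded_on_cbox[OF v] by blast
  have VB: "\<bar>?V x\<bar> \<le> B" for x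
    using B box_subset_cbox[of a b] by (auto simp: indicator_def)
  have bound: "norm (F x * (bump_prod y * t)) \<le> B * norm (F x * bump_prod y)" if "\<bar>t\<bar> \<le> B" for x y :: "real ^ 'n" and t
    using mult_left_mono[OF that, of "\<bar>F x * bump_prod y\<bar>"] by (simp add: abs_mult mult_ac)
  have FB: "integrable lborel2 (\<lambda>(x, y). F x * bump_prod (y :: real ^ 'n))"
  proof (rule lborel_pair.Fubini_integrable)
    show "integrable lborel (\<lambda>x. LBINT y. norm (case (x, y) of (x, y) \<Rightarrow> F x * bump_prod (y :: real ^ 'n)))"
      using F by (simp add: abs_mult)
    show "AE x in lborel. integrable lborel (\<lambda>y. case (x, y) of (x, y) \<Rightarrow> F x * bump_prod (y :: real ^ 'n))"
      by (simp add: integrable_bump_prod)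
  qed measurable
  have "(\<lambda>k. mollified_pairing c \<mu> (\<delta> k) F ?V)
    \<longlonglongrightarrow> (\<integral>(x, y). F x * (bump_prod (y :: real ^ 'n) * ?V x) \<partial>lborel2)"
    unfolding mollified_pairing_def
  proof (rule integral_dominated_convergence)
    show "integrable lborel2 (\<lambda>z. B * norm (case z of (x, y) \<Rightarrow> F x * bump_prod (y :: real ^ 'n)))"
      using FB by (intro integrable_mult_right integrable_norm)
    show "AE z in lborel2. norm (case z of (x, y) \<Rightarrow> F x * (bump_prod y * ?V (dilate c \<mu> (\<delta> k) x y)))
        \<le> B * norm (case z of (x, y) \<Rightarrow> F x * bump_prod (y :: real ^ 'n))" for k
      using bound[OF VB] by (auto simp: split_def)
    show "AE z in lborel2. (\<lambda>k. case z of (x, y) \<Rightarrow> F x * (bump_prod y * ?V (dilate c \<mu> (\<delta> k) x y)))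
       \<longlonglongrightarrow> (case z of (x, y) \<Rightarrow> F x * (bump_prod (y :: real ^ 'n) * ?V x))"
    proof (rule AE_I2, clarsimp)
      fix x y :: "real ^ 'n"
      show "(\<lambda>k. F x * (bump_prod y * ?V (dilate c \<mu> (\<delta> k) x y))) \<longlonglongrightarrow> F x * (bump_prod y * ?V x)"
      proof (cases "x \<in> box a b")
        case True
        have "(\<lambda>k. dilate c \<mu> (\<delta> k) x y) \<longlonglongrightarrow> (1 + 0) *\<^sub>R x + (- 0 *\<^sub>R c - (0 * \<mu>) *\<^sub>R y)"
          unfolding dilate_def by (intro tendsto_intros \<delta>)
        then have lim: "(\<lambda>k. dilate c \<mu> (\<delta> k) x y) \<longlonglongrightarrow> x" by simp
        have "\<forall>\<^sub>F k in sequentially. dilate c \<mu> (\<delta> k) x y \<in> box a b"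
          by (rule topological_tendstoD[OF lim open_box True])
        then have ev: "\<forall>\<^sub>F k in sequentially. v (dilate c \<mu> (\<delta> k) x y) = ?V (dilate c \<mu> (\<delta> k) x y)"
          by eventually_elim simp
        have "(\<lambda>k. v (dilate c \<mu> (\<delta> k) x y)) \<longlonglongrightarrow> v x"
          by (rule continuous_on_tendsto_compose[OF v lim]) auto
        then have "(\<lambda>k. ?V (dilate c \<mu> (\<delta> k) x y)) \<longlonglongrightarrow> v x"
          by (rule Lim_transform_eventually[OF _ ev])
        then have "(\<lambda>k. F x * (bump_prod y * ?V (dilate c \<mu> (\<delta> k) x y))) \<longlonglongrightarrow> F x * (bump_prod y * v x)"
          by (rule tendsto_mult_left[OF tendsto_mult_left])
        then show ?thesis using True by simp
      qed (simp add: F0)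
    qed
    show "(\<lambda>z. case z of (x, y) \<Rightarrow> F x * (bump_prod (y :: real ^ 'n) * ?V x)) \<in> borel_measurable lborel2"
      by measurable
    show "(\<lambda>z. case z of (x, y) \<Rightarrow> F x * (bump_prod y * ?V (dilate c \<mu> (\<delta> k) x y))) \<in> borel_measurable lborel2" for k
      unfolding split_def by measurable
  qed
  also have "(\<integral>(x, y). F x * (bump_prod (y :: real ^ 'n) * ?V x) \<partial>lborel2)
     = (LBINT x. (LBINT y. F x * (bump_prod (y :: real ^ 'n) * ?V x)))"
  proof (rule lborel_pair.integral_fst[symmetric])
    show "integrable lborel2 (\<lambda>(x, y). F x * (bump_prod (y :: real ^ 'n) * ?V x))"
    proof (rule Bochner_Integration.integrable_bound)
      show "integrable lborel2 (\<lambda>z. B * norm (case z of (x, y) \<Rightarrow> F x * bump_prod (y :: real ^ 'n)))"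
        using FB by (intro integrable_mult_right integrable_norm)
      show "AE z in lborel2. norm (case z of (x, y) \<Rightarrow> F x * (bump_prod (y :: real ^ 'n) * ?V x))
         \<le> norm (B * norm (case z of (x, y) \<Rightarrow> F x * bump_prod (y :: real ^ 'n)))"
        using bound[OF VB] B(1) by (auto simp: split_def)
    qed measurable
  qed
  also have "\<dots> = bump_mass TYPE('n) * (LBINT x. F x * ?V x)"
  proof -
    have "(LBINT y. F x * (bump_prod (y :: real ^ 'n) * ?V x)) = bump_mass TYPE('n) * (F x * ?V x)" for x
      by (simp add: bump_mass_def)
    then show ?thesis by (simp only: integral_mult_right_zero)
  qed
  finally show ?thesis .
qed

text \<open>An argument with three errors of size \<open>\<epsilon> / 3\<close>: replacing
  \<open>W\<close> by \<open>V m\<close> costs the same small amount for every \<open>k\<close>, by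
  the uniform bound.\<close>

lemma mollified_pairing_tendsto:
  fixes F W :: "real ^ 'n::finite \<Rightarrow> real"
  assumes F: "L2 lborel F" and W: "L2 lborel W" and V: "\<And>m. L2 lborel (V m)"
    and VW: "(\<lambda>m. L2_norm lborel (\<lambda>x. V m x - W x)) \<longlonglongrightarrow> 0" and \<delta>: "\<And>k. 0 < \<delta> k"
    and lim: "\<And>m::nat. (\<lambda>k. mollified_pairing c \<mu> (\<delta> k) F (V m)) \<longlonglongrightarrow> bump_mass TYPE('n) * (LBINT x. F x * V m x)"
  shows "(\<lambda>k. mollified_pairing c \<mu> (\<delta> k) F W) \<longlonglongrightarrow> bump_mass TYPE('n) * (LBINT x. F x * W x)"
proof (rule LIMSEQ_I)
  let ?Z = "bump_mass TYPE('n)" and ?P = "\<lambda>k. mollified_pairing c \<mu> (\<delta> k) F"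
  fix \<epsilon> :: real assume \<epsilon>: "0 < \<epsilon>"
  have "(\<lambda>m. ?Z * (L2_norm lborel F * L2_norm lborel (\<lambda>x. V m x - W x))) \<longlonglongrightarrow> ?Z * (L2_norm lborel F * 0)"
    by (intro tendsto_intros VW)
  then have "\<forall>\<^sub>F m in sequentially. ?Z * (L2_norm lborel F * L2_norm lborel (\<lambda>x. V m x - W x)) < \<epsilon> / 3"
    using \<epsilon> by (intro order_tendstoD(2)) auto
  then obtain m where m: "?Z * (L2_norm lborel F * L2_norm lborel (\<lambda>x. V m x - W x)) < \<epsilon> / 3"
    by (auto simp: eventually_sequentially)
  obtain K where K: "\<And>k. K \<le> k \<Longrightarrow> norm (?P k (V m) - ?Z * (LBINT x. F x * V m x)) < \<epsilon> / 3"
    using LIMSEQ_D[OF lim[of m], of "\<epsilon> / 3"] \<epsilon> by auto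
  have VmW: "L2 lborel (\<lambda>x. V m x - W x)" by (intro L2_diff V W)
  have 1: "\<bar>?P k (V m) - ?P k W\<bar> < \<epsilon> / 3" for k
    unfolding mollified_pairing_diff[OF F V[of m] W \<delta>]
    using mollified_pairing_L2(2)[OF F VmW \<delta>[of k], of c \<mu>] m by linarith
  have "(LBINT x. F x * V m x) - (LBINT x. F x * W x) = (LBINT x. F x * (V m x - W x))"
    unfolding right_diff_distrib
    by (rule Bochner_Integration.integral_diff[symmetric]) (intro L2_prod_integrable F V W)+
  then have "\<bar>?Z * (LBINT x. F x * V m x) - ?Z * (LBINT x. F x * W x)\<bar> = ?Z * \<bar>LBINT x. F x * (V m x - W x)\<bar>"
    using bump_mass_pos[where 'n = 'n] by (simp add: abs_mult flip: right_diff_distrib)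
  also have "\<dots> \<le> ?Z * (L2_norm lborel F * L2_norm lborel (\<lambda>x. V m x - W x))"
    by (intro mult_left_mono L2_inner_bound F VmW less_imp_le bump_mass_pos)
  finally have 2: "\<bar>?Z * (LBINT x. F x * V m x) - ?Z * (LBINT x. F x * W x)\<bar> < \<epsilon> / 3" using m by linarith
  have "norm (?P k W - ?Z * (LBINT x. F x * W x)) < \<epsilon>" if "K \<le> k" for k
    using 1[of k] 2 K[OF that] unfolding real_norm_def by linarith
  then show "\<exists>K. \<forall>k\<ge>K. norm (?P k W - ?Z * (LBINT x. F x * W x)) < \<epsilon>" by blast
qed

text \<open>The solution \<open>y\<close> of \<open>dilate c \<mu> \<delta> x y = z\<close>. Thus
  \<open>bump_prod (dilated_bump c \<mu> \<delta> x z)\<close> is the mollifying kernel in the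
  variables \<open>x\<close> and \<open>z\<close>, up to the power of
  \<open>\<delta> * \<mu>\<close> in \<open>inner_mollified\<close>.\<close>

definition dilated_bump :: "real ^ 'n::finite \<Rightarrow> real \<Rightarrow> real \<Rightarrow> real ^ 'n \<Rightarrow> real ^ 'n \<Rightarrow> real ^ 'n" where
  "dilated_bump c \<mu> \<delta> x z = (1 / (\<delta> * \<mu>)) *\<^sub>R ((1 + \<delta>) *\<^sub>R x - \<delta> *\<^sub>R c - z)"

lemma dilated_bump_dilate:
  "\<delta> * \<mu> \<noteq> 0 \<Longrightarrow> dilated_bump c \<mu> \<delta> x (dilate c \<mu> \<delta> x y) = y"
  by (simp add: dilated_bump_def dilate_def)

lemma dilated_bump_eq:
  "dilated_bump c \<mu> \<delta> x z = ((1 + \<delta>) / (\<delta> * \<mu>)) *\<^sub>R x + (- 1 / (\<delta> * \<mu>)) *\<^sub>R (\<delta> *\<^sub>R c + z)"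
  "dilated_bump c \<mu> \<delta> x z = (- 1 / (\<delta> * \<mu>)) *\<^sub>R z + (1 / (\<delta> * \<mu>)) *\<^sub>R ((1 + \<delta>) *\<^sub>R x - \<delta> *\<^sub>R c)"
  by (simp_all add: dilated_bump_def algebra_simps divide_inverse flip: scaleR_add_left)

lemma dilated_bump_borel[measurable]:
  "(\<lambda>p. dilated_bump c \<mu> \<delta> (fst p) (snd p)) \<in> borel_measurable lborel2"
  unfolding dilated_bump_def by measurable

text \<open>The derivatives of the kernel in \<open>x\<close> and in \<open>z\<close> are constant
  multiples of the same function. This links the equation, which concerns \<open>x\<close>, with
  integration by parts in \<open>z\<close>.\<close>

lemma pderiv_at_dilated_bump:
  "pderiv_at i (\<lambda>x. bump_prod (dilated_bump c \<mu> \<delta> x z)) x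
    = (1 + \<delta>) / (\<delta> * \<mu>) * bump_prod_deriv i (dilated_bump c \<mu> \<delta> x z)"
  "pderiv_at i (\<lambda>z. bump_prod (dilated_bump c \<mu> \<delta> x z)) z
    = - 1 / (\<delta> * \<mu>) * bump_prod_deriv i (dilated_bump c \<mu> \<delta> x z)"
  unfolding dilated_bump_eq(1) pderiv_at_bump_prod_affine
  by (rule refl) (unfold dilated_bump_eq(1)[symmetric], unfold dilated_bump_eq(2) pderiv_at_bump_prod_affine, rule refl)

lemma smooth_dilated_bump: "smooth (\<lambda>z. bump_prod (dilated_bump c \<mu> \<delta> x z))"
  unfolding dilated_bump_eq(2) by (rule smooth_bump_prod_affine)

text \<open>The kernel is nonzero only if (1 + \<delta>) (x_j - c_j) is within \<delta> \<mu> of z_j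
  - c_j for all j, where c is the centre. As z_j - c_j is at most half the width, x_j - c_j is at
  most \<open>r j\<close>, and \<mu> being at most a quarter of the width makes \<open>r j\<close>
  smaller than half of it. Hence even for \<open>z\<close> on the boundary the support lies in the
  open box.\<close>

lemma test_function_dilated_bump:
  fixes a b :: "real ^ 'n::finite"
  assumes \<mu>: "0 < \<mu>" "\<And>j. \<mu> \<le> (b $ j - a $ j) / 4" and \<delta>: "0 < \<delta>" and z: "z \<in> cbox a b"
  shows "test_function (box a b) (\<lambda>x. bump_prod (dilated_bump ((1/2) *\<^sub>R (a + b)) \<mu> \<delta> x z))"
proof -
  define c where "c = (1/2) *\<^sub>R (a + b)"
  define \<epsilon> where "\<epsilon> = \<delta> * \<mu>"
  define r where "r j = ((b $ j - a $ j) / 2 + \<epsilon>) / (1 + \<delta>)" for j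
  have \<epsilon>: "0 < \<epsilon>" using \<mu> \<delta> by (simp add: \<epsilon>_def)
  have cj: "c $ j = (a $ j + b $ j) / 2" for j by (simp add: c_def)
  have lin: "- E < G - (Z - C) \<Longrightarrow> G - (Z - C) < E \<Longrightarrow> A \<le> Z \<Longrightarrow> Z \<le> B \<Longrightarrow> C = (A + B) / 2 \<Longrightarrow>
      G < (B - A) / 2 + E \<and> - ((B - A) / 2 + E) < G" for A B C E G Z :: real
    by (simp add: field_simps)
  have r: "r j < (b $ j - a $ j) / 2" for j
  proof -
    define D where "D = (b $ j - a $ j) / 4"
    have "\<delta> * \<mu> \<le> \<delta> * D" using \<mu>(2)[of j] \<delta> by (intro mult_left_mono) (auto simp: D_def)
    moreover have "0 < \<delta> * D"
      using order_less_le_trans[OF \<mu>(1) \<mu>(2)[of j]] \<delta> by (simp add: D_def)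
    moreover have "(b $ j - a $ j) / 2 = 2 * D" by (simp add: D_def)
    ultimately have "(b $ j - a $ j) / 2 + \<epsilon> < (b $ j - a $ j) / 2 * (1 + \<delta>)"
      by (simp add: \<epsilon>_def algebra_simps)
    then show ?thesis unfolding r_def using \<delta> by (simp add: divide_less_eq)
  qed
  let ?F = "\<lambda>j t. bump ((1 + \<delta>) / \<epsilon> * t + (- 1 / \<epsilon>) * (\<delta> * c $ j + z $ j))"
  have eq: "(\<lambda>x. bump_prod (dilated_bump c \<mu> \<delta> x z)) = coord_prod ?F"
    unfolding dilated_bump_eq(1) bump_prod_affine \<epsilon>_def by simp
  show ?thesis
    unfolding c_def[symmetric] eq
  proof (rule test_function_coord_prod[where l = "\<chi> j. c $ j - r j" and u = "\<chi> j. c $ j + r j"])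
    show "smooth_real (?F j)" for j by (intro smooth_real_affine smooth_real_bump)
    show "cbox (\<chi> j. c $ j - r j) (\<chi> j. c $ j + r j) \<subseteq> box a b"
    proof
      fix x assume x: "x \<in> cbox (\<chi> j. c $ j - r j) (\<chi> j. c $ j + r j)"
      have "a $ j < x $ j \<and> x $ j < b $ j" for j
      proof -
        have "c $ j - r j \<le> x $ j" "x $ j \<le> c $ j + r j" using x by (auto simp: mem_box_cart)
        moreover have "C - R \<le> X \<Longrightarrow> X \<le> C + R \<Longrightarrow> R < (B - A) / 2 \<Longrightarrow> C = (A + B) / 2 \<Longrightarrow> A < X \<and> X < B"
          for A B C R X :: real
          by (simp add: field_simps)
        ultimately show ?thesis using r[of j] cj[of j] by blast
      qed
      then show "x \<in> box a b" by (simp add: mem_box_cart)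
    qed
    fix j t
    assume t: "t \<notin> {(\<chi> j. c $ j - r j) $ j..(\<chi> j. c $ j + r j) $ j}"
    show "?F j t = 0"
    proof (rule bump_eq_0, rule notI)
      assume m: "(1 + \<delta>) / \<epsilon> * t + (- 1 / \<epsilon>) * (\<delta> * c $ j + z $ j) \<in> {- 1<..<1}"
      have "(1 + \<delta>) / \<epsilon> * t + (- 1 / \<epsilon>) * (\<delta> * c $ j + z $ j) = ((1 + \<delta>) * (t - c $ j) - (z $ j - c $ j)) / \<epsilon>"
        using \<epsilon> by (simp add: field_simps)
      with m have "- 1 < ((1 + \<delta>) * (t - c $ j) - (z $ j - c $ j)) / \<epsilon>" "((1 + \<delta>) * (t - c $ j) - (z $ j - c $ j)) / \<epsilon> < 1"
        by auto
      then have "- \<epsilon> < (1 + \<delta>) * (t - c $ j) - (z $ j - c $ j)" "(1 + \<delta>) * (t - c $ j) - (z $ j - c $ j) < \<epsilon>"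
        using \<epsilon> by (simp_all add: less_divide_eq divide_less_eq)
      moreover have "a $ j \<le> z $ j" "z $ j \<le> b $ j" using z by (auto simp: mem_box_cart)
      ultimately have "(1 + \<delta>) * (t - c $ j) < (b $ j - a $ j) / 2 + \<epsilon>" "- ((b $ j - a $ j) / 2 + \<epsilon>) < (1 + \<delta>) * (t - c $ j)"
        using cj[of j] lin[of \<epsilon> "(1 + \<delta>) * (t - c $ j)" "z $ j" "c $ j" "a $ j" "b $ j"] by blast+
      then have "t - c $ j < r j" "- r j < t - c $ j"
        unfolding r_def using \<delta> by (simp_all add: less_divide_eq divide_less_eq mult.commute minus_divide_left)
      then show False using t by auto
    qed
  qed
qed

lemma inner_mollified:
  fixes V :: "real ^ 'n::finite \<Rightarrow> real"
  assumes [measurable]: "V \<in> borel_measurable borel" and \<delta>: "0 < \<delta>" "0 < \<mu>"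
  shows "(LBINT z. bump_prod (dilated_bump c \<mu> \<delta> x z) * V z)
     = (\<delta> * \<mu>) ^ CARD('n) * (LBINT y. bump_prod y * V (dilate c \<mu> \<delta> x y))"
proof -
  have [measurable]: "bump_prod \<in> borel_measurable (borel :: (real ^ 'n) measure)"
    by (rule smooth_borel[OF smooth_bump_prod(1)])
  have m: "(\<lambda>z. bump_prod (dilated_bump c \<mu> \<delta> x z) * V z) \<in> borel_measurable borel"
    unfolding dilated_bump_def by measurable
  have eq: "((1 + \<delta>) *\<^sub>R x - \<delta> *\<^sub>R c) + (- (\<delta> * \<mu>)) *\<^sub>R y = dilate c \<mu> \<delta> x y" for y
    by (simp add: dilate_def)
  show ?thesis
    using lborel_integral_affine[OF m, of "- (\<delta> * \<mu>)" "(1 + \<delta>) *\<^sub>R x - \<delta> *\<^sub>R c"] \<delta>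
    unfolding eq by (simp add: dilated_bump_dilate abs_mult)
qed

lemma integrable_L2_support:
  fixes F :: "'a::euclidean_space \<Rightarrow> real"
  assumes F: "L2 lborel F" and F0: "\<And>x. x \<notin> S \<Longrightarrow> F x = 0" and S: "bounded S" "S \<in> sets borel"
  shows "integrable lborel F"
proof -
  have "L2 lborel (indicator S :: 'a \<Rightarrow> real)"
    using S by (intro L2_bounded_support[where A = S and B = 1]) auto
  from L2_prod_integrable[OF this F] have "integrable lborel (\<lambda>x. indicator S x * F x)" .
  also have "(\<lambda>x. indicator S x * F x) = F" using F0 by (auto simp: fun_eq_iff indicator_def)
  finally show ?thesis .
qed

lemma L2_box_continuous:
  fixes f :: "'a::euclidean_space \<Rightarrow> real"
  assumes "continuous_on UNIV f"
  shows "L2 lborel (\<lambda>x. indicator (box a b) x * f x)"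
proof -
  obtain B where B: "0 < B" "\<And>x. x \<in> cbox a b \<Longrightarrow> \<bar>f x\<bar> \<le> B"
    using continuous_bounded_on_cbox[OF assms] by blast
  have [measurable]: "f \<in> borel_measurable borel" by (rule borel_measurable_continuous_onI[OF assms])
  have "\<bar>indicator (box a b) x * f x\<bar> \<le> B" for x
    using B box_subset_cbox[of a b] by (auto simp: indicator_def)
  then show ?thesis
    by (intro L2_bounded_support[where A = "box a b" and B = B]) auto
qed

section \<open>A weakly divergence free field is orthogonal to gradients of functions with zero
  trace\<close>

context
  fixes a b :: "real ^ 'n::finite" and \<mu> :: real and F :: "'n \<Rightarrow> real ^ 'n \<Rightarrow> real"
  assumes \<mu>: "0 < \<mu>" "\<And>j. \<mu> \<le> (b $ j - a $ j) / 4"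
    and F: "\<And>i. L2 lborel (F i)" and F0: "\<And>i x. x \<notin> box a b \<Longrightarrow> F i x = 0"
    and eqn: "\<And>\<phi>. test_function (box a b) \<phi> \<Longrightarrow> (\<Sum>i\<in>UNIV. LBINT x. F i x * pderiv_at i \<phi> x) = 0"
begin

lemma box_nonempty: "a $ j < b $ j"
  using order_less_le_trans[OF \<mu>(1) \<mu>(2)[of j]] by simp

lemma flux_integrable: "integrable lborel (F i)"
  using F F0 by (rule integrable_L2_support) auto

abbreviation (input) "ctr \<equiv> (1/2) *\<^sub>R (a + b)"

text \<open>Let K(x, z) be the kernel. For fixed \<open>x\<close> the divergence theorem in
  \<open>z\<close>, applied to K times \<open>\<psi>\<close>, splits the pairing with the gradient
  of \<open>\<psi>\<close> into a term with the gradient of K and a face term. After Fubini the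
  former contains the equation tested with K(., z) and sums to 0, so only the face terms remain. The
  factor in front undoes the scaling of the mollifier.\<close>

lemma mollified_pairing_boundary:
  assumes \<delta>: "0 < \<delta>" and \<psi>: "smooth \<psi>"
  shows "\<bar>\<Sum>i\<in>UNIV. mollified_pairing ctr \<mu> \<delta> (F i) (\<lambda>x. indicator (box a b) x * pderiv_at i \<psi> x)\<bar>
    \<le> 1 / (\<delta> * \<mu>) ^ CARD('n) * (\<Sum>i\<in>UNIV. (LBINT x. \<bar>F i x\<bar>) *
      (\<Sum>c\<in>{a $ i, b $ i}. L2_norm (face_measure a b i c) (\<lambda>_. 1) * L2_norm (face_measure a b i c) \<psi>))"
proof -
  let ?c = "ctr" and ?S = "box a b"
  let ?K = "\<lambda>x z. bump_prod (dilated_bump ?c \<mu> \<delta> x z)"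
  let ?K' = "\<lambda>i x z. bump_prod_deriv i (dilated_bump ?c \<mu> \<delta> x z)"
  let ?u = "\<lambda>z. indicator ?S z * \<psi> z" and ?s = "(\<delta> * \<mu>) ^ CARD('n)"
  have s: "0 < ?s" using \<delta> \<mu> by simp
  have \<epsilon>: "0 < \<delta> * \<mu>" using \<delta> \<mu> by simp
  have [measurable]: "F i \<in> borel_measurable borel" "pderiv_at i \<psi> \<in> borel_measurable borel"
    "\<psi> \<in> borel_measurable borel" "bump_prod \<in> borel_measurable (borel :: (real ^ 'n) measure)"
    "bump_prod_deriv i \<in> borel_measurable (borel :: (real ^ 'n) measure)" for i
    using F \<psi> by (auto simp: L2_borel smooth_borel smooth_pderiv smooth_bump_prod)
  have \<psi>c: "continuous_on UNIV \<psi>" and \<psi>'c: "continuous_on UNIV (pderiv_at i \<psi>)" for i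
    using \<psi> by (auto intro: smooth_continuous smooth_pderiv)
  \<comment> \<open>With \<open>split\<close> below, \<open>D i x\<close> is the face term,
    \<open>I i x\<close> has the derivative on \<open>\<psi>\<close>, and \<open>Q i x\<close> has
    it on the kernel, without the factor \<open>- 1 / (\<delta> * \<mu>)\<close>.\<close>
  define I where "I i x = (LBINT z. ?K x z * (indicator ?S z * pderiv_at i \<psi> z))" for i x
  define Q where "Q i x = (LBINT z. ?K' i x z * ?u z)" for i x
  define D where "D i x = (\<integral>z. ?K x z * \<psi> z \<partial>face_measure a b i (b $ i)) - (\<integral>z. ?K x z * \<psi> z \<partial>face_measure a b i (a $ i))" for i x
  have I: "integrable lborel (\<lambda>x. F i x * I i x)"
    "(LBINT x. F i x * I i x) = ?s * mollified_pairing ?c \<mu> \<delta> (F i) (\<lambda>x. indicator ?S x * pderiv_at i \<psi> x)" for i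
  proof -
    let ?V = "\<lambda>x. indicator ?S x * pderiv_at i \<psi> x"
    have V: "L2 lborel ?V" by (rule L2_box_continuous[OF \<psi>'c])
    have "I i x = ?s * (LBINT y. bump_prod y * ?V (dilate ?c \<mu> \<delta> x y))" for x
      unfolding I_def by (rule inner_mollified[OF _ \<delta> \<mu>(1)]) measurable
    then have eq: "F i x * I i x = ?s * (LBINT y. F i x * (bump_prod y * ?V (dilate ?c \<mu> \<delta> x y)))" for x
      by simp
    note pi = mollified_pairing_L2(1)[OF F V \<delta>, of i ?c \<mu>]
    show "integrable lborel (\<lambda>x. F i x * I i x)"
      unfolding eq using lborel_pair.integrable_fst[OF pi] by (rule integrable_mult_right)
    show "(LBINT x. F i x * I i x) = ?s * mollified_pairing ?c \<mu> \<delta> (F i) ?V"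
      unfolding eq mollified_pairing_def integral_mult_right_zero using lborel_pair.integral_fst[OF pi] by simp
  qed
  have \<psi>i: "integrable lborel (\<lambda>z. ?u z)"
    by (rule integrable_L2_support[OF L2_box_continuous[OF \<psi>c], of ?S]) auto
  have Q_pair: "integrable lborel2 (\<lambda>(x, z). F i x * (?K' i x z * ?u z))" for i
  proof -
    obtain B where B: "\<And>y :: real ^ 'n. \<bar>bump_prod_deriv i y\<bar> \<le> B" using bump_prod_deriv_bounded by blast
    have FB: "integrable lborel2 (\<lambda>(x, z). F i x * ?u z)"
    proof (rule lborel_pair.Fubini_integrable)
      show "integrable lborel (\<lambda>x. LBINT z. norm (case (x, z) of (x, z) \<Rightarrow> F i x * ?u z))"
        using flux_integrable[of i] by (simp add: abs_mult)
      show "AE x in lborel. integrable lborel (\<lambda>z. case (x, z) of (x, z) \<Rightarrow> F i x * ?u z)"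
        using \<psi>i by simp
    qed measurable
    show ?thesis
    proof (rule Bochner_Integration.integrable_bound)
      show "integrable lborel2 (\<lambda>p. B * norm (case p of (x, z) \<Rightarrow> F i x * ?u z))"
        by (intro integrable_mult_right integrable_norm FB)
      show "AE p in lborel2. norm (case p of (x, z) \<Rightarrow> F i x * (?K' i x z * ?u z))
         \<le> norm (B * norm (case p of (x, z) \<Rightarrow> F i x * ?u z))"
      proof (rule AE_I2, clarify)
        fix x z
        have "\<bar>F i x * ?u z\<bar> * \<bar>?K' i x z\<bar> \<le> \<bar>F i x * ?u z\<bar> * B"
          by (rule mult_left_mono[OF B]) simp
        also have "\<dots> \<le> \<bar>B * \<bar>F i x * ?u z\<bar>\<bar>"
          by (rule order_trans[OF _ abs_ge_self]) (simp add: mult.commute)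
        finally show "norm (F i x * (?K' i x z * ?u z)) \<le> norm (B * norm (F i x * ?u z))"
          by (simp add: abs_mult mult_ac)
      qed
      show "(\<lambda>(x, z). F i x * (?K' i x z * ?u z)) \<in> borel_measurable lborel2"
        unfolding split_def by measurable
    qed
  qed
  have Q: "integrable lborel (\<lambda>x. F i x * Q i x)"
    "(LBINT x. F i x * Q i x) = (LBINT z. ?u z * (LBINT x. F i x * ?K' i x z))" for i
  proof -
    show "integrable lborel (\<lambda>x. F i x * Q i x)"
      using lborel_pair.integrable_fst[OF Q_pair[of i]] by (simp add: Q_def)
    have "(LBINT x. F i x * Q i x) = (LBINT x. (LBINT z. F i x * (?K' i x z * ?u z)))"
      by (simp add: Q_def)
    also have "\<dots> = (LBINT z. (LBINT x. F i x * (?K' i x z * ?u z)))"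
      using lborel_pair.Fubini_integral[OF Q_pair[of i]] by simp
    also have "\<dots> = (LBINT z. (LBINT x. ?u z * (F i x * ?K' i x z)))"
      by (simp only: mult_ac)
    finally show "(LBINT x. F i x * Q i x) = (LBINT z. ?u z * (LBINT x. F i x * ?K' i x z))"
      by simp
  qed
  have sum_Q: "(\<Sum>i\<in>UNIV. LBINT x. F i x * Q i x) = 0"
  proof -
    \<comment> \<open>The equation is used here, once for each \<open>z\<close>, with the kernel as
      test function in \<open>x\<close>. Its \<open>x\<close>-derivative is a nonzero multiple of
      \<open>?K'\<close>, the same for all \<open>i\<close>.\<close>
    have z: "(\<Sum>i\<in>UNIV. LBINT x. F i x * ?K' i x z) = 0" if "z \<in> ?S" for z
    proof -
      have "test_function ?S (\<lambda>x. ?K x z)"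
        using that box_subset_cbox by (intro test_function_dilated_bump \<mu> \<delta>) auto
      from eqn[OF this] have "(\<Sum>i\<in>UNIV. LBINT x. (1 + \<delta>) / (\<delta> * \<mu>) * (F i x * ?K' i x z)) = 0"
        unfolding pderiv_at_dilated_bump(1) by (simp only: mult.left_commute)
      then have "(1 + \<delta>) / (\<delta> * \<mu>) * (\<Sum>i\<in>UNIV. LBINT x. F i x * ?K' i x z) = 0"
        by (simp only: integral_mult_right_zero sum_distrib_left)
      then show ?thesis using \<mu>(1) \<delta> by simp
    qed
    have int: "integrable lborel (\<lambda>z. ?u z * (LBINT x. F i x * ?K' i x z))" for i
    proof -
      have "integrable lborel (\<lambda>z. LBINT x. F i x * (?K' i x z * ?u z))"
        using lborel_pair.integrable_snd[OF Q_pair[of i]] .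
      also have "(\<lambda>z. LBINT x. F i x * (?K' i x z * ?u z))
        = (\<lambda>z. LBINT x. ?u z * (F i x * ?K' i x z))"
        by (simp only: mult_ac)
      finally show ?thesis by simp
    qed
    have "(\<Sum>i\<in>UNIV. LBINT x. F i x * Q i x)
       = (LBINT z. (\<Sum>i\<in>UNIV. ?u z * (LBINT x. F i x * ?K' i x z)))"
      unfolding Q(2) by (rule Bochner_Integration.integral_sum[symmetric]) (rule int)
    also have "\<dots> = integral\<^sup>L lborel (\<lambda>z :: real ^ 'n. 0 :: real)"
      unfolding sum_distrib_left[symmetric]
      by (rule Bochner_Integration.integral_cong[OF refl]) (use z in \<open>auto simp: indicator_def\<close>)
    finally show ?thesis by simp
  qed
  have split: "I i x - 1 / (\<delta> * \<mu>) * Q i x = D i x" for i x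
  proof -
    have sK: "smooth (?K x)" by (rule smooth_dilated_bump)
    have pd: "pderiv_at i (\<lambda>z. ?K x z * \<psi> z) z = ?K x z * pderiv_at i \<psi> z + (- 1 / (\<delta> * \<mu>) * ?K' i x z) * \<psi> z" for z
      unfolding pderiv_at_mult[OF sK \<psi>] pderiv_at_dilated_bump(2) ..
    have K'c: "continuous_on UNIV (?K' i x)"
      by (rule continuous_on_compose2[OF smooth_continuous[OF smooth_bump_prod(2)]])
         (auto simp: dilated_bump_def intro!: continuous_intros)
    have "(LBINT z. indicator ?S z * pderiv_at i (\<lambda>z. ?K x z * \<psi> z) z) = D i x"
      unfolding D_def
    proof (rule divergence_box)
      show "(\<lambda>z. ?K x z * \<psi> z) differentiable at y" for y
        by (intro differentiable_mult smooth_differentiable sK \<psi>)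
      show "continuous_on UNIV (pderiv_at i (\<lambda>z. ?K x z * \<psi> z))"
        unfolding pd[abs_def] by (intro continuous_intros smooth_continuous[OF sK] \<psi>'c K'c \<psi>c)
    qed (rule box_nonempty)
    also have "(LBINT z. indicator ?S z * pderiv_at i (\<lambda>z. ?K x z * \<psi> z) z)
       = (LBINT z. ?K x z * (indicator ?S z * pderiv_at i \<psi> z) + (- 1 / (\<delta> * \<mu>)) * (?K' i x z * ?u z))"
      unfolding pd by (simp only: distrib_left mult_ac)
    also have "\<dots> = I i x - 1 / (\<delta> * \<mu>) * Q i x"
    proof (subst Bochner_Integration.integral_add)
      have b: "integrable lborel (\<lambda>z. indicator ?S z * h z)" if "continuous_on UNIV h" for h :: "real ^ 'n \<Rightarrow> real"
        by (rule integrable_L2_support[OF L2_box_continuous[OF that], of ?S]) auto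
      show "integrable lborel (\<lambda>z. ?K x z * (indicator ?S z * pderiv_at i \<psi> z))"
        using b[of "\<lambda>z. ?K x z * pderiv_at i \<psi> z"] smooth_continuous[OF sK] \<psi>'c
        by (simp add: mult.left_commute continuous_on_mult)
      show "integrable lborel (\<lambda>z. (- 1 / (\<delta> * \<mu>)) * (?K' i x z * ?u z))"
        using b[of "\<lambda>z. ?K' i x z * \<psi> z"] K'c \<psi>c
        by (intro integrable_mult_right) (simp add: mult.left_commute continuous_on_mult)
    qed (simp add: I_def Q_def)
    finally show ?thesis .
  qed
  have D_bound: "\<bar>D i x\<bar> \<le> (\<Sum>c\<in>{a $ i, b $ i}. L2_norm (face_measure a b i c) (\<lambda>_. 1) * L2_norm (face_measure a b i c) \<psi>)"
    (is "_ \<le> ?E i") for i x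
  proof -
    have 1: "\<bar>\<integral>z. ?K x z * \<psi> z \<partial>face_measure a b i c\<bar> \<le> L2_norm (face_measure a b i c) (\<lambda>_. 1) * L2_norm (face_measure a b i c) \<psi>"
      if c: "a $ i \<le> c" "c \<le> b $ i" for c
    proof -
      have K: "L2 (face_measure a b i c) (?K x)" and o: "L2 (face_measure a b i c) (\<lambda>_. 1)"
        by (intro L2_face_measure_continuous c smooth_continuous smooth_dilated_bump continuous_on_const)+
      have "\<bar>\<integral>z. ?K x z * \<psi> z \<partial>face_measure a b i c\<bar> \<le> L2_norm (face_measure a b i c) (?K x) * L2_norm (face_measure a b i c) \<psi>"
        by (intro L2_inner_bound K L2_face_measure_continuous c \<psi>c)
      \<comment> \<open>The kernel takes values between 0 and 1, which makes the bound independent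
        of \<open>x\<close>.\<close>
      also have "L2_norm (face_measure a b i c) (?K x) \<le> L2_norm (face_measure a b i c) (\<lambda>_. 1)"
        unfolding L2_norm_def
        using K o by (intro real_sqrt_le_mono integral_mono)
          (auto simp: L2_def bump_prod_nonneg bump_prod_le_1 power_le_one)
      finally show ?thesis by (simp add: mult_right_mono L2_norm_nonneg)
    qed
    show ?thesis
      using 1[of "a $ i"] 1[of "b $ i"] box_nonempty[of i] unfolding D_def by simp
  qed
  have FD: "integrable lborel (\<lambda>x. F i x * D i x)"
    "(LBINT x. F i x * D i x) = (LBINT x. F i x * I i x) - 1 / (\<delta> * \<mu>) * (LBINT x. F i x * Q i x)" for i
  proof -
    have eq: "F i x * D i x = F i x * I i x - 1 / (\<delta> * \<mu>) * (F i x * Q i x)" for x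
      unfolding split[symmetric] by (simp add: right_diff_distrib)
    show "integrable lborel (\<lambda>x. F i x * D i x)"
      unfolding eq by (intro Bochner_Integration.integrable_diff integrable_mult_right I Q)
    show "(LBINT x. F i x * D i x) = (LBINT x. F i x * I i x) - 1 / (\<delta> * \<mu>) * (LBINT x. F i x * Q i x)"
      unfolding eq by (subst Bochner_Integration.integral_diff) (auto intro!: integrable_mult_right I Q)
  qed
  have "(\<Sum>i\<in>UNIV. LBINT x. F i x * D i x) = ?s * (\<Sum>i\<in>UNIV. mollified_pairing ?c \<mu> \<delta> (F i) (\<lambda>x. indicator ?S x * pderiv_at i \<psi> x))"
    unfolding FD(2) sum_subtractf sum_distrib_left[symmetric] sum_Q I(2) by simp
  then have "?s * \<bar>\<Sum>i\<in>UNIV. mollified_pairing ?c \<mu> \<delta> (F i) (\<lambda>x. indicator ?S x * pderiv_at i \<psi> x)\<bar>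
     = \<bar>\<Sum>i\<in>UNIV. LBINT x. F i x * D i x\<bar>"
    using s by (simp add: abs_mult)
  also have "\<dots> \<le> (\<Sum>i\<in>UNIV. \<bar>LBINT x. F i x * D i x\<bar>)" by (rule sum_abs)
  also have "\<dots> \<le> (\<Sum>i\<in>UNIV. (LBINT x. \<bar>F i x\<bar>) * ?E i)"
  proof (rule sum_mono)
    fix i
    have "\<bar>LBINT x. F i x * D i x\<bar> \<le> (LBINT x. \<bar>F i x * D i x\<bar>)"
      using integral_norm_bound[of lborel "\<lambda>x. F i x * D i x"] by simp
    also have "\<dots> \<le> (LBINT x. \<bar>F i x\<bar> * ?E i)"
    proof (rule integral_mono)
      show "integrable lborel (\<lambda>x. \<bar>F i x * D i x\<bar>)" using FD(1) by (rule integrable_abs)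
      show "integrable lborel (\<lambda>x. \<bar>F i x\<bar> * ?E i)" using flux_integrable by (intro integrable_mult_left integrable_abs)
      show "\<bar>F i x * D i x\<bar> \<le> \<bar>F i x\<bar> * ?E i" for x
        unfolding abs_mult by (intro mult_left_mono D_bound) simp
    qed
    finally show "\<bar>LBINT x. F i x * D i x\<bar> \<le> (LBINT x. \<bar>F i x\<bar>) * ?E i" by simp
  qed
  finally show ?thesis using s by (simp add: field_simps)
qed

text \<open>Two limits in a fixed order. The face bound contains a negative power of
  \<open>\<delta>\<close>, so first the approximants converge with \<open>\<delta>\<close> fixed,
  which removes the face terms, and only then does \<open>\<delta>\<close> tend to 0.\<close>

lemma pairing_flux_gradient_eq_0:
  fixes W :: "'n \<Rightarrow> real ^ 'n \<Rightarrow> real"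
  assumes W: "\<And>i. L2 lborel (W i)" and \<psi>: "\<And>k. smooth (\<psi> k)"
    and \<psi>W: "\<And>i. (\<lambda>k. L2_norm lborel (\<lambda>x. indicator (box a b) x * pderiv_at i (\<psi> k) x - W i x)) \<longlonglongrightarrow> 0"
    and face: "\<And>i c. c \<in> {a $ i, b $ i} \<Longrightarrow> (\<lambda>k::nat. L2_norm (face_measure a b i c) (\<psi> k)) \<longlonglongrightarrow> 0"
  shows "(\<Sum>i\<in>UNIV. LBINT x. F i x * W i x) = 0"
proof -
  let ?V = "\<lambda>k i x. indicator (box a b) x * pderiv_at i (\<psi> k) x"
  let ?P = "\<lambda>\<delta> i. mollified_pairing ctr \<mu> \<delta> (F i)"
  have V: "L2 lborel (?V k i)" for k i
    by (intro L2_box_continuous smooth_continuous smooth_pderiv \<psi>)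
  have zero: "(\<Sum>i\<in>UNIV. ?P \<delta> i (W i)) = 0" if \<delta>: "0 < \<delta>" for \<delta>
  proof -
    have "(\<lambda>k. ?P \<delta> i (?V k i)) \<longlonglongrightarrow> ?P \<delta> i (W i)" for i
    proof (rule LIM_zero_cancel, rule Lim_null_comparison)
      show "\<forall>\<^sub>F k in sequentially. norm (?P \<delta> i (?V k i) - ?P \<delta> i (W i))
          \<le> bump_mass TYPE('n) * (L2_norm lborel (F i) * L2_norm lborel (\<lambda>x. ?V k i x - W i x))"
        unfolding mollified_pairing_diff[OF F V W \<delta>] real_norm_def
        by (intro always_eventually allI mollified_pairing_L2 F L2_diff V W \<delta>)
      show "(\<lambda>k. bump_mass TYPE('n) * (L2_norm lborel (F i) * L2_norm lborel (\<lambda>x. ?V k i x - W i x))) \<longlonglongrightarrow> 0"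
        by (intro tendsto_mult_right_zero \<psi>W)
    qed
    then have lim: "(\<lambda>k. \<Sum>i\<in>UNIV. ?P \<delta> i (?V k i)) \<longlonglongrightarrow> (\<Sum>i\<in>UNIV. ?P \<delta> i (W i))"
      by (intro tendsto_sum)
    have "(\<lambda>k. \<Sum>i\<in>UNIV. ?P \<delta> i (?V k i)) \<longlonglongrightarrow> 0"
    proof (rule Lim_null_comparison)
      let ?E = "\<lambda>k. 1 / (\<delta> * \<mu>) ^ CARD('n) * (\<Sum>i\<in>UNIV. (LBINT x. \<bar>F i x\<bar>) *
         (\<Sum>c\<in>{a $ i, b $ i}. L2_norm (face_measure a b i c) (\<lambda>_. 1) * L2_norm (face_measure a b i c) (\<psi> k)))"
      show "\<forall>\<^sub>F k in sequentially. norm (\<Sum>i\<in>UNIV. ?P \<delta> i (?V k i)) \<le> ?E k"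
        unfolding real_norm_def by (intro always_eventually allI mollified_pairing_boundary \<delta> \<psi>)
      show "?E \<longlonglongrightarrow> 0"
        by (intro tendsto_mult_right_zero tendsto_null_sum face)
    qed
    then show ?thesis using LIMSEQ_unique lim by blast
  qed
  define \<delta> where "\<delta> k = 1 / real (Suc k)" for k
  have \<delta>: "0 < \<delta> k" for k by (simp add: \<delta>_def)
  have \<delta>0: "\<delta> \<longlonglongrightarrow> 0" unfolding \<delta>_def[abs_def] by (rule LIMSEQ_Suc) (rule lim_1_over_n)
  \<comment> \<open>\<open>W i\<close> is merely square integrable, so the limit is taken for the
    continuous derivatives of the \<open>\<psi> k\<close>, cut off at the box, and carried over by
    density.\<close>
  have "(\<lambda>k. ?P (\<delta> k) i (W i)) \<longlonglongrightarrow> bump_mass TYPE('n) * (LBINT x. F i x * W i x)" for i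
    by (rule mollified_pairing_tendsto[OF F W V \<psi>W \<delta>])
       (intro mollified_pairing_tendsto_continuous flux_integrable F0 smooth_continuous smooth_pderiv \<psi> \<delta>0)
  then have "(\<lambda>k. \<Sum>i\<in>UNIV. ?P (\<delta> k) i (W i)) \<longlonglongrightarrow> (\<Sum>i\<in>UNIV. bump_mass TYPE('n) * (LBINT x. F i x * W i x))"
    by (intro tendsto_sum)
  then have "(\<Sum>i\<in>UNIV. bump_mass TYPE('n) * (LBINT x. F i x * W i x)) = 0"
    unfolding zero[OF \<delta>] by (simp add: LIMSEQ_const_iff)
  then show ?thesis
    using bump_mass_pos[where 'n = 'n] by (simp flip: sum_distrib_left)
qed

end

section \<open>The fundamental lemma of the calculus of variations\<close>

text \<open>\<open>ennreal\<close> sends negative numbers to 0, so \<open>?M 1\<close> and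
  \<open>?M (-1)\<close> have the positive and the negative part of \<open>W\<close> as densities.
  They agree on boxes, which are stable under intersection and generate the Borel sets, hence they
  are equal.\<close>

lemma AE_0_if_box_integrals_0:
  fixes W :: "'a::euclidean_space \<Rightarrow> real"
  assumes W: "integrable lborel W" and 0: "\<And>l u. (LBINT x. indicator (box l u) x * W x) = 0"
  shows "AE x in lborel. W x = 0"
proof -
  have Wm[measurable]: "W \<in> borel_measurable borel" using W by auto
  let ?M = "\<lambda>s. density lborel (\<lambda>x. ennreal (s * W x))"
  have int: "integrable lborel (\<lambda>x. indicator (box l u) x * W x)" for l u
    using integrable_real_mult_indicator[of "box l u" lborel W] W by (simp add: mult.commute)
  have em: "emeasure (?M s) (box l u) = (\<integral>\<^sup>+x. ennreal (s * (indicator (box l u) x * W x)) \<partial>lborel)" for s l u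
    by (subst emeasure_density) (auto intro!: nn_integral_cong simp: indicator_def)
  have fin: "emeasure (?M s) (box l u) < \<infinity>" for s l u
  proof -
    have "integrable lborel (\<lambda>x. s * (indicator (box l u) x * W x))" using int by (rule integrable_mult_right)
    then have "(\<integral>\<^sup>+x. ennreal (norm (s * (indicator (box l u) x * W x))) \<partial>lborel) < \<infinity>"
      by (simp only: integrable_iff_bounded)
    then show ?thesis unfolding em
      by (rule order_le_less_trans[rotated]) (auto intro!: nn_integral_mono ennreal_leI)
  qed
  have eq: "emeasure (?M 1) (box l u) = emeasure (?M (-1)) (box l u)" for l u
  proof -
    have "enn2real (emeasure (?M 1) (box l u)) - enn2real (emeasure (?M (-1)) (box l u)) = 0"
      using real_lebesgue_integral_def[OF int, of l u] 0[of l u] unfolding em by simp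
    then show ?thesis
      using fin[of 1 l u] fin[of "-1" l u] by (metis eq_iff_diff_eq_0 ennreal_enn2real infinity_ennreal_def)
  qed
  have "?M 1 = ?M (-1)"
  proof (rule measure_eqI_generator_eq[where E = "range (\<lambda>(l, u). box l u :: 'a set)" and \<Omega> = UNIV
        and A = "\<lambda>n::nat. box (- (real n *\<^sub>R One)) (real n *\<^sub>R One)"])
    show "Int_stable (range (\<lambda>(l, u). box l u :: 'a set))"
      by (auto simp: Int_stable_def box_Int_box)
    show "sets (?M 1) = sigma_sets UNIV (range (\<lambda>(l, u). box l u :: 'a set))"
      "sets (?M (-1)) = sigma_sets UNIV (range (\<lambda>(l, u). box l u :: 'a set))"
      by (simp_all add: borel_eq_box)
    show "(\<Union>n::nat. box (- (real n *\<^sub>R One)) (real n *\<^sub>R One)) = (UNIV :: 'a set)"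
      using UN_box_eq_UNIV .
    show "emeasure (?M 1) X = emeasure (?M (-1)) X" if "X \<in> range (\<lambda>(l, u). box l u :: 'a set)" for X
      using that eq by auto
    show "emeasure (?M 1) (box (- (real n *\<^sub>R One)) (real n *\<^sub>R One)) \<noteq> \<infinity>" for n
      using fin[of 1] by (metis less_irrefl)
  qed auto
  then have "AE x in lborel. ennreal (1 * W x) = ennreal (- 1 * W x)"
    by (subst (asm) sigma_finite_measure.density_unique_iff[OF sigma_finite_lborel]) auto
  then show ?thesis
  proof eventually_elim
    case (elim x)
    then show ?case by (cases "0 \<le> W x") (auto simp: ennreal_neg ennreal_eq_0_iff)
  qed
qed

lemma exp_bump_tendsto_1: "(exp_bump \<longlongrightarrow> 1) at_top"
proof -
  have "((\<lambda>t::real. exp (- inverse t)) \<longlongrightarrow> exp (- 0)) at_top"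
    by (intro tendsto_intros tendsto_inverse_0_at_top filterlim_ident)
  then have "((\<lambda>t::real. exp (- inverse t)) \<longlongrightarrow> 1) at_top" by simp
  then show ?thesis
    by (rule Lim_transform_eventually)
       (auto intro!: eventually_mono[OF eventually_gt_at_top[of 0]] simp: exp_bump_eq divide_inverse)
qed

text \<open>The shift by 1 keeps the support at distance \<open>1 / real (Suc m)\<close> inside the
  interval, and the growing slope drives both factors to 1 at every interior point.\<close>

definition plateau :: "nat \<Rightarrow> real \<Rightarrow> real \<Rightarrow> real \<Rightarrow> real" where
  "plateau m l u t = exp_bump (real (Suc m) * (t - l) - 1) * exp_bump (real (Suc m) * (u - t) - 1)"

lemma smooth_real_plateau: "smooth_real (plateau m l u)"
proof -
  have "plateau m l u = (\<lambda>t. exp_bump (real (Suc m) * t + (- real (Suc m) * l - 1)) *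
      exp_bump (- real (Suc m) * t + (real (Suc m) * u - 1)))"
    by (auto simp: plateau_def fun_eq_iff algebra_simps)
  then show ?thesis
    by (simp only:) (intro smooth_real_mult smooth_real_affine smooth_real_exp_bump_poly)
qed

lemma plateau_bounds: "0 \<le> plateau m l u t" "plateau m l u t \<le> 1"
  by (auto simp: plateau_def exp_bump_eq intro!: mult_le_one)

lemma plateau_eq_0:
  assumes "t \<notin> {l + 1 / real (Suc m)..u - 1 / real (Suc m)}"
  shows "plateau m l u t = 0"
proof -
  have "t < l + 1 / real (Suc m) \<or> u - 1 / real (Suc m) < t" using assms by auto
  then have "real (Suc m) * (t - l) - 1 \<le> 0 \<or> real (Suc m) * (u - t) - 1 \<le> 0"
    by (auto simp: field_simps)
  then show ?thesis by (auto simp: plateau_def exp_bump_eq)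
qed

lemma plateau_tendsto: "(\<lambda>m. plateau m l u t) \<longlonglongrightarrow> indicator {l<..<u} t"
proof (cases "t \<in> {l<..<u}")
  case True
  have lim: "(\<lambda>m. exp_bump (real (Suc m) * c - 1)) \<longlonglongrightarrow> 1" if "0 < c" for c
  proof (rule filterlim_compose[OF exp_bump_tendsto_1])
    have "filterlim (\<lambda>m. real (Suc m) * c) at_top sequentially"
      using that by (intro filterlim_at_top_mult_tendsto_pos[OF tendsto_const] filterlim_compose[OF filterlim_real_sequentially filterlim_Suc])
    then have "filterlim (\<lambda>m. - 1 + real (Suc m) * c) at_top sequentially"
      by (rule filterlim_tendsto_add_at_top[OF tendsto_const])
    then show "filterlim (\<lambda>m. real (Suc m) * c - 1) at_top sequentially" by (simp add: add.commute)
  qed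
  have "(\<lambda>m. plateau m l u t) \<longlonglongrightarrow> 1 * 1"
    unfolding plateau_def by (intro tendsto_mult lim) (use True in auto)
  then show ?thesis using True by simp
next
  case False
  have "plateau m l u t = 0" for m
  proof (rule plateau_eq_0, rule notI)
    assume "t \<in> {l + 1 / real (Suc m)..u - 1 / real (Suc m)}"
    then have "l + 1 / real (Suc m) \<le> t" "t \<le> u - 1 / real (Suc m)" by (simp_all del: of_nat_Suc)
    moreover have "0 < 1 / real (Suc m)" by simp
    ultimately have "l < t" "t < u" by linarith+
    then show False using False by simp
  qed
  then show ?thesis using False by simp
qed

text \<open>Products of plateaus are test functions that converge boundedly to indicators of boxes,
  so \<open>W\<close> integrates to 0 over every box.\<close>

lemma fundamental_lemma_box:
  fixes W :: "real ^ 'n::finite \<Rightarrow> real"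
  assumes W: "integrable lborel W" and W0: "\<And>x. x \<notin> box a b \<Longrightarrow> W x = 0"
    and orth: "\<And>\<phi>. test_function (box a b) \<phi> \<Longrightarrow> (LBINT x. W x * \<phi> x) = 0"
  shows "AE x in lborel. W x = 0"
proof (rule AE_0_if_box_integrals_0[OF W])
  fix l0 u0 :: "real ^ 'n"
  \<comment> \<open>Since \<open>W\<close> vanishes outside \<open>box a b\<close>, an arbitrary box
    may be clipped to it.\<close>
  define l u where "l = (\<chi> j. max (l0 $ j) (a $ j))" and "u = (\<chi> j. min (u0 $ j) (b $ j))"
  have lu: "box l u = box l0 u0 \<inter> box a b"
    by (auto simp: l_def u_def mem_box_cart)
  define \<phi> where "\<phi> m = coord_prod (\<lambda>j. plateau m (l $ j) (u $ j))" for m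
  have [measurable]: "W \<in> borel_measurable borel" using W by auto
  have [measurable]: "\<phi> m \<in> borel_measurable borel" for m
    unfolding \<phi>_def by (intro smooth_borel smooth_coord_prod smooth_real_plateau)
  have t: "test_function (box a b) (\<phi> m)" for m
    unfolding \<phi>_def
  proof (rule test_function_coord_prod[where l = "\<chi> j. l $ j + 1 / real (Suc m)" and u = "\<chi> j. u $ j - 1 / real (Suc m)"])
    show "cbox (\<chi> j. l $ j + 1 / real (Suc m)) (\<chi> j. u $ j - 1 / real (Suc m)) \<subseteq> box a b"
    proof
      fix x assume x: "x \<in> cbox (\<chi> j. l $ j + 1 / real (Suc m)) (\<chi> j. u $ j - 1 / real (Suc m))"
      have "l $ j < x $ j \<and> x $ j < u $ j" for j
      proof -
        have "l $ j + 1 / real (Suc m) \<le> x $ j" "x $ j \<le> u $ j - 1 / real (Suc m)"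
          using x by (auto simp: mem_box_cart simp del: of_nat_Suc)
        moreover have "0 < 1 / real (Suc m)" by simp
        ultimately show ?thesis by linarith
      qed
      then have "x \<in> box l u" by (simp add: mem_box_cart)
      then show "x \<in> box a b" using lu by auto
    qed
  qed (use smooth_real_plateau plateau_eq_0 in \<open>auto simp del: of_nat_Suc\<close>)
  have lim: "(\<lambda>m. \<phi> m x) \<longlonglongrightarrow> indicator (box l u) x" for x
  proof -
    have "(\<lambda>m. \<phi> m x) \<longlonglongrightarrow> (\<Prod>j\<in>UNIV. indicator {l $ j<..<u $ j} (x $ j))"
      unfolding \<phi>_def coord_prod_def by (intro tendsto_prod plateau_tendsto)
    also have "(\<Prod>j\<in>UNIV. indicator {l $ j<..<u $ j} (x $ j)) = (indicator (box l u) x :: real)"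
      by (auto simp: indicator_def mem_box_cart prod_eq_1_iff intro!: prod.neutral)
    finally show ?thesis .
  qed
  have bd: "\<bar>\<phi> m x\<bar> \<le> 1" for m x
    unfolding \<phi>_def coord_prod_def
    by (auto simp: abs_prod intro!: prod_le_1 plateau_bounds abs_of_nonneg simp: plateau_bounds)
  have "(\<lambda>m. LBINT x. W x * \<phi> m x) \<longlonglongrightarrow> (LBINT x. W x * indicator (box l u) x)"
  proof (rule integral_dominated_convergence[where w = "\<lambda>x. \<bar>W x\<bar>"])
    show "AE x in lborel. (\<lambda>m. W x * \<phi> m x) \<longlonglongrightarrow> W x * indicator (box l u) x"
      by (intro AE_I2 tendsto_mult_left lim)
    show "AE x in lborel. norm (W x * \<phi> m x) \<le> \<bar>W x\<bar>" for m
      using mult_left_mono[OF bd[of m], of "\<bar>W _\<bar>"] by (intro AE_I2) (simp add: abs_mult)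
  qed (use W in auto)
  then have "(LBINT x. W x * indicator (box l u) x) = 0"
    unfolding orth[OF t] by (simp add: LIMSEQ_const_iff)
  also have "(\<lambda>x. W x * indicator (box l u) x) = (\<lambda>x. indicator (box l0 u0) x * W x)"
    using W0 by (auto simp: lu indicator_def fun_eq_iff)
  finally show "(LBINT x. indicator (box l0 u0) x * W x) = 0" .
qed

section \<open>A Poincare inequality with boundary term\<close>

text \<open>Integrate the derivative of \<open>\<psi>\<close> squared times
  \<open>x $ i - b $ i\<close>. This factor vanishes on the upper face, is minus the width on the
  lower one, and has derivative 1, which produces the norm to be estimated. The mixed term is
  absorbed.\<close>

lemma poincare_box:
  fixes a b :: "real ^ 'n::finite"
  assumes ab: "\<And>i. a $ i < b $ i" and \<psi>: "smooth \<psi>"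
  shows "(L2_norm lborel (\<lambda>x. indicator (box a b) x * \<psi> x))\<^sup>2 \<le>
     2 * (b $ i - a $ i) * (L2_norm (face_measure a b i (a $ i)) \<psi>)\<^sup>2 +
     4 * (b $ i - a $ i)\<^sup>2 * (L2_norm lborel (\<lambda>x. indicator (box a b) x * pderiv_at i \<psi> x))\<^sup>2"
proof -
  let ?l = "b $ i - a $ i" and ?h = "\<lambda>x :: real ^ 'n. x $ i - b $ i" and ?S = "box a b"
  let ?\<Psi> = "\<lambda>x. \<psi> x * (\<psi> x * ?h x)" and ?D = "pderiv_at i \<psi>"
  have l: "0 < ?l" using ab[of i] by simp
  have \<psi>c: "continuous_on UNIV \<psi>" and Dc: "continuous_on UNIV ?D"
    using \<psi> by (auto intro: smooth_continuous smooth_pderiv)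
  have hd: "(?h has_derivative (\<lambda>h. h $ i)) (at x)" for x
    by (auto intro!: derivative_eq_intros bounded_linear_imp_has_derivative bounded_linear_vec_nth)
  note d\<psi> = smooth_has_derivative[OF \<psi>]
  note dd = has_derivative_mult[OF d\<psi> has_derivative_mult[OF d\<psi> hd]]
  have pd: "pderiv_at i ?\<Psi> x = \<psi> x * \<psi> x + 2 * (\<psi> x * (?D x * ?h x))" for x
    using pderiv_at_eq[OF dd, of i] by (simp add: pderiv_at_def axis_def algebra_simps)
  have fa: "L2 (face_measure a b i (a $ i)) \<psi>"
    by (intro L2_face_measure_continuous \<psi>c) (use l in auto)
  have "(LBINT x. indicator ?S x * pderiv_at i ?\<Psi> x)
     = (\<integral>x. ?\<Psi> x \<partial>face_measure a b i (b $ i)) - (\<integral>x. ?\<Psi> x \<partial>face_measure a b i (a $ i))"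
  proof (rule divergence_box[OF ab])
    show "?\<Psi> differentiable at x" for x using dd by (rule differentiableI)
    show "continuous_on UNIV (pderiv_at i ?\<Psi>)"
      unfolding pd[abs_def] by (intro continuous_intros \<psi>c Dc)
  qed
  also have "(\<integral>x. ?\<Psi> x \<partial>face_measure a b i (b $ i)) = (\<integral>x. 0 \<partial>face_measure a b i (b $ i))"
    by (rule Bochner_Integration.integral_cong[OF refl]) (simp add: space_face_measure)
  also have "(\<integral>x. ?\<Psi> x \<partial>face_measure a b i (a $ i)) = (\<integral>x. - ?l * (\<psi> x)\<^sup>2 \<partial>face_measure a b i (a $ i))"
    by (rule Bochner_Integration.integral_cong[OF refl]) (simp add: space_face_measure power2_eq_square algebra_simps)
  also have "\<dots> = - ?l * (L2_norm (face_measure a b i (a $ i)) \<psi>)\<^sup>2"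
    unfolding L2_norm_sq by (rule integral_mult_right_zero)
  finally have 1: "(LBINT x. indicator ?S x * pderiv_at i ?\<Psi> x) = ?l * (L2_norm (face_measure a b i (a $ i)) \<psi>)\<^sup>2"
    by (simp add: algebra_simps)
  let ?u = "\<lambda>x. indicator ?S x * \<psi> x" and ?v = "\<lambda>x. indicator ?S x * (?D x * ?h x)"
  have u: "L2 lborel ?u" and v: "L2 lborel ?v" and D: "L2 lborel (\<lambda>x. indicator ?S x * ?D x)"
    by (intro L2_box_continuous continuous_intros \<psi>c Dc)+
  have eq: "indicator ?S x * pderiv_at i ?\<Psi> x = (?u x)\<^sup>2 + 2 * (?u x * ?v x)" for x
    unfolding pd by (auto simp: indicator_def power2_eq_square)
  have "(LBINT x. indicator ?S x * pderiv_at i ?\<Psi> x) = (L2_norm lborel ?u)\<^sup>2 + 2 * (LBINT x. ?u x * ?v x)"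
    unfolding eq L2_norm_sq using u L2_prod_integrable[OF u v] by (subst Bochner_Integration.integral_add) (auto simp: L2_def)
  moreover have "\<bar>LBINT x. ?u x * ?v x\<bar> \<le> L2_norm lborel ?u * (?l * L2_norm lborel (\<lambda>x. indicator ?S x * ?D x))"
  proof (rule order_trans[OF L2_inner_bound[OF u v] mult_left_mono])
    have "L2_norm lborel ?v \<le> L2_norm lborel (\<lambda>x. ?l * (indicator ?S x * ?D x))"
      unfolding L2_norm_def
    proof (intro real_sqrt_le_mono integral_mono)
      show "integrable lborel (\<lambda>x. (?v x)\<^sup>2)" using v by (simp add: L2_def)
      show "integrable lborel (\<lambda>x. (?l * (indicator ?S x * ?D x))\<^sup>2)" using L2_cmult[OF D] by (simp only: L2_def)
      fix x
      show "(?v x)\<^sup>2 \<le> (?l * (indicator ?S x * ?D x))\<^sup>2"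
      proof (cases "x \<in> ?S")
        case True
        then have "a $ i < x $ i" "x $ i < b $ i" by (auto simp: mem_box_cart)
        then have "\<bar>?h x\<bar> \<le> \<bar>?l\<bar>" by auto
        then have "(?h x)\<^sup>2 \<le> ?l\<^sup>2" by (rule abs_le_square_iff[THEN iffD1])
        then show ?thesis using True by (simp add: power_mult_distrib mult.commute mult_left_mono)
      qed simp
    qed
    also have "\<dots> = ?l * L2_norm lborel (\<lambda>x. indicator ?S x * ?D x)"
      using l unfolding L2_norm_def power_mult_distrib[of ?l] integral_mult_right_zero by (simp add: real_sqrt_mult)
    finally show "L2_norm lborel ?v \<le> ?l * L2_norm lborel (\<lambda>x. indicator ?S x * ?D x)" .
  qed (rule L2_norm_nonneg)
  \<comment> \<open>The absorption: 2 T B is at most T^2/2 + 2 B^2. This is where the constants 2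
    and 4 come from.\<close>
  moreover have quad: "T\<^sup>2 \<le> 2 * A + 4 * B\<^sup>2" if "A = T\<^sup>2 + 2 * I" "\<bar>I\<bar> \<le> T * B" for T A B I :: real
  proof -
    have "0 \<le> (T - 2 * B)\<^sup>2" by simp
    then have "4 * (T * B) \<le> T\<^sup>2 + 4 * B\<^sup>2" by (simp add: power2_eq_square algebra_simps)
    then show ?thesis using that by linarith
  qed
  ultimately show ?thesis
    unfolding 1 by (metis (no_types, lifting) quad power_mult_distrib mult.assoc)
qed

section \<open>Uniqueness\<close>

lemma RL_deriv_works:
  assumes "\<exists>w. has_RL_deriv a b s i v w"
  shows "has_RL_deriv a b s i v (RL_deriv a b s i v)"
  using someI_ex[OF assms] by (simp add: RL_deriv_def)

lemma RL_deriv_L2: "u \<in> H_space a b s \<Longrightarrow> L2 (lebesgue_on (box a b)) (RL_deriv a b s i u)"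
  using RL_deriv_works[of a b s i u] by (auto simp: H_space_def has_RL_deriv_def)

text \<open>The norm uses an arbitrarily chosen derivative, so it is not enough that 0 is one.
  Whatever is chosen is orthogonal to all test functions, hence vanishes almost everywhere by the
  fundamental lemma.\<close>

lemma H_norm_eq_0_if_AE_0:
  fixes a b :: "real ^ 'n::finite"
  assumes \<alpha>: "0 < \<alpha>" "\<alpha> < 1" and v: "borel_rep (box a b) v (\<lambda>_. 0)"
  shows "v \<in> H_space a b (1 - \<alpha>)" "H_norm a b (1 - \<alpha>) v = 0"
proof -
  let ?S = "box a b"
  have S: "?S \<in> sets borel" by simp
  have zero: "L2 lborel (\<lambda>x :: real ^ 'n. 0)" by (simp add: L2_def)
  have Jrep: "borel_rep ?S (J_left a \<alpha> i v) (\<lambda>_. 0)" for i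
    using J_left_AE[where i = i and \<alpha> = \<alpha>, OF v order_refl]
    by (auto simp: borel_rep_def frac_avg_def elim!: eventually_mono)
  have J: "distributional_deriv i (regular_distribution ?S (J_left a \<alpha> i v)) \<phi> = 0" if "test_function ?S \<phi>" for i \<phi>
  proof -
    have "borel_rep ?S (pderiv_at i \<phi>) (\<lambda>x. indicator ?S x * pderiv_at i \<phi> x)"
      using that by (intro borel_rep_indicator S smooth_borel smooth_pderiv test_function_smooth)
    from borel_rep_integral(3)[OF S borel_rep_mult[OF Jrep this]]
    show ?thesis by (simp add: distributional_deriv_def regular_distribution_def)
  qed
  have has0: "has_RL_deriv a b (1 - \<alpha>) i v (\<lambda>_. 0)" for i
  proof -
    have "L2 (lebesgue_on ?S) (\<lambda>_. 0)" by (simp add: L2_def)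
    then show ?thesis
      using \<alpha> J by (simp add: has_RL_deriv_def has_weak_pderiv_def) (simp add: regular_distribution_def)
  qed
  show "v \<in> H_space a b (1 - \<alpha>)"
    using borel_rep_L2(1)[OF S v] zero has0 by (auto simp: H_space_def)
  have "L2_norm (lebesgue_on ?S) (RL_deriv a b (1 - \<alpha>) i v) = 0" for i
  proof -
    let ?w = "RL_deriv a b (1 - \<alpha>) i v"
    have h: "has_RL_deriv a b (1 - \<alpha>) i v ?w" using RL_deriv_works has0 by blast
    then have wL2: "L2 (lebesgue_on ?S) ?w" by (simp add: has_RL_deriv_def)
    then obtain R where R: "borel_rep ?S ?w R" using borel_rep_ex[OF S] by (auto simp: L2_def)
    have RL2: "L2 lborel R" using borel_rep_L2(1)[OF S R] wL2 by simp
    have R0: "x \<notin> ?S \<Longrightarrow> R x = 0" for x using R by (simp add: borel_rep_def)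
    have "(LBINT x. R x * \<phi> x) = 0" if t: "test_function ?S \<phi>" for \<phi>
    proof -
      have "regular_distribution ?S ?w \<phi> = 0"
        using h \<alpha> J[OF t, of i] t by (simp add: has_RL_deriv_def has_weak_pderiv_def)
      moreover have "borel_rep ?S \<phi> (\<lambda>x. indicator ?S x * \<phi> x)"
        using t by (intro borel_rep_indicator S smooth_borel test_function_smooth)
      from borel_rep_integral(3)[OF S borel_rep_mult[OF R this]]
      have "regular_distribution ?S ?w \<phi> = (LBINT x. R x * (indicator ?S x * \<phi> x))"
        by (simp add: regular_distribution_def)
      moreover have "R x * (indicator ?S x * \<phi> x) = R x * \<phi> x" for x using R0[of x] by (auto simp: indicator_def)
      ultimately show ?thesis by simp
    qed
    then have "AE x in lborel. R x = 0"
      using integrable_L2_support[OF RL2 R0] by (intro fundamental_lemma_box[of R a b] R0) auto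
    then have "L2_norm lborel R = 0" using RL2 by (simp add: L2_norm_0_iff)
    then show ?thesis using borel_rep_L2(2)[OF S R] by simp
  qed
  then show "H_norm a b (1 - \<alpha>) v = 0" by (simp add: H_norm_def)
qed

text \<open>Zero energy makes \<open>W\<close> orthogonal to every continuous function. Being a
  limit of continuous functions restricted to the box, \<open>W\<close> is then orthogonal to
  itself.\<close>

lemma energy_eq_0_imp_AE_0:
  fixes W :: "real ^ 'n::finite \<Rightarrow> real"
  assumes \<alpha>: "0 < \<alpha>" "\<alpha> < 1" and W: "L2 lborel W" and W0: "\<And>x. x \<notin> box a b \<Longrightarrow> W x = 0"
    and L: "b $ i - a $ i \<le> L"
    and 0: "frac_energy \<alpha> L (axis i 1) W = 0"
    and v: "\<And>k. continuous_on UNIV (v k)"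
    and lim: "(\<lambda>k::nat. L2_norm lborel (\<lambda>x. indicator (box a b) x * v k x - W x)) \<longlonglongrightarrow> 0"
  shows "AE x in lborel. W x = 0"
proof -
  have av: "AE R in lborel. 0 < R \<longrightarrow> (AE x in lborel. segment_integral (axis i 1) R W x = 0)"
  proof (rule energy_eq_0D[OF \<alpha> W _ 0])
    show "corr (axis i 1) W r = 0" if "L \<le> r" for r
      using W0 L that by (intro corr_eq_0_outside[of a b]) auto
  qed
  have "(LBINT x. W x * (indicator (box a b) x * v k x)) = 0" for k
  proof -
    have eq: "W x * (indicator (box a b) x * v k x) = W x * v k x" for x using W0[of x] by (auto simp: indicator_def)
    show ?thesis unfolding eq by (rule averages_0_imp_orthogonal[OF W bounded_box W0 v av])
  qed
  then have "(\<lambda>k::nat. 0) \<longlonglongrightarrow> (LBINT x. W x * W x)"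
    using L2_inner_tendsto[OF L2_box_continuous[OF v] W W lim] by simp
  then have "L2_norm lborel W = 0"
    by (simp add: LIMSEQ_const_iff L2_norm_def power2_eq_square)
  then show ?thesis using W by (simp add: L2_norm_0_iff)
qed

text \<open>The indicator is needed because averages of translates spread beyond the box, while the
  mollified pairing wants a field supported in it.\<close>

definition flux :: "real ^ 'n::finite \<Rightarrow> real ^ 'n \<Rightarrow> real \<Rightarrow> real \<Rightarrow> real \<Rightarrow> real \<Rightarrow> 'n \<Rightarrow> (real ^ 'n \<Rightarrow> real) \<Rightarrow> real ^ 'n \<Rightarrow> real" where
  "flux a b \<alpha> L p q i W x = indicator (box a b) x *
     (p * (1 / Gamma \<alpha> * frac_avg \<alpha> L (axis i 1) W x) + q * (1 / Gamma \<alpha> * frac_avg \<alpha> L (- axis i 1) W x))"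

lemma flux_L2:
  fixes a b :: "real ^ 'n::finite"
  assumes "0 < \<alpha>" "L2 lborel W"
  shows "L2 lborel (flux a b \<alpha> L p q i W)"
proof -
  have "L2 lborel (\<lambda>x. p * (1 / Gamma \<alpha> * frac_avg \<alpha> L (axis i 1) W x) + q * (1 / Gamma \<alpha> * frac_avg \<alpha> L (- axis i 1) W x))" (is "L2 _ ?f")
    by (intro L2_add L2_cmult frac_avg_L2 assms)
  moreover have "L2 lborel (\<lambda>x. indicator (box a b) x * f x)" if f: "L2 lborel f" for f :: "real ^ 'n \<Rightarrow> real"
  proof -
    have [measurable]: "f \<in> borel_measurable borel" using f by (rule L2_borel)
    have "integrable lborel (\<lambda>x. (indicator (box a b) x * f x)\<^sup>2)"
      by (rule Bochner_Integration.integrable_bound[of _ "\<lambda>x. (f x)\<^sup>2"])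
         (use f in \<open>auto simp: L2_def indicator_def\<close>)
    then show ?thesis by (simp add: L2_def)
  qed
  ultimately show ?thesis unfolding flux_def[abs_def] by blast
qed

lemma flux_eq_0_outside: "x \<notin> box a b \<Longrightarrow> flux a b \<alpha> L p q i W x = 0"
  by (simp add: flux_def)

lemma flux_diff:
  assumes "0 < \<alpha>" "L2 lborel V" "L2 lborel W"
  shows "AE x in lborel. flux a b \<alpha> L p q i (\<lambda>x. V x - W x) x = flux a b \<alpha> L p q i V x - flux a b \<alpha> L p q i W x"
  using frac_avg_diff[OF assms, of L "axis i 1"] frac_avg_diff[OF assms, of L "- axis i 1"]
proof eventually_elim
  case (elim x)
  show ?case unfolding flux_def elim by (simp add: algebra_simps diff_divide_distrib)
qed

lemma flux_rep:
  assumes "0 < \<alpha>" and rep: "borel_rep (box a b) w W" and W: "L2 lborel W" and L: "b $ i - a $ i \<le> L"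
  shows "borel_rep (box a b) (\<lambda>x. p * J_left a \<alpha> i w x + q * J_right b \<alpha> i w x) (flux a b \<alpha> L p q i W)"
proof -
  have "AE x in lborel. x \<in> box a b \<longrightarrow> flux a b \<alpha> L p q i W x = p * J_left a \<alpha> i w x + q * J_right b \<alpha> i w x"
    using J_left_AE[OF rep L, of \<alpha>] J_right_AE[OF rep L, of \<alpha>]
    by eventually_elim (simp add: flux_def)
  then show ?thesis
    using L2_borel[OF flux_L2[OF assms(1) W]] by (simp add: borel_rep_def flux_eq_0_outside)
qed

lemma flux_energy:
  assumes \<alpha>: "0 < \<alpha>" and W: "L2 lborel W" and W0: "\<And>x. x \<notin> box a b \<Longrightarrow> W x = 0"
  shows "(LBINT x. flux a b \<alpha> L p q i W x * W x) = (p + q) / Gamma \<alpha> *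
    frac_energy \<alpha> L (axis i 1) W"
proof -
  let ?E = "frac_energy \<alpha> L (axis i 1) W"
  have 1: "(LBINT x. W x * frac_avg \<alpha> L (axis i 1) W x) = ?E"
    by (rule frac_avg_inner[OF \<alpha> W])
  have 2: "(LBINT x. W x * frac_avg \<alpha> L (- axis i 1) W x) = ?E"
    using frac_avg_inner[OF \<alpha> W, of L "- axis i 1"] by (simp add: corr_uminus[OF L2_borel[OF W]])
  have "(LBINT x. flux a b \<alpha> L p q i W x * W x)
     = (LBINT x. p / Gamma \<alpha> * (W x * frac_avg \<alpha> L (axis i 1) W x) + q / Gamma \<alpha> * (W x * frac_avg \<alpha> L (- axis i 1) W x))"
  proof (rule Bochner_Integration.integral_cong[OF refl])
    fix x
    show "flux a b \<alpha> L p q i W x * W x = p / Gamma \<alpha> * (W x * frac_avg \<alpha> L (axis i 1) W x) + q / Gamma \<alpha> * (W x * frac_avg \<alpha> L (- axis i 1) W x)"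
      using W0[of x] by (cases "x \<in> box a b") (auto simp: flux_def algebra_simps)
  qed
  also have "\<dots> = p / Gamma \<alpha> * ?E + q / Gamma \<alpha> * ?E"
    using L2_prod_integrable[OF W frac_avg_L2[OF \<alpha> W]] by (simp add: 1 2)
  finally show ?thesis by (simp add: add_divide_distrib distrib_right)
qed

text \<open>The data of a solution other than the equation, carried over from the box to Borel
  functions on the whole space.\<close>

lemma dirichlet_solution_approximation:
  fixes a b :: "real ^ 'n::finite"
  assumes u: "dirichlet_solution a b \<alpha> p q f g u"
  obtains U W \<phi> where "borel_rep (box a b) u U" "L2 lborel U"
    "\<And>i. borel_rep (box a b) (RL_deriv a b 1 i u) (W i)" "\<And>i. L2 lborel (W i)" "\<And>k. smooth (\<phi> k)"
    "(\<lambda>k::nat. L2_norm lborel (\<lambda>x. indicator (box a b) x * \<phi> k x - U x)) \<longlonglongrightarrow> 0"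
    "\<And>i. (\<lambda>k. L2_norm lborel (\<lambda>x. indicator (box a b) x * pderiv_at i (\<phi> k) x - W i x)) \<longlonglongrightarrow> 0"
    "\<And>i c. c \<in> {a $ i, b $ i} \<Longrightarrow> L2 (face_measure a b i c) g"
    "\<And>i c. c \<in> {a $ i, b $ i} \<Longrightarrow> (\<lambda>k. L2_norm (face_measure a b i c) (\<lambda>x. \<phi> k x - g x)) \<longlonglongrightarrow> 0"
proof -
  have S: "box a b \<in> sets borel" by simp
  have uH: "u \<in> H_space a b 1" and tr: "has_trace a b u g" using u by (auto simp: dirichlet_solution_def)
  have uL: "L2 (lebesgue_on (box a b)) u" using uH by (simp add: H_space_def)
  obtain U where U: "borel_rep (box a b) u U" using borel_rep_ex[OF S] uL by (auto simp: L2_def)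
  have wL: "L2 (lebesgue_on (box a b)) (RL_deriv a b 1 i u)" for i using uH by (rule RL_deriv_L2)
  have "\<exists>W. borel_rep (box a b) (RL_deriv a b 1 i u) W" for i
    using borel_rep_ex[OF S] wL[of i] by (auto simp: L2_def)
  then obtain W where W: "\<And>i. borel_rep (box a b) (RL_deriv a b 1 i u) (W i)" by metis
  from tr obtain \<phi> where \<phi>: "\<And>k. smooth (\<phi> k)"
    "(\<lambda>k::nat. L2_norm (lebesgue_on (box a b)) (\<lambda>x. \<phi> k x - u x)) \<longlonglongrightarrow> 0"
    "\<And>i. (\<lambda>k. L2_norm (lebesgue_on (box a b)) (\<lambda>x. pderiv_at i (\<phi> k) x - RL_deriv a b 1 i u x)) \<longlonglongrightarrow> 0"
    "\<And>i c. c \<in> {a $ i, b $ i} \<Longrightarrow> (\<lambda>k. L2_norm (face_measure a b i c) (\<lambda>x. \<phi> k x - g x)) \<longlonglongrightarrow> 0"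
    "\<And>i c. c \<in> {a $ i, b $ i} \<Longrightarrow> L2 (face_measure a b i c) g"
    unfolding has_trace_def by blast
  have r1: "L2_norm (lebesgue_on (box a b)) (\<lambda>x. \<phi> k x - u x) = L2_norm lborel (\<lambda>x. indicator (box a b) x * \<phi> k x - U x)" for k
    by (intro borel_rep_L2(2)[OF S] borel_rep_diff borel_rep_indicator S U smooth_borel \<phi>)
  have r2: "L2_norm (lebesgue_on (box a b)) (\<lambda>x. pderiv_at i (\<phi> k) x - RL_deriv a b 1 i u x)
      = L2_norm lborel (\<lambda>x. indicator (box a b) x * pderiv_at i (\<phi> k) x - W i x)" for k i
    by (intro borel_rep_L2(2)[OF S] borel_rep_diff borel_rep_indicator S W smooth_borel smooth_pderiv \<phi>)
  show ?thesis
    by (rule that[OF U _ W _ \<phi>(1) \<phi>(2)[unfolded r1] \<phi>(3)[unfolded r2] \<phi>(5,4)])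
       (use uL wL borel_rep_L2(1)[OF S U] borel_rep_L2(1)[OF S W] in auto)
qed

theorem theorem2p4:
  fixes a b :: "real ^ 'n::finite" and \<alpha> :: real and p q :: "'n \<Rightarrow> real"
    and f :: "'n functional" and g :: "real ^ 'n \<Rightarrow> real"
  assumes "\<And>i. a $ i < b $ i"
    and "0 < \<alpha>" and "\<alpha> < 1"
    and "\<And>i. 0 < p i" and "\<And>i. 0 < q i" and "(\<Sum>i\<in>UNIV. p i + q i) = 1"
    and "distribution (box a b) f"
    and "\<exists>u. dirichlet_solution a b \<alpha> p q f g u \<and> \<not> (AE x in lebesgue_on (box a b). u x = 0)"
  shows "\<forall>u1 u2. dirichlet_solution a b \<alpha> p q f g u1 \<and> dirichlet_solution a b \<alpha> p q f g u2 \<longrightarrow>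
     (\<lambda>x. u1 x - u2 x) \<in> H_space a b (1 - \<alpha>) \<and> H_norm a b (1 - \<alpha>) (\<lambda>x. u1 x - u2 x) = 0"
proof (intro allI impI)
  fix u1 u2
  assume sol: "dirichlet_solution a b \<alpha> p q f g u1 \<and> dirichlet_solution a b \<alpha> p q f g u2"
  note ab = assms(1) and \<alpha> = assms(2,3)
  let ?S = "box a b"
  have S: "?S \<in> sets borel" by simp
  obtain U1 W1 \<phi>1 where 1: "borel_rep ?S u1 U1" "L2 lborel U1"
      "\<And>i. borel_rep ?S (RL_deriv a b 1 i u1) (W1 i)" "\<And>i. L2 lborel (W1 i)" "\<And>k. smooth (\<phi>1 k)"
      "(\<lambda>k::nat. L2_norm lborel (\<lambda>x. indicator ?S x * \<phi>1 k x - U1 x)) \<longlonglongrightarrow> 0"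
      "\<And>i. (\<lambda>k. L2_norm lborel (\<lambda>x. indicator ?S x * pderiv_at i (\<phi>1 k) x - W1 i x)) \<longlonglongrightarrow> 0"
      "\<And>i c. c \<in> {a $ i, b $ i} \<Longrightarrow> L2 (face_measure a b i c) g"
      "\<And>i c. c \<in> {a $ i, b $ i} \<Longrightarrow> (\<lambda>k. L2_norm (face_measure a b i c) (\<lambda>x. \<phi>1 k x - g x)) \<longlonglongrightarrow> 0"
    by (rule dirichlet_solution_approximation[OF sol[THEN conjunct1]]) (rule that; assumption)
  obtain U2 W2 \<phi>2 where 2: "borel_rep ?S u2 U2" "L2 lborel U2"
      "\<And>i. borel_rep ?S (RL_deriv a b 1 i u2) (W2 i)" "\<And>i. L2 lborel (W2 i)" "\<And>k. smooth (\<phi>2 k)"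
      "(\<lambda>k::nat. L2_norm lborel (\<lambda>x. indicator ?S x * \<phi>2 k x - U2 x)) \<longlonglongrightarrow> 0"
      "\<And>i. (\<lambda>k. L2_norm lborel (\<lambda>x. indicator ?S x * pderiv_at i (\<phi>2 k) x - W2 i x)) \<longlonglongrightarrow> 0"
      "\<And>i c. c \<in> {a $ i, b $ i} \<Longrightarrow> L2 (face_measure a b i c) g"
      "\<And>i c. c \<in> {a $ i, b $ i} \<Longrightarrow> (\<lambda>k. L2_norm (face_measure a b i c) (\<lambda>x. \<phi>2 k x - g x)) \<longlonglongrightarrow> 0"
    by (rule dirichlet_solution_approximation[OF sol[THEN conjunct2]]) (rule that; assumption)
  define \<psi> where "\<psi> k x = \<phi>1 k x - \<phi>2 k x" for k x
  define W where "W i x = W1 i x - W2 i x" for i x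
  define U where "U x = U1 x - U2 x" for x
  \<comment> \<open>One cut-off length for all directions: the sum of the widths is at least each of
    them.\<close>
  define L where "L = (\<Sum>i\<in>UNIV. b $ i - a $ i)"
  have L: "b $ i - a $ i \<le> L" for i
    unfolding L_def by (rule member_le_sum) (use ab less_imp_le in auto)
  have WL: "L2 lborel (W i)" for i unfolding W_def using 1(4) 2(4) by (intro L2_diff)
  have W0: "x \<notin> ?S \<Longrightarrow> W i x = 0" for i x using 1(3) 2(3) by (simp add: W_def borel_rep_def)
  have \<psi>: "smooth (\<psi> k)" for k unfolding \<psi>_def[abs_def] by (intro smooth_diff 1 2)
  have smL2: "L2 lborel (\<lambda>x. indicator ?S x * h x)" if "smooth h" for h
    using that by (intro L2_box_continuous smooth_continuous)
  have \<psi>U: "(\<lambda>k. L2_norm lborel (\<lambda>x. indicator ?S x * \<psi> k x - U x)) \<longlonglongrightarrow> 0"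
  proof -
    have "(\<lambda>k. L2_norm lborel (\<lambda>x. (indicator ?S x * \<phi>1 k x - U1 x) - (indicator ?S x * \<phi>2 k x - U2 x))) \<longlonglongrightarrow> 0"
      by (intro L2_norm_diff_tendsto_0 L2_diff smL2 1 2)
    then show ?thesis by (simp add: \<psi>_def U_def algebra_simps)
  qed
  let ?D = "\<lambda>k i x. indicator ?S x * pderiv_at i (\<psi> k) x"
  have \<psi>W: "(\<lambda>k. L2_norm lborel (\<lambda>x. ?D k i x - W i x)) \<longlonglongrightarrow> 0" for i
  proof -
    have "(\<lambda>k. L2_norm lborel (\<lambda>x. (indicator ?S x * pderiv_at i (\<phi>1 k) x - W1 i x) - (indicator ?S x * pderiv_at i (\<phi>2 k) x - W2 i x))) \<longlonglongrightarrow> 0"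
      by (intro L2_norm_diff_tendsto_0 L2_diff smL2 smooth_pderiv 1 2)
    then show ?thesis by (simp add: \<psi>_def[abs_def] W_def pderiv_at_diff[OF 1(5) 2(5)] algebra_simps)
  qed
  \<comment> \<open>The common boundary datum \<open>g\<close> cancels in the difference of the two
    approximations.\<close>
  have face: "(\<lambda>k. L2_norm (face_measure a b i c) (\<psi> k)) \<longlonglongrightarrow> 0" if c: "c \<in> {a $ i, b $ i}" for i c
  proof -
    have "L2 (face_measure a b i c) h" if "smooth h" for h
      using that c less_imp_le[OF ab[of i]] by (intro L2_face_measure_continuous smooth_continuous) auto
    then have "L2 (face_measure a b i c) (\<lambda>x. \<phi>1 k x - g x)" "L2 (face_measure a b i c) (\<lambda>x. \<phi>2 k x - g x)" for k
      using c 1(5,8) 2(5) by (auto intro!: L2_diff)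
    from L2_norm_diff_tendsto_0[OF this 1(9)[OF c] 2(9)[OF c]]
    have "(\<lambda>k. L2_norm (face_measure a b i c) (\<lambda>x. (\<phi>1 k x - g x) - (\<phi>2 k x - g x))) \<longlonglongrightarrow> 0" .
    then show ?thesis by (simp add: \<psi>_def[abs_def])
  qed
  let ?F = "\<lambda>i. flux a b \<alpha> L (p i) (q i) i"
  \<comment> \<open>The datum \<open>f\<close> cancels as well. The flux of a difference is the
    difference of the fluxes only almost everywhere, so the two sides are compared under the
    integral.\<close>
  have eqn: "(\<Sum>i\<in>UNIV. LBINT x. ?F i (W i) x * pderiv_at i \<phi> x) = 0" if t: "test_function ?S \<phi>" for \<phi>
  proof -
    let ?G = "\<lambda>i V x. ?F i V x * (indicator ?S x * pderiv_at i \<phi> x)"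
    have reg: "distributional_deriv i (regular_distribution ?S (\<lambda>x. p i * J_left a \<alpha> i w x + q i * J_right b \<alpha> i w x)) \<phi>
       = - (LBINT x. ?F i V x * (indicator ?S x * pderiv_at i \<phi> x))"
      if "borel_rep ?S w V" "L2 lborel V" for i w V
      unfolding distributional_deriv_def regular_distribution_def
      using t by (intro arg_cong[where f = uminus] borel_rep_integral(3)[OF S] borel_rep_mult flux_rep \<alpha> that L
          borel_rep_indicator S smooth_borel smooth_pderiv test_function_smooth)
    have sol': "- (\<Sum>i\<in>UNIV. distributional_deriv i (regular_distribution ?S
             (\<lambda>x. p i * J_left a \<alpha> i (RL_deriv a b 1 i u) x + q i * J_right b \<alpha> i (RL_deriv a b 1 i u) x)) \<phi>) = f \<phi>"
      if "dirichlet_solution a b \<alpha> p q f g u" for u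
      using that t by (simp add: dirichlet_solution_def solves_equation_def)
    have e1: "(\<Sum>i\<in>UNIV. LBINT x. ?G i (W1 i) x) = f \<phi>"
      using sol'[OF sol[THEN conjunct1]] unfolding reg[OF 1(3,4)] by (simp add: sum_negf)
    have e2: "(\<Sum>i\<in>UNIV. LBINT x. ?G i (W2 i) x) = f \<phi>"
      using sol'[OF sol[THEN conjunct2]] unfolding reg[OF 2(3,4)] by (simp add: sum_negf)
    have "(LBINT x. ?F i (W i) x * pderiv_at i \<phi> x) =
        (LBINT x. ?G i (W1 i) x) -
        (LBINT x. ?G i (W2 i) x)" for i
    proof -
      have FL: "L2 lborel (?F i V)" if "L2 lborel V" for V using \<alpha>(1) that by (rule flux_L2)
      have ps: "smooth (pderiv_at i \<phi>)" using t by (intro smooth_pderiv test_function_smooth)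
      note P = L2_prod_integrable[OF FL smL2[OF ps]]
      have "(LBINT x. ?F i (W i) x * pderiv_at i \<phi> x) =
        (LBINT x. ?G i (W1 i) x - ?G i (W2 i) x)"
      proof (rule integral_cong_AE)
        have [measurable]: "?F i V \<in> borel_measurable borel" if "L2 lborel V" for V using FL[OF that] by (rule L2_borel)
        show "(\<lambda>x. ?F i (W i) x * pderiv_at i \<phi> x) \<in> borel_measurable lborel"
          using L2_borel[OF FL[OF WL]] smooth_borel[OF ps] by simp
        show "(\<lambda>x. ?G i (W1 i) x - ?G i (W2 i) x) \<in> borel_measurable lborel"
          using P[OF 1(4)] P[OF 2(4)] by (intro borel_measurable_diff borel_measurable_integrable)
        show "AE x in lborel. ?F i (W i) x * pderiv_at i \<phi> x =
            ?G i (W1 i) x - ?G i (W2 i) x"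
          using flux_diff[OF \<alpha>(1) 1(4)[of i] 2(4)[of i], of a b L "p i" "q i" i]
        proof eventually_elim
          case (elim x)
          then show ?case
            unfolding W_def[abs_def] by (cases "x \<in> ?S") (simp_all add: flux_eq_0_outside left_diff_distrib)
        qed
      qed
      also have "\<dots> = (LBINT x. ?G i (W1 i) x) -
        (LBINT x. ?G i (W2 i) x)"
        by (intro Bochner_Integration.integral_diff P 1 2)
      finally show ?thesis .
    qed
    then show ?thesis using e1 e2 by (simp add: sum_subtractf)
  qed
  \<comment> \<open>The largest mollification scale that \<open>test_function_dilated_bump\<close>
    admits in all coordinates.\<close>
  define \<mu> where "\<mu> = Min (range (\<lambda>i. (b $ i - a $ i) / 4))"
  have \<mu>: "0 < \<mu>" "\<And>j. \<mu> \<le> (b $ j - a $ j) / 4"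
  proof -
    show "0 < \<mu>" using ab by (simp add: \<mu>_def)
    show "\<mu> \<le> (b $ j - a $ j) / 4" for j unfolding \<mu>_def by (rule Min_le) auto
  qed
  have "(\<Sum>i\<in>UNIV. LBINT x. ?F i (W i) x * W i x) = 0"
    by (rule pairing_flux_gradient_eq_0[OF \<mu> flux_L2[OF \<alpha>(1) WL] flux_eq_0_outside eqn WL \<psi> \<psi>W face])
  let ?E = "\<lambda>i. frac_energy \<alpha> L (axis i 1) (W i)"
  have E: "0 \<le> ?E i" for i
    by (rule energy_nonneg[OF \<alpha> WL])
       (use W0 L[of i] in \<open>intro corr_eq_0_outside[of a b], auto\<close>)
  have pos: "0 < (p i + q i) / Gamma \<alpha>" for i
    using assms(4)[of i] assms(5)[of i] Gamma_real_pos[OF \<alpha>(1)] by simp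
  have "(LBINT x. ?F i (W i) x * W i x) = (p i + q i) / Gamma \<alpha> * ?E i" for i
    by (rule flux_energy[OF \<alpha>(1) WL W0])
  with \<open>(\<Sum>i\<in>UNIV. LBINT x. ?F i (W i) x * W i x) = 0\<close>
  have "(\<Sum>i\<in>UNIV. (p i + q i) / Gamma \<alpha> * ?E i) = 0" by simp
  moreover have nonneg: "0 \<le> (p i + q i) / Gamma \<alpha> * ?E i" for i
    using pos[of i] E[of i] by (intro mult_nonneg_nonneg) (rule less_imp_le)
  ultimately have "\<forall>i\<in>UNIV. (p i + q i) / Gamma \<alpha> * ?E i = 0"
    by (subst (asm) sum_nonneg_eq_0_iff) (rule finite, rule nonneg)
  then have prod_0: "(p i + q i) / Gamma \<alpha> * ?E i = 0" for i by (rule bspec) simp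
  have cancel: "y = 0" if "c * y = 0" "0 < c" for c y :: real using that by simp
  have E0: "?E i = 0" for i by (rule cancel[OF prod_0 pos])
  have WAE: "AE x in lborel. W i x = 0" for i
    by (rule energy_eq_0_imp_AE_0[OF \<alpha> WL W0 L E0 _ \<psi>W]) (assumption, intro smooth_continuous smooth_pderiv \<psi>)
  have grad: "(\<lambda>k. L2_norm lborel (?D k i)) \<longlonglongrightarrow> 0" for i
  proof -
    have "L2_norm lborel (W i) = 0" using WAE WL by (simp add: L2_norm_0_iff)
    then have "(\<lambda>k. L2_norm lborel (\<lambda>x. ?D k i x - W i x) + L2_norm lborel (W i)) \<longlonglongrightarrow> 0"
      using \<psi>W by simp
    then show ?thesis
    proof (rule Lim_null_comparison[rotated], intro always_eventually allI)
      fix k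
      have "L2_norm lborel (\<lambda>x. (?D k i x - W i x) + W i x)
        \<le> L2_norm lborel (\<lambda>x. ?D k i x - W i x) + L2_norm lborel (W i)"
        by (intro L2_norm_triangle L2_diff smL2 smooth_pderiv \<psi> WL)
      then show "norm (L2_norm lborel (?D k i))
        \<le> L2_norm lborel (\<lambda>x. ?D k i x - W i x) + L2_norm lborel (W i)"
        by (simp add: L2_norm_nonneg)
    qed
  qed
  have \<psi>0: "(\<lambda>k. L2_norm lborel (\<lambda>x. indicator ?S x * \<psi> k x)) \<longlonglongrightarrow> 0"
  proof -
    \<comment> \<open>The inequality in a single direction suffices, and there is one because types
      are nonempty.\<close>
    fix i :: 'n
    let ?R = "\<lambda>k. 2 * (b $ i - a $ i) * (L2_norm (face_measure a b i (a $ i)) (\<psi> k))\<^sup>2 +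
     4 * (b $ i - a $ i)\<^sup>2 * (L2_norm lborel (?D k i))\<^sup>2"
    have "?R \<longlonglongrightarrow> 2 * (b $ i - a $ i) * 0\<^sup>2 + 4 * (b $ i - a $ i)\<^sup>2 * 0\<^sup>2"
      by (intro tendsto_intros face grad) simp
    then have lim: "?R \<longlonglongrightarrow> 0"
      by (simp only: power_zero_numeral mult_zero_right add_0_right)
    have "(\<lambda>k. (L2_norm lborel (\<lambda>x. indicator ?S x * \<psi> k x))\<^sup>2) \<longlonglongrightarrow> 0"
    proof (rule Lim_null_comparison[OF _ lim], intro always_eventually allI)
      fix k
      show "norm ((L2_norm lborel (\<lambda>x. indicator ?S x * \<psi> k x))\<^sup>2) \<le> ?R k"
        unfolding real_norm_def abs_power2 by (rule poincare_box[OF ab \<psi>])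
    qed
    then show ?thesis by simp
  qed
  have "L2_norm lborel U = 0"
  proof -
    have UL: "L2 lborel U" unfolding U_def[abs_def] by (intro L2_diff 1 2)
    \<comment> \<open>The integrand is \<open>U x\<close> for every \<open>k\<close>, written as a
      difference of two null sequences, so its constant norm is 0.\<close>
    have "(\<lambda>k. L2_norm lborel (\<lambda>x. indicator ?S x * \<psi> k x - (indicator ?S x * \<psi> k x - U x))) \<longlonglongrightarrow> 0"
      by (intro L2_norm_diff_tendsto_0 L2_diff smL2 \<psi> UL \<psi>0 \<psi>U)
    then show ?thesis by (simp add: LIMSEQ_const_iff)
  qed
  moreover have "L2 lborel U" unfolding U_def[abs_def] by (intro L2_diff 1 2)
  ultimately have "AE x in lborel. U x = 0" by (simp add: L2_norm_0_iff)
  moreover have "borel_rep ?S (\<lambda>x. u1 x - u2 x) U"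
    unfolding U_def[abs_def] by (intro borel_rep_diff 1 2)
  ultimately have "borel_rep ?S (\<lambda>x. u1 x - u2 x) (\<lambda>_. 0)"
    by (auto simp: borel_rep_def elim!: AE_mp)
  from H_norm_eq_0_if_AE_0[OF \<alpha> this]
  show "(\<lambda>x. u1 x - u2 x) \<in> H_space a b (1 - \<alpha>) \<and> H_norm a b (1 - \<alpha>) (\<lambda>x. u1 x - u2 x) = 0"
    by blast
qed

end
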